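(* Let $p \geq q$ and let $\mathbf{Y} = (Y_{ij})$ be a random $p \times q$ real matrix with independent entries $Y_{ij} \sim \mathcal{N}(\mu_{ij}, \sigma^2)$, where $\mu = (\mu_{ij})$ is a fixed $p \times q$ matrix and $\sigma^2 > 0$. Consider a spectral function estimator $$\hat{\mu} = \sum_{k=1}^q f_k(d_k) u_k v_k^T,$$ where $\mathbf{Y} = \sum_{k=1}^q d_k u_k v_k^T$ is the singular value decomposition with $d_1 > d_2 > \ldots > d_q \geq 0$, and $f_k : [0,\infty) \to [0,\infty)$, $k = 1,\ldots,q$, are the spectral functions. Assume that $\hat\mu$ has finite second moment, $E\|\hat\mu\|_F^2 < \infty$, and that the spectral functions fulfill that $f_1, \ldots, f_{q-1}$ are continuously differentiable on $(0,\infty)$, $f_q$ is continuously differentiable on $[0,\infty)$, $f_k \geq f_l$ for $k < l$, and $f_k' \geq 0$ for all $k$. Then $$\mathrm{SURE} = \|\mathbf{Y} - \hat{\mu}\|_F^2 - \sigma^2 pq + 2\sigma^2\, \nabla \cdot \hat{\mu}$$ is an unbiased estimate of the risk, i.e. $E(\mathrm{SURE}) = E\|\hat{\mu} - \mu\|_F^2$, and $$\nabla \cdot \hat{\mu} = (p - q) \sum_{k=1}^q \frac{f_k(d_k)}{d_k} + \sum_{k=1}^q f_k'(d_k) + 2 \sum_{\substack{k,l=1 \\ k \neq l}}^q \frac{d_k f_k(d_k)}{d_k^2 - d_l^2}$$ whenever $\mathbf{Y}$ has $q$ distinct singular values.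
   Context: In the singular value decomposition, $u_1,\ldots,u_q \in \mathbb{R}^p$ are orthonormal, $v_1,\ldots,v_q \in \mathbb{R}^q$ are orthonormal, and $d_1,\ldots,d_q \ge 0$ are the $q$ singular values of $\mathbf{Y}$. $\|\cdot\|_F$ is the Frobenius norm. For an estimator $\hat\mu = \hat\mu(\mathbf{Y})$ with values in the $p \times q$ matrices, the divergence is $\nabla \cdot \hat{\mu} = \sum_{i=1}^p\sum_{j=1}^q \partial \hat{\mu}_{ij}/\partial Y_{ij}$, i.e. the divergence under the identification of $p\times q$ matrices with $\mathbb{R}^{pq}$. The risk of $\hat\mu$ is $E\|\hat{\mu} - \mu\|_F^2$. The estimator and its divergence are considered on the set of matrices with $q$ distinct singular values; expectations are with respect to the distribution of $\mathbf{Y}$, and values on a Lebesgue null set are irrelevant. The inequality $f_k \ge f_l$ is pointwise on $[0,\infty)$.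
   Formalization: Adds: p > q or f_q(0) = 0; otherwise unbiasedness fails (p = q = 1, f_1 = 1 gives sign(Y)). If d_q = 0 the divergence formula is claimed only when f_q(0) = 0, with f_q(d_q)/d_q read as f_q'(0); for f_q(0) > 0 the estimator and formula are undefined there. *)

theory Defs
  imports "HOL-Probability.Probability"
begin

text \<open>A \<open>p \<times> q\<close> matrix is an element of \<^typ>\<open>real ^ 'q ^ 'p\<close>.  The library norm of this type is
  \<open>sqrt (\<Sum>i j. (X $ i $ j)\<^sup>2)\<close>, i.e. the Frobenius norm.\<close>

definition outer_prod :: "real ^ 'p \<Rightarrow> real ^ 'q \<Rightarrow> real ^ 'q ^ 'p"
  where "outer_prod a b = (\<chi> i j. a $ i * b $ j)"

text \<open>The thin singular value decomposition, in which \<^term>\<open>d\<close>, \<^term>\<open>u\<close>, \<^term>\<open>v\<close> only matter on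
  \<open>{1..q}\<close>.  The singular values are required to be strictly decreasing, so a decomposition of this
  kind exists exactly for the matrices with \<open>q\<close> distinct singular values.  The last one may vanish.
  The decomposition is unique up to a common sign of \<open>u k\<close> and \<open>v k\<close>, except that \<open>u q\<close> is not
  determined if \<open>d q = 0\<close>.\<close>

definition distinct_svd ::
    "real ^ 'q ^ 'p \<Rightarrow> (nat \<Rightarrow> real) \<Rightarrow> (nat \<Rightarrow> real ^ 'p) \<Rightarrow> (nat \<Rightarrow> real ^ 'q) \<Rightarrow> bool"
  where "distinct_svd X d u v \<longleftrightarrow>
    (\<forall>k\<in>{1..CARD('q)}. \<forall>l\<in>{1..CARD('q)}. u k \<bullet> u l = (if k = l then 1 else 0)) \<and>
    (\<forall>k\<in>{1..CARD('q)}. \<forall>l\<in>{1..CARD('q)}. v k \<bullet> v l = (if k = l then 1 else 0)) \<and>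
    (\<forall>k\<in>{1..CARD('q)}. 0 \<le> d k) \<and>
    (\<forall>k\<in>{1..CARD('q)}. \<forall>l\<in>{1..CARD('q)}. k < l \<longrightarrow> d l < d k) \<and>
    X = (\<Sum>k=1..CARD('q). d k *\<^sub>R outer_prod (u k) (v k))"

text \<open>\<^term>\<open>entry_fun F X i j\<close> is the \<open>(i, j)\<close> entry of \<^term>\<open>F\<close> as a function of the increment of
  the \<open>(i, j)\<close> entry of its argument.\<close>

definition entry_fun ::
    "(real ^ 'q ^ 'p \<Rightarrow> real ^ 'q ^ 'p) \<Rightarrow> real ^ 'q ^ 'p \<Rightarrow> 'p \<Rightarrow> 'q \<Rightarrow> real \<Rightarrow> real"
  where "entry_fun F X i j t = F (X + t *\<^sub>R axis i (axis j 1)) $ i $ j"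

definition has_divergence_terms :: "(real ^ 'q ^ 'p \<Rightarrow> real ^ 'q ^ 'p) \<Rightarrow> real ^ 'q ^ 'p \<Rightarrow> bool"
  where "has_divergence_terms F X \<longleftrightarrow> (\<forall>i j. entry_fun F X i j differentiable (at 0))"

definition divergence :: "(real ^ 'q ^ 'p \<Rightarrow> real ^ 'q ^ 'p) \<Rightarrow> real ^ 'q ^ 'p \<Rightarrow> real"
  where "divergence F X = (\<Sum>i\<in>UNIV. \<Sum>j\<in>UNIV. deriv (entry_fun F X i j) 0)"

definition sure :: "real \<Rightarrow> (real ^ 'q ^ 'p \<Rightarrow> real ^ 'q ^ 'p) \<Rightarrow> real ^ 'q ^ 'p \<Rightarrow> real"
  where "sure \<sigma> F X = (norm (X - F X))\<^sup>2 - \<sigma>\<^sup>2 * real CARD('p) * real CARD('q)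
                        + 2 * \<sigma>\<^sup>2 * divergence F X"

text \<open>A spectral function estimator: on every matrix with \<open>q\<close> distinct singular values at which the
  formula does not depend on the choice of the decomposition, it is given by the formula.  This fails
  only if \<open>d q = 0\<close> and \<open>f q 0 \<noteq> 0\<close>, where the undetermined \<open>u q\<close> enters.  The values on the other
  matrices, which form a Lebesgue null set, are arbitrary.\<close>

definition spectral_estimator ::
    "(nat \<Rightarrow> real \<Rightarrow> real) \<Rightarrow> (real ^ 'q ^ 'p \<Rightarrow> real ^ 'q ^ 'p) \<Rightarrow> bool"
  where "spectral_estimator f F \<longleftrightarrow>
    (\<forall>X d u v. distinct_svd X d u v \<and> (d CARD('q) > 0 \<or> f CARD('q) 0 = 0) \<longrightarrow>
       F X = (\<Sum>k=1..CARD('q). f k (d k) *\<^sub>R outer_prod (u k) (v k)))"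

end

theory Submission
  imports Defs
begin

text \<open>The estimator is the gradient of the convex function \<open>\<Sum>k. \<Phi> k (d k)\<close> with \<open>\<Phi> k\<close> a primitive of
  \<open>f k\<close>, so each single partial derivative \<open>\<partial>\<mu>\<^sub>i\<^sub>j / \<partial>Y\<^sub>i\<^sub>j\<close> is nonnegative.  Hence Stein's
  identity can be proved entry by entry with Tonelli's theorem, and the integrability of the divergence
  is a consequence instead of a hypothesis.  This requires the estimator to be
  differentiable along almost every line parallel to a coordinate axis, that is, such a line must miss
  the matrices with a repeated singular value, a set of codimension 2.  Indeed a repeated singular
  value of \<open>X\<close> is shared by \<open>X\<close> without row \<open>i\<close> and \<open>X\<close> without column \<open>j\<close>, two matrices that are constant on
  the line through \<open>X\<close> in direction \<open>(i, j)\<close>, and the vanishing of the resultant of their spectra is a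
  nontrivial polynomial condition.\<close>

section \<open>Stein's identity for nondecreasing functions of one variable\<close>

text \<open>Near repeated singular values single terms of the divergence blow up like
  \<open>1 / (d k - d l)\<close>, with both signs. What bounds the expectation of a nonnegative
  partial derivative is the other side of Stein's identity, the product of an entry of the estimator
  with the noise, which is integrable by Cauchy-Schwarz and the finite second moment.

  The polynomial attached to a line has to be constant along it: then one null set serves all points
  of the line at once, whereas the discriminant of \<open>X^T X\<close> varies along the line. The
  resultant appears as \<open>det (sylvester A B)\<close>, the product of all differences between an
  eigenvalue of \<open>A\<close> and one of \<open>B\<close>.

  The left singular vectors are eliminated by \<open>d k u k = X v k\<close>: the estimator is the
  sum of \<open>f k (d k) / d k\<close> times \<open>X v k (v k)^T\<close>. This form survives
  \<open>d q = 0\<close>, where \<open>u q\<close> is undetermined and \<open>d q\<close> need not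
  be differentiable. For \<open>p = q\<close> that case cannot be avoided: the determinant is affine
  in each entry, so almost every line meets the singular matrices.\<close>

lemma borel_measurable_DERIV:
  fixes G D :: "real \<Rightarrow> real"
  assumes "\<And>t. (G has_real_derivative D t) (at t)"
  shows "D \<in> borel_measurable borel"
proof -
  have [measurable]: "G \<in> borel_measurable borel"
    using assms by (intro borel_measurable_continuous_onI) (meson DERIV_isCont continuous_at_imp_continuous_on)
  have L: "(\<lambda>n. inverse (real (Suc n))) \<longlonglongrightarrow> 0"
    by (rule LIMSEQ_inverse_real_of_nat)
  have *: "(\<lambda>n. (G (t + inverse (real (Suc n))) - G t) / inverse (real (Suc n))) \<longlonglongrightarrow> D t" for t
  proof -
    have "((\<lambda>h. (G (t + h) - G t) / h) \<longlongrightarrow> D t) (at 0)"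
      using assms[of t] by (simp add: DERIV_def)
    moreover have "filterlim (\<lambda>n. inverse (real (Suc n))) (at 0) sequentially"
      using L by (auto simp: filterlim_at)
    ultimately show ?thesis by (rule filterlim_compose)
  qed
  show ?thesis
    by (rule borel_measurable_LIMSEQ_real[OF *]) measurable
qed

lemma normal_density_DERIV:
  assumes "\<sigma> > 0"
  shows "((\<lambda>t. - (\<sigma>\<^sup>2 * normal_density m \<sigma> t)) has_real_derivative (t - m) * normal_density m \<sigma> t) (at t)"
proof -
  have "((\<lambda>t. exp (- (t - m)\<^sup>2 / (2 * \<sigma>\<^sup>2))) has_real_derivative
      exp (- (t - m)\<^sup>2 / (2 * \<sigma>\<^sup>2)) * (- (t - m) / \<sigma>\<^sup>2)) (at t)"
    using assms by (auto intro!: derivative_eq_intros simp: power2_eq_square field_simps)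
  from DERIV_cmult[OF this, of "- (\<sigma>\<^sup>2 * (1 / sqrt (2 * pi * \<sigma>\<^sup>2)))"]
  have "((\<lambda>t. - (\<sigma>\<^sup>2 * normal_density m \<sigma> t)) has_real_derivative
      - (\<sigma>\<^sup>2 * normal_density m \<sigma> t) * (- (t - m) / \<sigma>\<^sup>2)) (at t)"
    unfolding normal_density_def by (simp add: mult.assoc)
  moreover have "- (\<sigma>\<^sup>2 * normal_density m \<sigma> t) * (- (t - m) / \<sigma>\<^sup>2) = (t - m) * normal_density m \<sigma> t"
    using assms by (simp add: field_simps)
  ultimately show ?thesis by metis
qed

lemma normal_density_tendsto_0:
  assumes "\<sigma> > 0"
  shows "(normal_density m \<sigma> \<longlongrightarrow> 0) at_top"
proof -
  have "filterlim (\<lambda>t::real. (t - m)\<^sup>2 / (2 * \<sigma>\<^sup>2)) at_top at_top"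
  proof -
    have "filterlim (\<lambda>t::real. (t - m)\<^sup>2) at_top at_top"
      using filterlim_tendsto_add_at_top[OF tendsto_const[of "- m"] filterlim_ident]
      by (intro filterlim_pow_at_top) auto
    from filterlim_tendsto_pos_mult_at_top[OF tendsto_const[of "inverse (2 * \<sigma>\<^sup>2)"] _ this]
    show ?thesis using assms by (simp add: field_simps)
  qed
  then have "((\<lambda>t. exp (- ((t - m)\<^sup>2 / (2 * \<sigma>\<^sup>2)))) \<longlongrightarrow> 0) at_top"
    by (intro filterlim_compose[OF exp_at_bot]) (simp add: filterlim_uminus_at_top[symmetric])
  then have "((\<lambda>t. 1 / sqrt (2 * pi * \<sigma>\<^sup>2) * exp (- ((t - m)\<^sup>2 / (2 * \<sigma>\<^sup>2)))) \<longlongrightarrow> 1 / sqrt (2 * pi * \<sigma>\<^sup>2) * 0) at_top"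
    by (rule tendsto_mult_left)
  then show ?thesis
    unfolding normal_density_def by simp
qed

text \<open>\<open>(t - m) \<phi>\<close> is the derivative of
  \<open>- \<sigma>\<^sup>2 \<phi>\<close>, so integrating it over a tail reproduces the density at
  the endpoint. This is the inner integral in Stein's identity.\<close>

lemma nn_integral_normal_tail:
  assumes "\<sigma> > 0" "m \<le> s"
  shows "(\<integral>\<^sup>+t. ennreal ((t - m) * normal_density m \<sigma> t) * indicator {s..} t \<partial>lborel)
           = ennreal (\<sigma>\<^sup>2 * normal_density m \<sigma> s)"
proof -
  have "((\<lambda>t. - (\<sigma>\<^sup>2 * normal_density m \<sigma> t)) \<longlongrightarrow> - (\<sigma>\<^sup>2 * 0)) at_top"
    by (intro tendsto_intros normal_density_tendsto_0 assms)
  then show ?thesis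
    using assms
    by (subst nn_integral_FTC_atLeast[where F="\<lambda>t. - (\<sigma>\<^sup>2 * normal_density m \<sigma> t)" and T=0])
       (auto intro!: normal_density_DERIV mult_nonneg_nonneg)
qed

text \<open>The reflection of \<open>t\<close> at \<open>m\<close> preserves the density and
  exchanges the two tails.\<close>

lemma nn_integral_normal_lower_tail:
  assumes "\<sigma> > 0" "s \<le> m"
  shows "(\<integral>\<^sup>+t. ennreal ((m - t) * normal_density m \<sigma> t) * indicator {..s} t \<partial>lborel)
           = ennreal (\<sigma>\<^sup>2 * normal_density m \<sigma> s)"
proof -
  have r: "normal_density m \<sigma> (2 * m - t) = normal_density m \<sigma> t" for t
    unfolding normal_density_def by (simp add: power2_eq_square algebra_simps)
  have "(\<integral>\<^sup>+t. ennreal ((m - t) * normal_density m \<sigma> t) * indicator {..s} t \<partial>lborel)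
      = (\<integral>\<^sup>+t. ennreal ((m - (2 * m - t)) * normal_density m \<sigma> (2 * m - t)) * indicator {..s} (2 * m - t) \<partial>lborel)"
    by (subst nn_integral_real_affine[where c="-1" and t="2 * m"]) auto
  also have "\<dots> = (\<integral>\<^sup>+t. ennreal ((t - m) * normal_density m \<sigma> t) * indicator {2 * m - s..} t \<partial>lborel)"
    by (intro nn_integral_cong) (auto simp: r indicator_def)
  also have "\<dots> = ennreal (\<sigma>\<^sup>2 * normal_density m \<sigma> s)"
    using assms by (subst nn_integral_normal_tail) (auto simp: r)
  finally show ?thesis .
qed

lemma nn_integral_derivative_segment:
  fixes G D :: "real \<Rightarrow> real"
  assumes G: "\<And>t. (G has_real_derivative D t) (at t)" and D: "\<And>t. 0 \<le> D t" and "a \<le> b"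
  shows "(\<integral>\<^sup>+s. ennreal (D s) * indicator {a..b} s \<partial>lborel) = ennreal (G b - G a)"
  by (rule nn_integral_FTC_Icc) (use assms borel_measurable_DERIV[OF G] in \<open>auto\<close>)

text \<open>Both sides equal the integral of \<open>D s * \<bar>t - m\<bar> * \<phi> t\<close> over all pairs with \<open>s\<close> between
  \<open>m\<close> and \<open>t\<close>, so that no integrability is needed.\<close>

lemma stein_nn_integral:
  fixes G D :: "real \<Rightarrow> real"
  assumes \<sigma>: "\<sigma> > 0" and G: "\<And>t. (G has_real_derivative D t) (at t)" and D: "\<And>t. 0 \<le> D t"
  shows "(\<integral>\<^sup>+t. ennreal (\<sigma>\<^sup>2 * D t * normal_density m \<sigma> t) \<partial>lborel)
       = (\<integral>\<^sup>+t. ennreal ((G t - G m) * (t - m) * normal_density m \<sigma> t) \<partial>lborel)"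
proof -
  have [measurable]: "D \<in> borel_measurable borel"
    by (rule borel_measurable_DERIV[OF G])
  let ?\<phi> = "normal_density m \<sigma>"
  define S :: "(real \<times> real) set" where "S = {(s, t). (m \<le> s \<and> s \<le> t) \<or> (t \<le> s \<and> s \<le> m)}"
  have [measurable]: "S \<in> sets (borel \<Otimes>\<^sub>M borel)"
  proof -
    have "S = {x \<in> space (borel \<Otimes>\<^sub>M borel). (m \<le> fst x \<and> fst x \<le> snd x) \<or> (snd x \<le> fst x \<and> fst x \<le> m)}"
      by (auto simp: S_def space_pair_measure)
    then show ?thesis by simp
  qed
  define K where "K s t = ennreal (D s) * (ennreal (\<bar>t - m\<bar> * ?\<phi> t) * indicator S (s, t))" for s t
  have [measurable]: "(\<lambda>(s, t). K s t) \<in> borel_measurable (borel \<Otimes>\<^sub>M borel)"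
    unfolding K_def by measurable
  \<comment> \<open>At \<open>s = m\<close> both half lines belong to the section of
    \<open>S\<close> and the inner integral is twice as large; this single point is discarded below
    as a null set.\<close>
  have inner: "(\<integral>\<^sup>+t. K s t \<partial>lborel) = ennreal (\<sigma>\<^sup>2 * D s * ?\<phi> s)" if "s \<noteq> m" for s
  proof -
    have "(\<integral>\<^sup>+t. ennreal (\<bar>t - m\<bar> * ?\<phi> t) * indicator S (s, t) \<partial>lborel) = ennreal (\<sigma>\<^sup>2 * ?\<phi> s)"
    proof (cases "s > m")
      case True
      have "(\<integral>\<^sup>+t. ennreal (\<bar>t - m\<bar> * ?\<phi> t) * indicator S (s, t) \<partial>lborel)
          = (\<integral>\<^sup>+t. ennreal ((t - m) * ?\<phi> t) * indicator {s..} t \<partial>lborel)"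
        using True by (intro nn_integral_cong) (auto simp: S_def indicator_def)
      then show ?thesis
        using True \<sigma> by (simp add: nn_integral_normal_tail)
    next
      case False
      have "(\<integral>\<^sup>+t. ennreal (\<bar>t - m\<bar> * ?\<phi> t) * indicator S (s, t) \<partial>lborel)
          = (\<integral>\<^sup>+t. ennreal ((m - t) * ?\<phi> t) * indicator {..s} t \<partial>lborel)"
        using False that by (intro nn_integral_cong) (auto simp: S_def indicator_def)
      then show ?thesis
        using False \<sigma> by (simp add: nn_integral_normal_lower_tail)
    qed
    then show ?thesis
      unfolding K_def
      by (subst nn_integral_cmult) (auto simp: ennreal_mult[symmetric] D mult.commute mult.left_commute)
  qed
  have outer: "(\<integral>\<^sup>+s. K s t \<partial>lborel) = ennreal ((G t - G m) * (t - m) * ?\<phi> t)" for t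
  proof -
    have "(\<integral>\<^sup>+s. K s t \<partial>lborel)
        = (\<integral>\<^sup>+s. ennreal (\<bar>t - m\<bar> * ?\<phi> t) * (ennreal (D s) * indicator {min m t..max m t} s) \<partial>lborel)"
      by (intro nn_integral_cong) (auto simp: K_def S_def indicator_def mult.commute)
    also have "\<dots> = ennreal (\<bar>t - m\<bar> * ?\<phi> t) * ennreal (G (max m t) - G (min m t))"
      by (subst nn_integral_cmult) (auto simp: nn_integral_derivative_segment[OF G D])
    also have "\<dots> = ennreal (\<bar>t - m\<bar> * ?\<phi> t * (G (max m t) - G (min m t)))"
      by (rule ennreal_mult'[symmetric]) simp
    also have "\<bar>t - m\<bar> * ?\<phi> t * (G (max m t) - G (min m t)) = (G t - G m) * (t - m) * ?\<phi> t"
      by (cases "m \<le> t") (auto simp: max_def min_def algebra_simps)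
    finally show ?thesis .
  qed
  have "(\<integral>\<^sup>+s. ennreal (\<sigma>\<^sup>2 * D s * ?\<phi> s) \<partial>lborel) = (\<integral>\<^sup>+s. (\<integral>\<^sup>+t. K s t \<partial>lborel) \<partial>lborel)"
  proof (rule nn_integral_cong_AE)
    show "AE s in lborel. ennreal (\<sigma>\<^sup>2 * D s * ?\<phi> s) = (\<integral>\<^sup>+t. K s t \<partial>lborel)"
      using AE_lborel_singleton[of m] by eventually_elim (simp add: inner)
  qed
  also have "\<dots> = (\<integral>\<^sup>+t. (\<integral>\<^sup>+s. K s t \<partial>lborel) \<partial>lborel)"
    by (rule lborel_pair.Fubini'[symmetric]) measurable
  finally show ?thesis
    by (simp add: outer)
qed

section \<open>Functions that are polynomial in each coordinate\<close>

text \<open>Weaker than being a polynomial: only the restriction to each coordinate line is one.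
  This is what a Fubini argument over the coordinates uses, it passes to determinants, and no
  multivariate polynomials have to be represented.\<close>

definition sep_poly :: "(('n \<Rightarrow> real) \<Rightarrow> real) \<Rightarrow> bool"
  where "sep_poly P \<longleftrightarrow> P \<in> borel_measurable (Pi\<^sub>M UNIV (\<lambda>_. borel)) \<and>
    (\<forall>x s. \<exists>r. \<forall>t. P (x(s := t)) = poly r t)"

lemma sep_poly_const: "sep_poly (\<lambda>x. c)"
  unfolding sep_poly_def by (auto intro!: exI[of _ "[:c:]"])

lemma sep_poly_coord: "sep_poly (\<lambda>x. x s)"
  unfolding sep_poly_def
proof (safe)
  fix x :: "'a \<Rightarrow> real" and s'
  show "\<exists>r. \<forall>t. (x(s' := t)) s = poly r t"
    by (cases "s = s'") (auto intro: exI[of _ "[:0, 1:]"] exI[of _ "[:x s:]"])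
qed measurable

lemma sep_poly_add:
  assumes "sep_poly P" "sep_poly Q"
  shows "sep_poly (\<lambda>x. P x + Q x)"
  using assms unfolding sep_poly_def by (auto, metis poly_add)

lemma sep_poly_mult:
  assumes "sep_poly P" "sep_poly Q"
  shows "sep_poly (\<lambda>x. P x * Q x)"
  using assms unfolding sep_poly_def by (auto, metis poly_mult)

lemma sep_poly_diff:
  assumes "sep_poly P" "sep_poly Q"
  shows "sep_poly (\<lambda>x. P x - Q x)"
  using assms unfolding sep_poly_def by (auto, metis poly_diff)

lemma sep_poly_sum: "(\<And>i. i \<in> I \<Longrightarrow> sep_poly (P i)) \<Longrightarrow> sep_poly (\<lambda>x. \<Sum>i\<in>I. P i x)"
  by (induction I rule: infinite_finite_induct) (auto intro: sep_poly_const sep_poly_add)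

lemma sep_poly_prod: "(\<And>i. i \<in> I \<Longrightarrow> sep_poly (P i)) \<Longrightarrow> sep_poly (\<lambda>x. \<Prod>i\<in>I. P i x)"
  by (induction I rule: infinite_finite_induct) (auto intro: sep_poly_const sep_poly_mult)

lemma sep_poly_det:
  fixes A :: "('n \<Rightarrow> real) \<Rightarrow> real ^ 'm ^ 'm"
  assumes "\<And>a b. sep_poly (\<lambda>x. A x $ a $ b)"
  shows "sep_poly (\<lambda>x. det (A x))"
  unfolding det_def by (intro sep_poly_sum sep_poly_mult sep_poly_const sep_poly_prod assms)

text \<open>The coordinates are released from the witness \<open>z\<close> one at a time. Where
  \<open>P\<close> does not vanish at one stage, it is a nonzero polynomial along the next
  coordinate, and its finitely many roots have measure \<open>0\<close>.\<close>

lemma AE_sep_poly_nonzero: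
  fixes P :: "('n::finite \<Rightarrow> real) \<Rightarrow> real" and N :: "'n \<Rightarrow> real measure"
  assumes P: "sep_poly P" and z: "P z \<noteq> 0"
    and prob: "\<And>s. prob_space (N s)" and sets: "\<And>s. sets (N s) = sets borel"
    and atomless: "\<And>s c. emeasure (N s) {c} = 0"
  shows "AE x in Pi\<^sub>M UNIV N. P x \<noteq> 0"
proof -
  interpret N: product_prob_space N UNIV
    unfolding product_prob_space_def product_sigma_finite_def product_prob_space_axioms_def
    using prob by (auto intro: prob_space_imp_sigma_finite)
  define E where "E S x = (\<lambda>s. if s \<in> S then x s else z s)" for S and x :: "'n \<Rightarrow> real"
  have PN: "P \<in> borel_measurable (Pi\<^sub>M UNIV N)"
    using P unfolding sep_poly_def by (simp add: measurable_def sets_PiM_cong[OF refl sets] space_PiM sets_eq_imp_space_eq[OF sets])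
  have EN[measurable]: "E S \<in> measurable (Pi\<^sub>M S N) (Pi\<^sub>M UNIV N)" for S
  proof (rule measurable_PiM_single')
    fix s show "(\<lambda>x. E S x s) \<in> measurable (Pi\<^sub>M S N) (N s)"
      by (cases "s \<in> S") (auto simp: E_def sets_eq_imp_space_eq[OF sets])
  qed (auto simp: E_def space_PiM sets_eq_imp_space_eq[OF sets])
  have M[measurable]: "(\<lambda>x. P (E S x)) \<in> borel_measurable (Pi\<^sub>M S N)" for S
    by (rule measurable_compose[OF EN PN])
  have "AE x in Pi\<^sub>M S N. P (E S x) \<noteq> 0" if "finite S" for S
    using that
  proof (induction S)
    case empty
    have "E {} x = z" for x by (auto simp: E_def)
    then show ?case using z by simp
  next
    case (insert s S)
    have m: "{x \<in> space (Pi\<^sub>M (insert s S) N). P (E (insert s S) x) = 0} \<in> sets (Pi\<^sub>M (insert s S) N)"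
      by measurable
    have "(\<integral>\<^sup>+x. indicator {0} (P (E (insert s S) x)) \<partial>Pi\<^sub>M (insert s S) N)
        = (\<integral>\<^sup>+x. (\<integral>\<^sup>+y. indicator {0} (P (E (insert s S) (x(s := y)))) \<partial>N s) \<partial>Pi\<^sub>M S N)"
      using insert.hyps by (intro N.product_nn_integral_insert) measurable
    also have "\<dots> = (\<integral>\<^sup>+x. 0 \<partial>Pi\<^sub>M S N)"
    proof (rule nn_integral_cong_AE)
      show "AE x in Pi\<^sub>M S N. (\<integral>\<^sup>+y. indicator {0} (P (E (insert s S) (x(s := y)))) \<partial>N s) = 0"
        using insert.IH
      proof eventually_elim
        case (elim x)
        have eq: "E (insert s S) (x(s := y)) = (E S x)(s := y)" for y
          by (auto simp: E_def)
        obtain r where r: "\<And>t. P ((E S x)(s := t)) = poly r t"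
          using P unfolding sep_poly_def by blast
        \<comment> \<open>The previous stage is the value of the new polynomial at
          \<open>z s\<close>, so \<open>r\<close> is not the zero polynomial.\<close>
        have "E S x = (E S x)(s := z s)"
          using insert.hyps by (auto simp: E_def)
        then have "poly r (z s) \<noteq> 0"
          using elim r by metis
        then have "finite {t. poly r t = 0}"
          by (intro poly_roots_finite) auto
        moreover have "{t. poly r t = 0} \<in> sets borel"
          using calculation by (intro borel_closed finite_imp_closed)
        ultimately have "emeasure (N s) {t. poly r t = 0} = 0"
          using emeasure_eq_sum_singleton[of "{t. poly r t = 0}" "N s"] atomless sets by simp
        moreover have "(\<integral>\<^sup>+y. indicator {0} (P (E (insert s S) (x(s := y)))) \<partial>N s)
            = (\<integral>\<^sup>+y. indicator {t. poly r t = 0} y \<partial>N s)"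
          by (intro nn_integral_cong) (auto simp: eq r indicator_def)
        moreover have "{t. poly r t = 0} \<in> sets (N s)"
          using \<open>{t. poly r t = 0} \<in> sets borel\<close> sets by simp
        ultimately show ?case by simp
      qed
    qed
    finally have "(\<integral>\<^sup>+x. indicator {0} (P (E (insert s S) x)) \<partial>Pi\<^sub>M (insert s S) N) = 0"
      by simp
    then have "AE x in Pi\<^sub>M (insert s S) N. indicator {0} (P (E (insert s S) x)) = (0::ennreal)"
      by (subst (asm) nn_integral_0_iff_AE) measurable
    then show ?case by eventually_elim (auto simp: indicator_def split: if_splits)
  qed
  from this[of UNIV] show ?thesis by (simp add: E_def)
qed

section \<open>Orthonormal systems and the singular value decomposition\<close>

declare One_nat_def [simp del]

definition orthonormal_on :: "nat \<Rightarrow> (nat \<Rightarrow> 'a::real_inner) \<Rightarrow> bool"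
  where "orthonormal_on n v \<longleftrightarrow> (\<forall>k\<in>{1..n}. \<forall>l\<in>{1..n}. v k \<bullet> v l = (if k = l then 1 else 0))"

lemma orthonormal_onD:
  "orthonormal_on n v \<Longrightarrow> k \<in> {1..n} \<Longrightarrow> l \<in> {1..n} \<Longrightarrow> v k \<bullet> v l = (if k = l then 1 else 0)"
  by (simp add: orthonormal_on_def)

lemma orthonormal_on_inner_sum:
  assumes "orthonormal_on n v" "l \<in> {1..n}"
  shows "(\<Sum>k=1..n. c k *\<^sub>R v k) \<bullet> v l = c l"
proof -
  have "(\<Sum>k=1..n. c k *\<^sub>R v k) \<bullet> v l = (\<Sum>k=1..n. if k = l then c k else 0)"
    unfolding inner_sum_left using assms by (intro sum.cong) (auto simp: orthonormal_on_def)
  also have "\<dots> = c l" using assms(2) by simp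
  finally show ?thesis .
qed

lemma orthonormal_on_complete:
  fixes v :: "nat \<Rightarrow> 'a::euclidean_space"
  assumes v: "orthonormal_on DIM('a) v" and x: "\<And>k. k \<in> {1..DIM('a)} \<Longrightarrow> x \<bullet> v k = 0"
  shows "x = 0"
proof -
  let ?V = "v ` {1..DIM('a)}"
  have inj: "inj_on v {1..DIM('a)}"
  proof (rule inj_onI)
    fix k l assume kl: "k \<in> {1..DIM('a)}" "l \<in> {1..DIM('a)}" "v k = v l"
    then show "k = l"
      using orthonormal_onD[OF v kl(1,2)] orthonormal_onD[OF v kl(1,1)] by (auto split: if_splits)
  qed
  have "pairwise orthogonal ?V"
    unfolding pairwise_def orthogonal_def using v by (auto simp: orthonormal_on_def)
  moreover have "0 \<notin> ?V"
    using v by (force simp: orthonormal_on_def)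
  ultimately have "independent ?V"
    by (rule pairwise_orthogonal_independent)
  moreover have "card ?V = DIM('a)"
    using inj by (simp add: card_image)
  ultimately have "UNIV \<subseteq> span ?V"
    by (intro card_ge_dim_independent) (auto simp: dim_UNIV)
  moreover have "orthogonal x y" if "y \<in> span ?V" for y
    by (rule orthogonal_to_span[OF that]) (use x in \<open>auto simp: orthogonal_def\<close>)
  ultimately have "orthogonal x x" by blast
  then show ?thesis by (simp add: orthogonal_def)
qed

lemma orthonormal_on_expansion:
  fixes v :: "nat \<Rightarrow> 'a::euclidean_space"
  assumes v: "orthonormal_on DIM('a) v"
  shows "x = (\<Sum>k=1..DIM('a). (x \<bullet> v k) *\<^sub>R v k)"
proof -
  have "x - (\<Sum>k=1..DIM('a). (x \<bullet> v k) *\<^sub>R v k) = 0"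
    by (rule orthonormal_on_complete[OF v])
      (simp add: inner_diff_left orthonormal_on_inner_sum[OF v] del: atLeastAtMost_iff)
  then show ?thesis by simp
qed

text \<open>Meant for the left singular vectors, which are an incomplete system if
  \<open>q < p\<close>.\<close>

lemma orthonormal_on_Bessel:
  assumes v: "orthonormal_on n v"
  shows "(\<Sum>k=1..n. (x \<bullet> v k)\<^sup>2) \<le> x \<bullet> x"
proof -
  let ?y = "\<Sum>k=1..n. (x \<bullet> v k) *\<^sub>R v k"
  have xy: "x \<bullet> ?y = (\<Sum>k=1..n. (x \<bullet> v k)\<^sup>2)"
    by (simp add: inner_sum_right power2_eq_square)
  have "z \<bullet> ?y = (\<Sum>k=1..n. (x \<bullet> v k) * (z \<bullet> v k))" for z
    by (simp add: inner_sum_right)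
  then have "?y \<bullet> ?y = (\<Sum>k=1..n. (x \<bullet> v k) * (?y \<bullet> v k))" .
  also have "\<dots> = (\<Sum>k=1..n. (x \<bullet> v k)\<^sup>2)"
    by (intro sum.cong refl) (simp add: orthonormal_on_inner_sum[OF v] power2_eq_square del: atLeastAtMost_iff)
  finally have yy: "?y \<bullet> ?y = (\<Sum>k=1..n. (x \<bullet> v k)\<^sup>2)" .
  have "0 \<le> (x - ?y) \<bullet> (x - ?y)" by (rule inner_ge_zero)
  also have "\<dots> = x \<bullet> x - 2 * (x \<bullet> ?y) + ?y \<bullet> ?y"
    by (simp add: inner_diff_left inner_diff_right inner_commute)
  finally show ?thesis by (simp add: xy yy)
qed

text \<open>Fewer than \<open>DIM('a)\<close> vectors span a proper subspace. This supplies room for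
  the next eigenvector, and later the free left singular vector of a vanishing singular
  value.\<close>

lemma orthonormal_on_extend:
  fixes v :: "nat \<Rightarrow> 'a::euclidean_space"
  assumes "n < DIM('a)"
  shows "\<exists>x. norm x = 1 \<and> (\<forall>k\<in>{1..n}. x \<bullet> v k = 0)"
proof -
  have "dim (v ` {1..n}) \<le> card (v ` {1..n})"
    by (intro dim_le_card') auto
  also have "\<dots> \<le> n" using card_image_le[of "{1..n}" v] by simp
  finally have "dim (v ` {1..n}) < DIM('a)" using assms by simp
  then obtain x where x: "x \<noteq> 0" "\<And>y. y \<in> span (v ` {1..n}) \<Longrightarrow> orthogonal x y"
    using orthogonal_to_subspace_exists by metis
  show ?thesis
    using x by (intro exI[of _ "x /\<^sub>R norm x"]) (auto simp: orthogonal_def span_base)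
qed

text \<open>The next eigenvector maximises \<open>T x \<bullet> x\<close> over the unit vectors
  orthogonal to the previous ones. The last conjunct, a bound for the Rayleigh quotient on the
  remaining complement, carries the decreasing order through the induction.\<close>

lemma selfadjoint_eigenvectors:
  fixes T :: "'a::euclidean_space \<Rightarrow> 'a"
  assumes T: "linear T" and sa: "\<And>x y. T x \<bullet> y = x \<bullet> T y" and n: "n \<le> DIM('a)"
  shows "\<exists>v \<rho>. orthonormal_on n v \<and> (\<forall>k\<in>{1..n}. T (v k) = \<rho> k *\<^sub>R v k) \<and>
    (\<forall>k\<in>{1..n}. \<forall>l\<in>{1..n}. k < l \<longrightarrow> \<rho> l \<le> \<rho> k) \<and>
    (\<forall>k\<in>{1..n}. \<forall>x. (\<forall>l\<in>{1..n}. x \<bullet> v l = 0) \<longrightarrow> T x \<bullet> x \<le> \<rho> k * (x \<bullet> x))"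
  using n
proof (induction n)
  case 0
  show ?case by (simp add: orthonormal_on_def)
next
  case (Suc n)
  obtain v \<rho> where IH: "orthonormal_on n v" "\<forall>k\<in>{1..n}. T (v k) = \<rho> k *\<^sub>R v k"
    "\<forall>k\<in>{1..n}. \<forall>l\<in>{1..n}. k < l \<longrightarrow> \<rho> l \<le> \<rho> k"
    "\<forall>k\<in>{1..n}. \<forall>x. (\<forall>l\<in>{1..n}. x \<bullet> v l = 0) \<longrightarrow> T x \<bullet> x \<le> \<rho> k * (x \<bullet> x)"
    using Suc.IH[OF Suc_leD[OF Suc.prems]] by (elim exE conjE) (rule that)
  note on = IH(1) and eig = IH(2)[rule_format] and mono = IH(3)[rule_format] and bd = IH(4)[rule_format]
  define V where "V = {x. \<forall>k\<in>{1..n}. x \<bullet> v k = 0}"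
  have V_add: "x + c *\<^sub>R y \<in> V" if "x \<in> V" "y \<in> V" for x y c
    using that by (auto simp: V_def inner_add_left)
  have V_scale: "c *\<^sub>R y \<in> V" if "y \<in> V" for y c
    using that by (auto simp: V_def)
  have contT: "continuous_on S T" for S
    using T by (intro linear_continuous_on) (simp add: linear_conv_bounded_linear)
  let ?S = "sphere 0 1 \<inter> V"
  have "closed V"
  proof -
    have "V = (\<Inter>k\<in>{1..n}. {x. x \<bullet> v k = 0})" by (auto simp: V_def)
    then show ?thesis by (auto intro!: closed_INT closed_Collect_eq continuous_intros)
  qed
  then have "compact ?S" by (intro compact_Int_closed) auto
  moreover have "?S \<noteq> {}"
    using orthonormal_on_extend[of n v] Suc.prems by (auto simp: V_def)
  moreover have "continuous_on ?S (\<lambda>x. T x \<bullet> x)"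
    by (intro continuous_intros contT)
  ultimately have "\<exists>x0\<in>?S. \<forall>x\<in>?S. T x \<bullet> x \<le> T x0 \<bullet> x0"
    by (rule continuous_attains_sup)
  then obtain x0 where x0: "x0 \<in> ?S" and max': "\<forall>x\<in>?S. T x \<bullet> x \<le> T x0 \<bullet> x0"
    by (elim bexE) (rule that)
  note max = max'[rule_format]
  define m where "m = T x0 \<bullet> x0"
  have x0x0: "x0 \<bullet> x0 = 1" using x0 by (simp add: norm_eq_1)
  have x0V: "x0 \<in> V" using x0 by simp
  have le: "T x \<bullet> x \<le> m * (x \<bullet> x)" if "x \<in> V" for x
  proof (cases "x = 0")
    case True
    then show ?thesis by simp
  next
    case False
    have "x /\<^sub>R norm x \<in> ?S" using that False by (auto intro: V_scale)
    from max[OF this] have "(T x \<bullet> x) / (norm x)\<^sup>2 \<le> m"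
      by (simp add: linear_scale[OF T] m_def power2_eq_square field_simps)
    then show ?thesis using False by (simp add: field_simps power2_norm_eq_inner)
  qed
  \<comment> \<open>Half the gradient at \<open>x0\<close> of
    \<open>m * (x \<bullet> x) - T x \<bullet> x\<close>, a form that is nonnegative on
    \<open>V\<close> and vanishes at \<open>x0\<close>. Since \<open>V\<close> is invariant under
    \<open>T\<close>, moving from \<open>x0\<close> along \<open>w\<close> stays in
    \<open>V\<close>.\<close>
  define w where "w = m *\<^sub>R x0 - T x0"
  have wV: "w \<in> V"
    unfolding w_def V_def
  proof safe
    fix k assume k: "k \<in> {1..n}"
    then have "x0 \<bullet> v k = 0" using x0V by (simp add: V_def)
    then show "(m *\<^sub>R x0 - T x0) \<bullet> v k = 0"
      using eig[OF k] by (simp add: inner_diff_left sa)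
  qed
  define b where "b = m * (w \<bullet> w) - T w \<bullet> w"
  have b0: "b \<ge> 0" using le[OF wV] by (simp add: b_def)
  \<comment> \<open>The form at \<open>x0 + t w\<close>. Its constant term is \<open>0\<close>, so
    nonnegativity for all \<open>t\<close> forces the linear coefficient
    \<open>2 (w \<bullet> w)\<close> to vanish.\<close>
  have quad: "0 \<le> 2 * t * (w \<bullet> w) + t\<^sup>2 * b" for t
  proof -
    have c: "T w \<bullet> x0 = T x0 \<bullet> w" "x0 \<bullet> w = w \<bullet> x0" by (metis sa inner_commute, rule inner_commute)
    have "0 \<le> m * ((x0 + t *\<^sub>R w) \<bullet> (x0 + t *\<^sub>R w)) - T (x0 + t *\<^sub>R w) \<bullet> (x0 + t *\<^sub>R w)"
      using le[OF V_add[OF x0V wV]] by simp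
    also have "\<dots> = 2 * t * (m * (x0 \<bullet> w) - T x0 \<bullet> w) + t\<^sup>2 * b"
      by (simp add: linear_add[OF T] linear_scale[OF T] inner_add_left inner_add_right c x0x0
          m_def[symmetric] b_def power2_eq_square algebra_simps)
    also have "m * (x0 \<bullet> w) - T x0 \<bullet> w = w \<bullet> w"
    proof -
      have "w \<bullet> w = (m *\<^sub>R x0 - T x0) \<bullet> w" by (simp add: w_def)
      then show ?thesis by (simp add: inner_diff_left)
    qed
    finally show ?thesis .
  qed
  have "w \<bullet> w = 0"
  proof (cases "b = 0")
    case True
    then show ?thesis using quad[of "-1"] inner_ge_zero[of w] by simp
  next
    case False
    then have "b > 0" using b0 by simp
    \<comment> \<open>The minimiser of the quadratic, whose value there is
      \<open>- (w \<bullet> w)\<^sup>2 / b\<close>.\<close>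
    from quad[of "- (w \<bullet> w) / b"] this have "(w \<bullet> w) * (w \<bullet> w) \<le> 0"
      by (simp add: power2_eq_square field_simps)
    then show ?thesis using inner_ge_zero[of w] by (auto simp: mult_le_0_iff simp del: inner_ge_zero)
  qed
  then have Tx0: "T x0 = m *\<^sub>R x0" by (simp add: w_def)
  let ?v = "v(Suc n := x0)" and ?l = "\<rho>(Suc n := m)"
  have set: "{1..Suc n} = insert (Suc n) {1..n}" by auto
  have ml: "m \<le> \<rho> k" if "k \<in> {1..n}" for k
    using bd[OF that, of x0] x0V by (simp add: V_def x0x0 m_def[symmetric])
  show ?case
  proof (rule exI[of _ ?v], rule exI[of _ ?l], intro conjI)
    show "orthonormal_on (Suc n) ?v"
      using on x0V x0x0 unfolding orthonormal_on_def V_def set by (auto simp: inner_commute)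
    show "\<forall>k\<in>{1..Suc n}. T (?v k) = ?l k *\<^sub>R ?v k"
      using eig Tx0 by auto
    show "\<forall>k\<in>{1..Suc n}. \<forall>l\<in>{1..Suc n}. k < l \<longrightarrow> ?l l \<le> ?l k"
      using mono ml by auto
    have "T x \<bullet> x \<le> ?l k * (x \<bullet> x)" if k: "k \<in> {1..Suc n}" and x: "\<forall>l\<in>{1..Suc n}. x \<bullet> ?v l = 0" for k x
    proof -
      have *: "\<forall>l\<in>{1..n}. x \<bullet> v l = 0"
      proof
        fix l assume "l \<in> {1..n}"
        then show "x \<bullet> v l = 0" using x by (auto dest: bspec[of _ _ l])
      qed
      show ?thesis
      proof (cases "k = Suc n")
        case True
        then show ?thesis using le[of x] * by (simp add: V_def)
      next
        case False
        then show ?thesis using bd[of k x] * k by simp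
      qed
    qed
    then show "\<forall>k\<in>{1..Suc n}. \<forall>x. (\<forall>l\<in>{1..Suc n}. x \<bullet> ?v l = 0) \<longrightarrow> T x \<bullet> x \<le> ?l k * (x \<bullet> x)"
      by blast
  qed
qed

section \<open>The Gram operator and the existence of the decomposition\<close>

definition gram :: "real ^ 'q ^ 'p \<Rightarrow> real ^ 'q \<Rightarrow> real ^ 'q"
  where "gram X x = transpose X *v (X *v x)"

lemma gram_inner: "gram X x \<bullet> y = (X *v x) \<bullet> (X *v y)"
  unfolding gram_def by (simp add: dot_lmul_matrix)

lemma gram_selfadjoint: "gram X x \<bullet> y = x \<bullet> gram X y"
  by (metis gram_inner inner_commute)

lemma linear_gram: "linear (gram X)"
  unfolding gram_def by (auto intro!: linearI simp: matrix_vector_right_distrib matrix_vector_mult_scaleR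
      simp del: transpose_matrix_vector)

lemma matrix_vector_mult_row: "(X *v x) $ i = X $ i \<bullet> x"
  by (simp add: matrix_vector_mul_component)

lemma outer_prod_nth: "outer_prod a b $ i $ j = a $ i * b $ j"
  by (simp add: outer_prod_def)

lemma distinct_svdD:
  fixes X :: "real ^ 'q ^ 'p"
  assumes "distinct_svd X d u v"
  shows "orthonormal_on CARD('q) u" "orthonormal_on CARD('q) v"
    "\<And>k. k \<in> {1..CARD('q)} \<Longrightarrow> 0 \<le> d k"
    "\<And>k l. k \<in> {1..CARD('q)} \<Longrightarrow> l \<in> {1..CARD('q)} \<Longrightarrow> k < l \<Longrightarrow> d l < d k"
    "X = (\<Sum>k=1..CARD('q). d k *\<^sub>R outer_prod (u k) (v k))"
  using assms unfolding distinct_svd_def orthonormal_on_def by blast+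

lemma distinct_svd_zero:
  fixes X :: "real ^ 'q ^ 'p"
  assumes "distinct_svd X d u v" "k \<in> {1..CARD('q)}" "d k = 0"
  shows "k = CARD('q)"
proof (rule ccontr)
  assume "k \<noteq> CARD('q)"
  then have "CARD('q) \<in> {1..CARD('q)}" "k < CARD('q)" using assms(2) by auto
  then have "d CARD('q) < 0" "0 \<le> d CARD('q)"
    using distinct_svdD(3,4)[OF assms(1)] assms(2,3) by metis+
  then show False by simp
qed

lemma distinct_svd_mult:
  fixes X :: "real ^ 'q ^ 'p"
  assumes "distinct_svd X d u v" "k \<in> {1..CARD('q)}"
  shows "X *v v k = d k *\<^sub>R u k" "gram X (v k) = (d k)\<^sup>2 *\<^sub>R v k"
proof -
  note D = distinct_svdD[OF assms(1)]
  have row: "X $ i = (\<Sum>k=1..CARD('q). (d k * u k $ i) *\<^sub>R v k)" for i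
    by (subst D(5)) (simp add: vec_eq_iff outer_prod_nth mult.assoc)
  have mult: "X *v y = (\<Sum>l=1..CARD('q). (d l * (v l \<bullet> y)) *\<^sub>R u l)" for y
    by (simp add: vec_eq_iff matrix_vector_mult_row row inner_sum_left mult_ac)
  show X: "X *v v k = d k *\<^sub>R u k"
    unfolding vec_eq_iff matrix_vector_mult_row row orthonormal_on_inner_sum[OF D(2) assms(2)] by simp
  show "gram X (v k) = (d k)\<^sup>2 *\<^sub>R v k"
  proof (rule vector_eq_ldot[THEN iffD1, rule_format])
    fix y
    have "gram X (v k) \<bullet> y = d k * ((X *v y) \<bullet> u k)"
      by (simp add: gram_inner X inner_commute[of "u k"])
    also have "(X *v y) \<bullet> u k = d k * (v k \<bullet> y)"
      unfolding mult by (rule orthonormal_on_inner_sum[OF D(1) assms(2)])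
    finally show "y \<bullet> gram X (v k) = y \<bullet> ((d k)\<^sup>2 *\<^sub>R v k)"
      by (simp add: inner_commute power2_eq_square)
  qed
qed

text \<open>\<open>u k = X v k / sqrt (\<rho> k)\<close> is forced except for a possible last vector
  belonging to the eigenvalue \<open>0\<close>. Any unit vector orthogonal to the others serves
  there, because its coefficient in the expansion of \<open>X\<close> is \<open>0\<close>.\<close>

lemma distinct_svd_exists:
  fixes X :: "real ^ 'q ^ 'p"
  assumes pq: "CARD('q) \<le> CARD('p)" and v: "orthonormal_on CARD('q) v"
    and eig: "\<And>k. k \<in> {1..CARD('q)} \<Longrightarrow> gram X (v k) = \<rho> k *\<^sub>R v k"
    and less: "\<And>k l. k \<in> {1..CARD('q)} \<Longrightarrow> l \<in> {1..CARD('q)} \<Longrightarrow> k < l \<Longrightarrow> \<rho> l < \<rho> k"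
  shows "\<exists>u. distinct_svd X (\<lambda>k. sqrt (\<rho> k)) u v"
proof -
  let ?q = "CARD('q)"
  have ip: "(X *v v k) \<bullet> (X *v v l) = (if k = l then \<rho> k else 0)" if "k \<in> {1..?q}" "l \<in> {1..?q}" for k l
    using orthonormal_onD[OF v that] eig[OF that(1)] by (simp add: gram_inner[symmetric])
  have pos: "0 \<le> \<rho> k" if "k \<in> {1..?q}" for k
    using ip[OF that that] inner_ge_zero[of "X *v v k"] by simp
  have q1: "?q \<in> {1..?q}" by (simp add: Suc_leI One_nat_def)
  have pos': "0 < \<rho> k" if "k \<in> {1..?q}" "k \<noteq> ?q" for k
    using less[OF that(1) q1] pos[OF q1] that by simp
  define u0 where "u0 k = (1 / sqrt (\<rho> k)) *\<^sub>R (X *v v k)" for k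
  \<comment> \<open>Only the first \<open>q - 1\<close> vectors have to be avoided, and
    \<open>q - 1 < p\<close> holds even for \<open>p = q\<close>.\<close>
  have "\<exists>x::real^'p. norm x = 1 \<and> (\<forall>k\<in>{1..?q - 1}. x \<bullet> u0 k = 0)"
    by (rule orthonormal_on_extend) (use pq in \<open>simp add: Suc_leI less_le_trans[OF _ pq]\<close>)
  then obtain x where x: "norm x = 1" "\<And>k. k \<in> {1..?q - 1} \<Longrightarrow> x \<bullet> u0 k = 0" by blast
  define u where "u k = (if \<rho> k = 0 then x else u0 k)" for k
  have u0: "u0 k \<bullet> u0 l = (if k = l then 1 else 0)"
    if "k \<in> {1..?q}" "l \<in> {1..?q}" "\<rho> k \<noteq> 0" "\<rho> l \<noteq> 0" for k l
    using that ip[OF that(1,2)] pos[OF that(1)] unfolding u0_def by (auto simp: power2_eq_square[symmetric])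
  have zero: "k = ?q" if "k \<in> {1..?q}" "\<rho> k = 0" for k
    using pos'[OF that(1)] that(2) by auto
  have on_u: "u k \<bullet> u l = (if k = l then 1 else 0)" if kl: "k \<in> {1..?q}" "l \<in> {1..?q}" for k l
  proof (cases "\<rho> k = 0")
    case True
    then have k: "k = ?q" using zero kl by auto
    show ?thesis
    proof (cases "\<rho> l = 0")
      case True
      then have "l = ?q" using zero kl by auto
      then show ?thesis using k x(1) \<open>\<rho> k = 0\<close> by (simp add: u_def norm_eq_1)
    next
      case False
      then have "l \<noteq> ?q" using k True by auto
      then have "l \<in> {1..?q - 1}" using kl(2) by auto
      then show ?thesis using x(2) True False by (auto simp: u_def)
    qed
  next
    case False
    show ?thesis
    proof (cases "\<rho> l = 0")
      case True
      then have "l = ?q" using zero kl by auto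
      then have "k \<noteq> ?q" using True False by auto
      then have "k \<in> {1..?q - 1}" using kl(1) by auto
      then show ?thesis using x(2) True False by (auto simp: u_def inner_commute)
    next
      case False
      then show ?thesis using u0[OF kl] \<open>\<rho> k \<noteq> 0\<close> by (simp add: u_def)
    qed
  qed
  have Xv: "sqrt (\<rho> k) *\<^sub>R u k = X *v v k" if "k \<in> {1..?q}" for k
  proof (cases "\<rho> k = 0")
    case True
    then have "X *v v k = 0" using ip[OF that that] by simp
    then show ?thesis using True by simp
  next
    case False
    then show ?thesis using pos[OF that] by (simp add: u_def u0_def)
  qed
  have "X $ i $ j = (\<Sum>k=1..?q. sqrt (\<rho> k) *\<^sub>R outer_prod (u k) (v k)) $ i $ j" for i j
  proof -
    have "X $ i = (\<Sum>k=1..?q. (X $ i \<bullet> v k) *\<^sub>R v k)"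
      using orthonormal_on_expansion[of v "X $ i"] v by simp
    from arg_cong[OF this, of "\<lambda>x. x $ j"]
    have "X $ i $ j = (\<Sum>k=1..?q. (X $ i \<bullet> v k) * v k $ j)"
      by simp
    also have "\<dots> = (\<Sum>k=1..?q. (sqrt (\<rho> k) *\<^sub>R u k) $ i * v k $ j)"
      by (intro sum.cong refl) (simp only: Xv matrix_vector_mult_row)
    finally show ?thesis by (simp add: outer_prod_nth mult.assoc)
  qed
  then have "X = (\<Sum>k=1..?q. sqrt (\<rho> k) *\<^sub>R outer_prod (u k) (v k))"
    by (simp add: vec_eq_iff)
  then have "distinct_svd X (\<lambda>k. sqrt (\<rho> k)) u v"
    unfolding distinct_svd_def using on_u v pos less by (auto simp: orthonormal_on_def)
  then show ?thesis by blast
qed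

text \<open>All eigenspaces of \<open>X^T X\<close> have dimension at most one. In this form no
  eigenvalues are enumerated, and the negation hands over an orthogonal pair spanning a plane of
  eigenvectors.\<close>

definition simple_gram :: "real ^ 'q ^ 'p \<Rightarrow> bool"
  where "simple_gram X \<longleftrightarrow> (\<forall>\<rho> x y. gram X x = \<rho> *\<^sub>R x \<and> gram X y = \<rho> *\<^sub>R y \<and> x \<bullet> y = 0 \<longrightarrow> x = 0 \<or> y = 0)"

lemma simple_gram_imp_distinct_svd:
  fixes X :: "real ^ 'q ^ 'p"
  assumes pq: "CARD('q) \<le> CARD('p)" and s: "simple_gram X"
  shows "\<exists>d u v. distinct_svd X d u v"
proof -
  have "\<exists>v \<rho>. orthonormal_on CARD('q) v \<and> (\<forall>k\<in>{1..CARD('q)}. gram X (v k) = \<rho> k *\<^sub>R v k) \<and>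
    (\<forall>k\<in>{1..CARD('q)}. \<forall>l\<in>{1..CARD('q)}. k < l \<longrightarrow> \<rho> l \<le> \<rho> k) \<and>
    (\<forall>k\<in>{1..CARD('q)}. \<forall>x. (\<forall>l\<in>{1..CARD('q)}. x \<bullet> v l = 0) \<longrightarrow> gram X x \<bullet> x \<le> \<rho> k * (x \<bullet> x))"
    by (rule selfadjoint_eigenvectors[OF linear_gram gram_selfadjoint]) simp
  then obtain v \<rho> where v: "orthonormal_on CARD('q) v"
    and E: "\<forall>k\<in>{1..CARD('q)}. gram X (v k) = \<rho> k *\<^sub>R v k"
      "\<forall>k\<in>{1..CARD('q)}. \<forall>l\<in>{1..CARD('q)}. k < l \<longrightarrow> \<rho> l \<le> \<rho> k"
    by (elim exE conjE) (rule that)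
  note eig = E(1)[rule_format] and le = E(2)[rule_format]
  have "\<rho> l < \<rho> k" if "k \<in> {1..CARD('q)}" "l \<in> {1..CARD('q)}" "k < l" for k l
  proof (rule ccontr)
    assume "\<not> \<rho> l < \<rho> k"
    then have "\<rho> l = \<rho> k" using le[OF that] by simp
    then have "gram X (v k) = \<rho> k *\<^sub>R v k \<and> gram X (v l) = \<rho> k *\<^sub>R v l \<and> v k \<bullet> v l = 0"
      using eig[OF that(1)] eig[OF that(2)] orthonormal_onD[OF v that(1,2)] that(3) by simp
    then have "v k = 0 \<or> v l = 0"
      using s unfolding simple_gram_def by blast
    then show False
      using orthonormal_onD[OF v that(1,1)] orthonormal_onD[OF v that(2,2)] by auto
  qed
  from distinct_svd_exists[OF pq v eig this] show ?thesis by blast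
qed

section \<open>Coordinate lines in the space of matrices\<close>

lemma det_eq_0_iff_kernel:
  fixes A :: "real ^ 'n ^ 'n"
  shows "det A = 0 \<longleftrightarrow> (\<exists>x. x \<noteq> 0 \<and> A *v x = 0)"
  using invertible_det_nz[of A] invertible_left_inverse[of A] matrix_left_invertible_ker[of A] by blast

lemma gram_nth: "gram X x $ a = (\<Sum>k\<in>UNIV. X $ k $ a * (X $ k \<bullet> x))"
  unfolding gram_def by (simp add: matrix_vector_mult_def transpose_def inner_vec_def)

definition row_gram :: "'p \<Rightarrow> real ^ 'q ^ 'p \<Rightarrow> real ^ 'q ^ 'q"
  where "row_gram i X = (\<chi> a b. \<Sum>k\<in>UNIV - {i}. X $ k $ a * X $ k $ b)"

text \<open>The entry \<open>-1\<close> keeps the artificial direction \<open>j\<close> away from the spectrum of \<open>row_gram\<close>.\<close>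

definition col_gram :: "'q \<Rightarrow> real ^ 'q ^ 'p \<Rightarrow> real ^ 'q ^ 'q"
  where "col_gram j X = (\<chi> a b. if a = j \<or> b = j then (if a = b then - 1 else 0)
    else \<Sum>k\<in>UNIV. X $ k $ a * X $ k $ b)"

text \<open>The matrix of \<open>M \<mapsto> A M - M B\<close>.\<close>

definition sylvester :: "real ^ 'q ^ 'q \<Rightarrow> real ^ 'q ^ 'q \<Rightarrow> real ^ ('q \<times> 'q) ^ ('q \<times> 'q)"
  where "sylvester A B = (\<chi> r s. (if snd r = snd s then A $ fst r $ fst s else 0)
    - (if fst r = fst s then B $ snd s $ snd r else 0))"

lemma row_gram_mult: "(row_gram i X *v x) $ a = (\<Sum>k\<in>UNIV - {i}. X $ k $ a * (X $ k \<bullet> x))"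
proof -
  have "(row_gram i X *v x) $ a = (\<Sum>b\<in>UNIV. \<Sum>k\<in>UNIV - {i}. X $ k $ a * (X $ k $ b * x $ b))"
    by (simp add: row_gram_def matrix_vector_mult_def sum_distrib_right mult.assoc)
  also have "\<dots> = (\<Sum>k\<in>UNIV - {i}. X $ k $ a * (X $ k \<bullet> x))"
    by (subst sum.swap) (simp add: inner_vec_def sum_distrib_left)
  finally show ?thesis .
qed

lemma gram_row_gram: "gram X x $ a = X $ i $ a * (X $ i \<bullet> x) + (row_gram i X *v x) $ a"
  unfolding gram_nth row_gram_mult by (rule sum.remove) auto

lemma col_gram_mult:
  assumes "x $ j = 0"
  shows "(col_gram j X *v x) $ a = (if a = j then 0 else gram X x $ a)"
proof (cases "a = j")
  case True
  have "(col_gram j X *v x) $ a = (\<Sum>b\<in>UNIV. (if a = b then - 1 else 0) * x $ b)"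
    using True by (simp add: col_gram_def matrix_vector_mult_def)
  also have "\<dots> = 0"
    using True assms by (intro sum.neutral) auto
  finally show ?thesis using True by simp
next
  case False
  have "(col_gram j X *v x) $ a = (\<Sum>b\<in>UNIV. \<Sum>k\<in>UNIV. X $ k $ a * (X $ k $ b * x $ b))"
    unfolding matrix_vector_mult_def using False assms
    by (auto simp: col_gram_def sum_distrib_right mult.assoc intro!: sum.cong)
  also have "\<dots> = gram X x $ a"
    unfolding gram_nth by (subst sum.swap) (simp add: inner_vec_def sum_distrib_left)
  finally show ?thesis using False by simp
qed

lemma sylvester_mult:
  "(sylvester A B *v M) $ (a, b) = (\<Sum>c\<in>UNIV. A $ a $ c * M $ (c, b)) - (\<Sum>d\<in>UNIV. B $ d $ b * M $ (a, d))"
proof -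
  have "(sylvester A B *v M) $ (a, b) = (\<Sum>c\<in>UNIV. \<Sum>d\<in>UNIV. ((if b = d then A $ a $ c else 0)
    - (if a = c then B $ d $ b else 0)) * M $ (c, d))"
    unfolding sum.cartesian_product UNIV_Times_UNIV
    by (simp add: sylvester_def matrix_vector_mult_def case_prod_unfold cong: if_cong)
  also have "\<dots> = (\<Sum>c\<in>UNIV. \<Sum>d\<in>UNIV. if b = d then A $ a $ c * M $ (c, d) else 0)
      - (\<Sum>c\<in>UNIV. \<Sum>d\<in>UNIV. if a = c then B $ d $ b * M $ (c, d) else 0)"
    unfolding sum_subtractf[symmetric] by (intro sum.cong) (auto simp: left_diff_distrib)
  also have "(\<Sum>c\<in>UNIV. \<Sum>d\<in>UNIV. if a = c then B $ d $ b * M $ (c, d) else 0)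
      = (\<Sum>d\<in>UNIV. \<Sum>c\<in>UNIV. if a = c then B $ d $ b * M $ (c, d) else 0)"
    by (rule sum.swap)
  finally show ?thesis by simp
qed

text \<open>The rank one matrix \<open>x y^T\<close> lies in the kernel of
  \<open>M \<mapsto> A M - M B\<close>: symmetry of \<open>B\<close> turns \<open>y^T B\<close> into
  \<open>e y^T\<close>, so both products equal \<open>e x y^T\<close>.\<close>

lemma det_sylvester_eq_0:
  fixes A B :: "real ^ 'q ^ 'q"
  assumes A: "A *v x = e *\<^sub>R x" "x \<noteq> 0" and B: "B *v y = e *\<^sub>R y" "y \<noteq> 0"
    and sym: "transpose B = B"
  shows "det (sylvester A B) = 0"
proof -
  define M :: "real ^ ('q \<times> 'q)" where "M = (\<chi> r. x $ fst r * y $ snd r)"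
  have Bs: "B $ d $ b = B $ b $ d" for b d
    using arg_cong[OF sym, of "\<lambda>Z. Z $ b $ d"] by (simp add: transpose_def)
  have "(sylvester A B *v M) $ (a, b) = 0" for a b
  proof -
    have "(\<Sum>c\<in>UNIV. A $ a $ c * M $ (c, b)) = (A *v x) $ a * y $ b"
      by (simp add: M_def matrix_vector_mult_def sum_distrib_right mult.assoc)
    moreover have "(\<Sum>d\<in>UNIV. B $ d $ b * M $ (a, d)) = x $ a * (B *v y) $ b"
      unfolding matrix_vector_mult_def by (simp add: M_def Bs[of _ b] sum_distrib_left mult_ac)
    ultimately show ?thesis by (simp add: sylvester_mult A B)
  qed
  then have "sylvester A B *v M = 0" by (simp add: vec_eq_iff)
  moreover have "M \<noteq> 0"
  proof -
    from A(2) B(2) obtain a b where "x $ a \<noteq> 0" "y $ b \<noteq> 0" by (auto simp: vec_eq_iff)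
    then have "M $ (a, b) \<noteq> 0" by (simp add: M_def)
    then show ?thesis by auto
  qed
  ultimately show ?thesis using det_eq_0_iff_kernel by blast
qed

text \<open>A repeated eigenvalue survives the deletion of a row as well as that of a column, and neither
  of the two submatrices involves the entry \<open>(i, j)\<close>.\<close>

lemma simple_gram_sylvester:
  assumes "det (sylvester (row_gram i X) (col_gram j X)) \<noteq> 0"
  shows "simple_gram X"
  unfolding simple_gram_def
proof (intro allI impI, rule ccontr)
  fix e x y assume E: "gram X x = e *\<^sub>R x \<and> gram X y = e *\<^sub>R y \<and> x \<bullet> y = 0" and nz: "\<not> (x = 0 \<or> y = 0)"
  \<comment> \<open>A plane of eigenvectors meets every hyperplane. With \<open>c\<close> the row
    \<open>i\<close> of \<open>X\<close> this gives a vector on which \<open>row_gram\<close> acts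
    like \<open>gram\<close>, with \<open>c\<close> the axis \<open>j\<close> one on which
    \<open>col_gram\<close> does.\<close>
  have *: "\<exists>z. z \<noteq> 0 \<and> gram X z = e *\<^sub>R z \<and> c \<bullet> z = 0" for c
  proof (cases "c \<bullet> x = 0")
    case True
    then show ?thesis using E nz by blast
  next
    case False
    let ?z = "(c \<bullet> y) *\<^sub>R x - (c \<bullet> x) *\<^sub>R y"
    have "?z \<bullet> y = - (c \<bullet> x) * (y \<bullet> y)"
      using E by (simp add: inner_diff_left)
    then have "?z \<noteq> 0" using False nz by auto
    moreover have "gram X ?z = e *\<^sub>R ?z"
      using E by (simp add: linear_diff[OF linear_gram] linear_scale[OF linear_gram] scaleR_diff_right mult.commute)
    moreover have "c \<bullet> ?z = 0" by (simp add: inner_diff_right)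
    ultimately show ?thesis by blast
  qed
  obtain z where z: "z \<noteq> 0" "gram X z = e *\<^sub>R z" "X $ i \<bullet> z = 0" using * by blast
  obtain w where w: "w \<noteq> 0" "gram X w = e *\<^sub>R w" "axis j 1 \<bullet> w = 0" using * by blast
  have wj: "w $ j = 0" using w(3) by (simp add: inner_axis')
  have "(row_gram i X *v z) $ a = (e *\<^sub>R z) $ a" for a
    using gram_row_gram[of X z a i] z by simp
  then have 1: "row_gram i X *v z = e *\<^sub>R z" by (simp add: vec_eq_iff)
  have "(col_gram j X *v w) $ a = (e *\<^sub>R w) $ a" for a
    using wj w(2) by (simp add: col_gram_mult)
  then have 2: "col_gram j X *v w = e *\<^sub>R w" by (simp add: vec_eq_iff)
  have "transpose (col_gram j X) = col_gram j X"
    by (auto simp: vec_eq_iff transpose_def col_gram_def mult.commute)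
  from det_sylvester_eq_0[OF 1 z(1) 2 w(1) this] assms show False by simp
qed

text \<open>Witness: row \<open>i\<close> is zero and the nonzero rows are
  \<open>a m e_m + e_j\<close> for \<open>m \<noteq> j\<close>. Deleting column \<open>j\<close>
  leaves a diagonal Gram matrix with entries \<open>(a m)\<^sup>2\<close>. Deleting the zero row
  leaves the full Gram matrix, an arrow matrix whose coupling through \<open>e_j\<close> moves its
  eigenvalues away from all \<open>(a m)\<^sup>2\<close>.\<close>

lemma det_sylvester_generic:
  fixes i :: "'p::finite" and j :: "'q::finite"
  assumes pq: "CARD('q) \<le> CARD('p)"
  shows "\<exists>X :: real ^ 'q ^ 'p. det (sylvester (row_gram i X) (col_gram j X)) \<noteq> 0"
proof -
  obtain \<pi> :: "'q \<Rightarrow> 'p" where \<pi>: "inj \<pi>" "\<pi> j = i"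
  proof -
    obtain g :: "'q \<Rightarrow> 'p" where g: "inj g"
      using card_le_inj[of "UNIV :: 'q set" "UNIV :: 'p set"] pq by auto
    \<comment> \<open>A transposition of the values sends \<open>j\<close> to \<open>i\<close>, so
      that the row left empty is row \<open>i\<close>.\<close>
    show thesis
      by (rule that[of "Transposition.transpose (g j) i \<circ> g"])
        (use g in \<open>auto intro!: inj_compose inj_transpose\<close>)
  qed
  obtain h :: "'q \<Rightarrow> nat" where h: "inj h"
    using finite_imp_inj_to_nat_seg[of "UNIV :: 'q set"] by auto
  \<comment> \<open>The shift by \<open>1\<close> makes \<open>a\<close> positive, so the squares
    are distinct as well.\<close>
  define a where "a l = real (h l) + 1" for l
  have a0: "a l > 0" for l by (simp add: a_def)
  have a_inj: "(a l)\<^sup>2 = (a m)\<^sup>2 \<longleftrightarrow> l = m" for l m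
    using a0[of l] a0[of m] h by (auto simp: power2_eq_iff a_def inj_eq)
  define r :: "'q \<Rightarrow> real ^ 'q" where "r m = (\<chi> l. if l = m then a m else if l = j then 1 else 0)" for m
  have r_nth: "r m $ l = (if l = m then a m else if l = j then 1 else 0)" for m l
    by (simp add: r_def)
  define X :: "real ^ 'q ^ 'p" where "X = (\<chi> k. if k \<in> \<pi> ` (UNIV - {j}) then r (the_inv \<pi> k) else 0)"
  have X\<pi>: "X $ \<pi> m = r m" if "m \<noteq> j" for m
    using that \<pi>(1) by (simp add: X_def the_inv_f_f)
  have X0: "X $ k = 0" if "k \<notin> \<pi> ` (UNIV - {j})" for k
    using that by (simp add: X_def)
  have iout: "i \<notin> \<pi> ` (UNIV - {j})"
    using \<pi> by (auto simp: inj_eq)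
  have sumX: "(\<Sum>k\<in>K. g (X $ k)) = (\<Sum>m\<in>UNIV - {j}. g (r m))"
    if "g 0 = 0" "\<pi> ` (UNIV - {j}) \<subseteq> K" for g :: "real ^ 'q \<Rightarrow> real" and K
  proof -
    have "(\<Sum>k\<in>K. g (X $ k)) = (\<Sum>k\<in>\<pi> ` (UNIV - {j}). g (X $ k))"
      using that by (intro sum.mono_neutral_right) (auto simp: X0)
    also have "\<dots> = (\<Sum>m\<in>UNIV - {j}. g (X $ \<pi> m))"
      by (rule sum.reindex_cong[OF inj_on_subset[OF \<pi>(1)]]) auto
    finally show ?thesis by (simp add: X\<pi>)
  qed
  have rx: "r m \<bullet> x = a m * x $ m + x $ j" if "m \<noteq> j" for m x
  proof -
    have "r m \<bullet> x = (\<Sum>l\<in>UNIV. (if l = m then a m * x $ m else 0) + (if l = j then x $ j else 0))"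
      using that by (auto simp: r_nth inner_vec_def intro!: sum.cong)
    then show ?thesis by (simp add: sum.distrib)
  qed
  let ?R = "row_gram i X" and ?S = "col_gram j X"
  have R: "(?R *v x) $ c = (\<Sum>m\<in>UNIV - {j}. r m $ c * (r m \<bullet> x))" for x c
    unfolding row_gram_mult using iout by (intro sumX) auto
  have Rc: "(?R *v x) $ c = a c * (a c * x $ c + x $ j)" if "c \<noteq> j" for x c
  proof -
    have "(?R *v x) $ c = (\<Sum>m\<in>UNIV - {j}. if m = c then a c * (a c * x $ c + x $ j) else 0)"
      unfolding R by (intro sum.cong refl) (use that in \<open>auto simp: rx r_nth\<close>)
    then show ?thesis using that by simp
  qed
  have S: "?S $ b $ c = (if b = c then (if b = j then - 1 else (a b)\<^sup>2) else 0)" for b c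
  proof (cases "b = j \<or> c = j")
    case True
    then show ?thesis by (auto simp: col_gram_def)
  next
    case False
    then have "?S $ b $ c = (\<Sum>m\<in>UNIV - {j}. r m $ b * r m $ c)"
      by (simp add: col_gram_def sumX[where g="\<lambda>y. y $ b * y $ c"])
    also have "\<dots> = (\<Sum>m\<in>UNIV - {j}. if m = b then (if b = c then (a b)\<^sup>2 else 0) else 0)"
      by (intro sum.cong refl) (use False in \<open>auto simp: r_nth power2_eq_square\<close>)
    finally show ?thesis using False by simp
  qed
  have "M = 0" if M: "sylvester ?R ?S *v M = 0" for M
  proof -
    have "M $ (c, d) = 0" for c d
    proof -
      \<comment> \<open>As \<open>?S\<close> is diagonal, the equation decouples: column
        \<open>d\<close> of \<open>M\<close> is sent by \<open>?R\<close> to its multiple by the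
        \<open>d\<close>-th diagonal entry of \<open>?S\<close>.\<close>
      define x where "x = (\<chi> c. M $ (c, d))"
      define s where "s = (if d = j then - 1 else (a d)\<^sup>2)"
      have "(?R *v x) $ c = s * x $ c" for c
      proof -
        have "(\<Sum>e\<in>UNIV. ?S $ e $ d * M $ (c, e)) = (\<Sum>e\<in>UNIV. if e = d then s * M $ (c, d) else 0)"
          by (intro sum.cong) (auto simp: S s_def)
        moreover have "(sylvester ?R ?S *v M) $ (c, d) = 0" using M by simp
        moreover have "(?R *v x) $ c = (\<Sum>e\<in>UNIV. ?R $ c $ e * M $ (e, d))"
          by (simp add: matrix_vector_mult_def x_def)
        ultimately show ?thesis
          by (simp add: sylvester_mult x_def)
      qed
      note Rx = this
      have "x = 0"
      proof (cases "d = j")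
        case True
        \<comment> \<open>The factor \<open>- 1\<close> is excluded because \<open>?R\<close> is
          positive semidefinite.\<close>
        have "- (x \<bullet> x) = (\<Sum>c\<in>UNIV. (?R *v x) $ c * x $ c)"
          unfolding Rx using True by (simp add: s_def inner_vec_def sum_negf)
        also have "\<dots> = (\<Sum>c\<in>UNIV. \<Sum>m\<in>UNIV - {j}. (r m \<bullet> x) * (r m $ c * x $ c))"
          unfolding R by (simp add: sum_distrib_right sum_distrib_left mult_ac)
        also have "\<dots> = (\<Sum>m\<in>UNIV - {j}. (r m \<bullet> x)\<^sup>2)"
          by (subst sum.swap) (simp add: inner_vec_def sum_distrib_left power2_eq_square)
        also have "\<dots> \<ge> 0" by (intro sum_nonneg) simp
        finally have "x \<bullet> x = 0" using inner_ge_zero[of x] by linarith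
        then show ?thesis by simp
      next
        case False
        \<comment> \<open>Row \<open>d\<close> of the arrow matrix forces \<open>x $ j = 0\<close>,
          the rows other than \<open>d\<close> and \<open>j\<close> then annihilate their own
          coordinates, and row \<open>j\<close> finally forces \<open>x $ d = 0\<close>.\<close>
        have "a d * (a d * x $ d + x $ j) = (a d)\<^sup>2 * x $ d"
          using Rx[of d] Rc[OF False, of x] False by (simp add: s_def)
        then have xj: "x $ j = 0" using a0[of d] by (simp add: power2_eq_square algebra_simps)
        have xc: "x $ c = 0" if "c \<noteq> d" for c
        proof (cases "c = j")
          case True
          then show ?thesis using xj by simp
        next
          case cj: False
          have "(a c)\<^sup>2 * x $ c = (a d)\<^sup>2 * x $ c"
            using Rx[of c] Rc[OF cj, of x] False xj by (simp add: s_def power2_eq_square mult.assoc)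
          then show ?thesis using a_inj[of c d] that by simp
        qed
        have "0 = (\<Sum>m\<in>UNIV - {j}. r m $ j * (r m \<bullet> x))"
          using Rx[of j] xj by (simp add: R)
        also have "\<dots> = (\<Sum>m\<in>UNIV - {j}. if m = d then a d * x $ d else 0)"
          by (intro sum.cong refl) (use xj xc in \<open>auto simp: rx r_nth\<close>)
        also have "\<dots> = a d * x $ d" using False by simp
        finally have "x $ d = 0" using a0[of d] by simp
        then show ?thesis using xc by (metis vec_eq_iff zero_index)
      qed
      from arg_cong[OF this, of "\<lambda>x. x $ c"] show ?thesis by (simp add: x_def)
    qed
    then show ?thesis by (simp add: vec_eq_iff split_paired_All)
  qed
  then have "det (sylvester ?R ?S) \<noteq> 0"
    using det_eq_0_iff_kernel by blast
  then show ?thesis by blast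
qed

text \<open>Full column rank of \<open>X\<close> without row \<open>i\<close> persists when the row
  is restored. The submatrix does not involve the entry \<open>(i, j)\<close>, so this keeps
  \<open>d q\<close> positive on a whole line.\<close>

lemma gram_eq_0_imp:
  assumes "det (row_gram i X) \<noteq> 0" "gram X x = 0"
  shows "x = 0"
proof -
  have "(X *v x) \<bullet> (X *v x) = 0"
    using assms(2) by (simp add: gram_inner[symmetric])
  then have "X $ k \<bullet> x = 0" for k
    by (metis inner_eq_zero_iff matrix_vector_mult_row zero_index)
  then have "row_gram i X *v x = 0"
    by (simp add: vec_eq_iff row_gram_mult)
  then show ?thesis using assms(1) det_eq_0_iff_kernel by blast
qed

text \<open>If \<open>q < p\<close>, there is room for \<open>q\<close> unit rows besides row
  \<open>i\<close>. For \<open>p = q\<close> only \<open>q - 1\<close> rows remain and the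
  determinant vanishes identically.\<close>

lemma det_row_gram_generic:
  fixes i :: "'p::finite"
  assumes pq: "CARD('q) < CARD('p)"
  shows "\<exists>X :: real ^ 'q ^ 'p. det (row_gram i X) \<noteq> 0"
proof -
  obtain \<pi> :: "'q \<Rightarrow> 'p" where \<pi>: "inj \<pi>" "\<And>l. \<pi> l \<noteq> i"
  proof -
    have "card (UNIV - {i}) = CARD('p) - 1" by simp
    then have "\<exists>g. g ` (UNIV :: 'q set) \<subseteq> UNIV - {i} \<and> inj g"
      using pq by (intro card_le_inj) auto
    then obtain g :: "'q \<Rightarrow> 'p" where "inj g" "g ` UNIV \<subseteq> UNIV - {i}" by blast
    then show thesis by (intro that[of g]) auto
  qed
  define X :: "real ^ 'q ^ 'p" where "X = (\<chi> k l. if k = \<pi> l then 1 else 0)"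
  have "row_gram i X $ a $ b = (if a = b then 1 else 0)" for a b
  proof -
    have "row_gram i X $ a $ b = (\<Sum>k\<in>UNIV - {i}. X $ k $ a * X $ k $ b)"
      by (simp add: row_gram_def)
    also have "\<dots> = (\<Sum>k\<in>UNIV - {i}. if k = \<pi> a then (if a = b then 1 else 0) else 0)"
      by (intro sum.cong refl) (use \<pi> in \<open>auto simp: X_def inj_eq\<close>)
    finally show ?thesis using \<pi>(2)[of a] by simp
  qed
  then have "row_gram i X = mat 1" by (simp add: vec_eq_iff mat_def)
  then show ?thesis by (intro exI[of _ X]) simp
qed

definition matrix_of :: "('p \<times> 'q \<Rightarrow> real) \<Rightarrow> real ^ 'q ^ 'p"
  where "matrix_of x = (\<chi> i j. x (i, j))"

text \<open>Both determinants are unchanged when the entry \<open>(i, j)\<close> is updated, which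
  is why a single null set of \<open>x\<close> serves all \<open>t\<close>.\<close>

lemma AE_line_generic:
  fixes N :: "'p::finite \<times> 'q::finite \<Rightarrow> real measure"
  assumes pq: "CARD('q) \<le> CARD('p)"
    and prob: "\<And>s. prob_space (N s)" and sets: "\<And>s. sets (N s) = sets borel"
    and atomless: "\<And>s c. emeasure (N s) {c} = 0"
  shows "AE x in Pi\<^sub>M UNIV N. \<forall>t. simple_gram (matrix_of (x((i, j) := t))) \<and>
    (CARD('q) < CARD('p) \<longrightarrow> (\<forall>y. gram (matrix_of (x((i, j) := t))) y = 0 \<longrightarrow> y = 0))"
proof -
  let ?P = "\<lambda>x. det (sylvester (row_gram i (matrix_of x)) (col_gram j (matrix_of x)))"
  let ?Q = "\<lambda>x. det (row_gram i (matrix_of x) :: real ^ 'q ^ 'q)"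
  have entry: "\<exists>x. matrix_of x = X" for X :: "real ^ 'q ^ 'p"
    by (rule exI[of _ "\<lambda>(i, j). X $ i $ j"]) (simp add: matrix_of_def)
  have sR: "sep_poly (\<lambda>x. row_gram i (matrix_of x) $ a $ b)" for a b :: 'q
    unfolding row_gram_def matrix_of_def by (simp add: sep_poly_sum sep_poly_mult sep_poly_coord)
  have sS: "sep_poly (\<lambda>x. col_gram j (matrix_of x) $ a $ b)" for a b
  proof (cases "a = j \<or> b = j")
    case True
    then show ?thesis by (simp add: col_gram_def sep_poly_const)
  next
    case False
    then show ?thesis
      by (simp add: col_gram_def matrix_of_def sep_poly_sum sep_poly_mult sep_poly_coord)
  qed
  have sP: "sep_poly ?P"
  proof (rule sep_poly_det)
    fix r s :: "'q \<times> 'q"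
    have 1: "sep_poly (\<lambda>x. if snd r = snd s then row_gram i (matrix_of x) $ fst r $ fst s else 0)"
      by (cases "snd r = snd s") (auto intro: sR sep_poly_const)
    have 2: "sep_poly (\<lambda>x. if fst r = fst s then col_gram j (matrix_of x) $ snd s $ snd r else 0)"
      by (cases "fst r = fst s") (auto intro: sS sep_poly_const)
    show "sep_poly (\<lambda>x. sylvester (row_gram i (matrix_of x)) (col_gram j (matrix_of x)) $ r $ s)"
      unfolding sylvester_def using sep_poly_diff[OF 1 2] by simp
  qed
  have updR: "row_gram i (matrix_of (x((i, j) := t))) = row_gram i (matrix_of x)" for x t
    unfolding row_gram_def matrix_of_def by (auto simp: vec_eq_iff intro!: sum.cong)
  have updS: "col_gram j (matrix_of (x((i, j) := t))) = col_gram j (matrix_of x)" for x t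
    unfolding col_gram_def matrix_of_def by (auto simp: vec_eq_iff)
  have AP: "AE x in Pi\<^sub>M UNIV N. ?P x \<noteq> 0"
  proof -
    obtain x where "?P x \<noteq> 0" using det_sylvester_generic[OF pq] entry by metis
    from AE_sep_poly_nonzero[OF sP this prob sets atomless] show ?thesis .
  qed
  have AQ: "AE x in Pi\<^sub>M UNIV N. CARD('q) < CARD('p) \<longrightarrow> ?Q x \<noteq> 0"
  proof (cases "CARD('q) < CARD('p)")
    case True
    obtain x where "?Q x \<noteq> 0" using det_row_gram_generic[OF True] entry by metis
    from AE_sep_poly_nonzero[OF sep_poly_det[OF sR] this prob sets atomless] show ?thesis by simp
  qed simp
  from AP AQ show ?thesis
  proof eventually_elim
    case (elim x)
    show ?case
    proof (intro allI conjI impI)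
      fix t show "simple_gram (matrix_of (x((i, j) := t)))"
        by (rule simple_gram_sylvester[of i _ j]) (use elim in \<open>simp add: updR updS\<close>)
    next
      fix t y assume "CARD('q) < CARD('p)" "gram (matrix_of (x((i, j) := t))) y = 0"
      then show "y = 0" using elim by (intro gram_eq_0_imp[of i "matrix_of (x((i, j) := t))" y]) (simp_all add: updR)
    qed
  qed
qed

section \<open>Perturbation of simple singular values\<close>

lemma bounded_bilinear_matrix_vector_mult:
  "bounded_bilinear ((*v) :: real ^ 'n ^ 'm \<Rightarrow> real ^ 'n \<Rightarrow> real ^ 'm)"
  unfolding bilinear_conv_bounded_bilinear[symmetric] bilinear_def
  by (auto intro!: linearI simp: matrix_vector_mult_add_rdistrib matrix_vector_right_distrib
      matrix_vector_mult_scaleR scaleR_matrix_vector_assoc)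

lemma bounded_linear_transpose: "bounded_linear (transpose :: real ^ 'n ^ 'm \<Rightarrow> real ^ 'm ^ 'n)"
  unfolding linear_conv_bounded_linear[symmetric]
  by (auto intro!: linearI simp: transpose_def vec_eq_iff)

lemma bounded_bilinear_outer_prod:
  "bounded_bilinear (outer_prod :: real ^ 'p \<Rightarrow> real ^ 'q \<Rightarrow> real ^ 'q ^ 'p)"
  unfolding bilinear_conv_bounded_bilinear[symmetric] bilinear_def
  by (auto intro!: linearI simp: outer_prod_def vec_eq_iff algebra_simps)

lemmas matrix_vector_mult_has_derivative [derivative_intros] =
  bounded_bilinear.FDERIV[OF bounded_bilinear_matrix_vector_mult]
lemmas transpose_has_derivative [derivative_intros] =
  bounded_linear.has_derivative[OF bounded_linear_transpose]
lemmas outer_prod_has_derivative [derivative_intros] =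
  bounded_bilinear.FDERIV[OF bounded_bilinear_outer_prod]
lemmas matrix_vector_mult_continuous_on [continuous_intros] =
  bounded_bilinear.continuous_on[OF bounded_bilinear_matrix_vector_mult]
lemmas transpose_continuous_on [continuous_intros] =
  bounded_linear.continuous_on[OF bounded_linear_transpose]

definition gram_deriv :: "real ^ 'q ^ 'p \<Rightarrow> real ^ 'q ^ 'p \<Rightarrow> real ^ 'q \<Rightarrow> real ^ 'q"
  where "gram_deriv X H x = transpose X *v (H *v x) + transpose H *v (X *v x)"

lemma gram_deriv_inner:
  "gram_deriv X H x \<bullet> y = (H *v x) \<bullet> (X *v y) + (X *v x) \<bullet> (H *v y)"
  unfolding gram_deriv_def by (simp add: inner_add_left dot_lmul_matrix)

lemma gram_has_derivative:
  assumes "(V has_derivative V') (at X within S)"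
  shows "((\<lambda>X. gram X (V X)) has_derivative (\<lambda>H. gram_deriv X H (V X) + gram X (V' H))) (at X within S)"
  unfolding gram_def gram_deriv_def
  by (rule has_derivative_eq_rhs, (rule derivative_intros assms)+)
    (simp add: fun_eq_iff matrix_vector_right_distrib algebra_simps del: transpose_matrix_vector)

text \<open>The inverse function theorem for \<open>(X, x, e) \<mapsto> (X, X\<^sup>T X x - e x, x \<bullet> x)\<close>.\<close>

lemma simple_eigenpair_differentiable:
  fixes X0 :: "real ^ 'q ^ 'p"
  assumes ev: "gram X0 x0 = e0 *\<^sub>R x0" and unit: "x0 \<bullet> x0 = 1"
    and simple: "\<And>h. gram X0 h = e0 *\<^sub>R h \<Longrightarrow> h \<bullet> x0 = 0 \<Longrightarrow> h = 0"
  shows "\<exists>V V' e e'. V X0 = x0 \<and> e X0 = e0 \<and> (V has_derivative V') (at X0) \<and> (e has_derivative e') (at X0) \<and>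
    (\<forall>\<^sub>F X in nhds X0. gram X (V X) = e X *\<^sub>R V X \<and> V X \<bullet> V X = 1)"
proof -
  \<comment> \<open>\<open>X\<close> is carried along so that domain and codomain agree, as in the
    derivation of the implicit function theorem. The component \<open>x \<bullet> x\<close> fixes
    the length of the eigenvector; rescaling \<open>x\<close> would otherwise lie in the kernel of
    the derivative.\<close>
  define \<Phi> where "\<Phi> = (\<lambda>(X :: real ^ 'q ^ 'p, x, e :: real). (X, gram X x - e *\<^sub>R x, x \<bullet> x))"
  define \<Phi>' where "\<Phi>' = (\<lambda>(X :: real ^ 'q ^ 'p, x, e :: real) (H, h, \<eta>).
    (H :: real ^ 'q ^ 'p, gram_deriv X H x + gram X h - e *\<^sub>R h - \<eta> *\<^sub>R x, 2 * (x \<bullet> h)))"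
  have der: "(\<Phi> has_derivative \<Phi>' z) (at z)" for z
  proof -
    obtain X x e where z: "z = (X, x, e)" by (cases z) auto
    show ?thesis
      unfolding \<Phi>_def \<Phi>'_def gram_def gram_deriv_def z case_prod_unfold fst_conv snd_conv
      by (rule has_derivative_eq_rhs, (rule derivative_intros)+)
        (simp add: fun_eq_iff matrix_vector_right_distrib inner_commute algebra_simps del: transpose_matrix_vector)
  qed
  then have bl: "bounded_linear (\<Phi>' z)" for z by (rule has_derivative_bounded_linear)
  have app: "blinfun_apply (Blinfun (\<Phi>' z)) = \<Phi>' z" for z by (rule bounded_linear_Blinfun_apply[OF bl])
  have cont: "continuous_on UNIV (\<lambda>z. Blinfun (\<Phi>' z))"
  proof (rule continuous_on_blinfun_componentwise)
    fix b :: "(real ^ 'q ^ 'p) \<times> (real ^ 'q) \<times> real"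
    show "continuous_on UNIV (\<lambda>z. blinfun_apply (Blinfun (\<Phi>' z)) b)"
      unfolding app unfolding \<Phi>'_def gram_def gram_deriv_def case_prod_unfold by (intro continuous_intros)
  qed
  let ?z = "(X0, x0, e0)"
  have lin: "linear (\<Phi>' ?z)" using bl by (simp add: linear_conv_bounded_linear)
  have "inj (\<Phi>' ?z)"
  proof (subst linear_injective_0[OF lin], safe)
    fix H h \<eta> assume "\<Phi>' ?z (H, h, \<eta>) = 0"
    then have H: "H = 0" and E: "gram_deriv X0 H x0 + gram X0 h - e0 *\<^sub>R h - \<eta> *\<^sub>R x0 = 0" and O: "x0 \<bullet> h = 0"
      by (auto simp: \<Phi>'_def zero_prod_def)
    from H E have E: "gram X0 h - e0 *\<^sub>R h = \<eta> *\<^sub>R x0"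
      by (simp add: gram_deriv_def transpose_def zero_vec_def[symmetric])
    \<comment> \<open>Testing against \<open>x0\<close> kills the left-hand side by self-adjointness
      and isolates \<open>\<eta>\<close>. Then \<open>h\<close> lies in the eigenspace of
      \<open>e0\<close> and is orthogonal to \<open>x0\<close>.\<close>
    have "(gram X0 h - e0 *\<^sub>R h) \<bullet> x0 = h \<bullet> gram X0 x0 - e0 * (h \<bullet> x0)"
      by (simp add: inner_diff_left gram_selfadjoint)
    then have "\<eta> = 0" using E O ev unit by (simp add: inner_commute)
    moreover from this have "h = 0" using E O by (intro simple) (auto simp: inner_commute)
    ultimately show "(H, h, \<eta>) = 0" using H by (simp add: zero_prod_def)
  qed
  then obtain L where L: "linear L" "L \<circ> \<Phi>' ?z = id"
    using linear_injective_left_inverse[OF lin] by blast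
  have "Blinfun L o\<^sub>L Blinfun (\<Phi>' ?z) = id_blinfun"
    using L(1) fun_cong[OF L(2)] by (intro blinfun_eqI)
      (simp add: app bounded_linear_Blinfun_apply linear_conv_bounded_linear)
  moreover have "(\<Phi> has_derivative blinfun_apply (Blinfun (\<Phi>' z))) (at z)" for z
    unfolding app by (rule der)
  ultimately obtain U W g g' where U: "?z \<in> U" and W: "open W" "\<Phi> ?z \<in> W" and hom: "homeomorphism U W \<Phi> g"
    and g': "\<And>y. y \<in> W \<Longrightarrow> (g has_derivative g' y) (at y)"
    using inverse_function_theorem[OF open_UNIV _ cont UNIV_I] by metis
  \<comment> \<open>The values that \<open>\<Phi>\<close> takes at a unit eigenpair of
    \<open>X\<close>; the local inverse applied to them is the eigenpair near
    \<open>(x0, e0)\<close>.\<close>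
  define \<iota> where "\<iota> X = (X, 0 :: real ^ 'q, 1 :: real)" for X :: "real ^ 'q ^ 'p"
  have \<Phi>z: "\<Phi> ?z = \<iota> X0" using ev unit by (simp add: \<Phi>_def \<iota>_def)
  have gz: "g (\<iota> X0) = ?z"
    using homeomorphism_apply1[OF hom U] \<Phi>z by simp
  have "(\<iota> has_derivative (\<lambda>H. (H, 0, 0))) (at X0)"
    unfolding \<iota>_def by (rule derivative_intros)+
  moreover have "(g has_derivative g' (\<iota> X0)) (at (\<iota> X0))"
    using g' W \<Phi>z by simp
  ultimately have d: "((\<lambda>X. g (\<iota> X)) has_derivative (\<lambda>H. g' (\<iota> X0) (H, 0, 0))) (at X0)"
    by (rule has_derivative_compose)
  have "open (\<iota> -` W)"
    unfolding \<iota>_def by (intro open_vimage W continuous_intros)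
  moreover have "X0 \<in> \<iota> -` W" using W \<Phi>z by simp
  ultimately have ev: "\<forall>\<^sub>F X in nhds X0. \<iota> X \<in> W"
    unfolding eventually_nhds by blast
  show ?thesis
  proof (intro exI conjI)
    show "((\<lambda>X. fst (snd (g (\<iota> X)))) has_derivative (\<lambda>H. fst (snd (g' (\<iota> X0) (H, 0, 0))))) (at X0)"
      by (intro has_derivative_fst has_derivative_snd d)
    show "((\<lambda>X. snd (snd (g (\<iota> X)))) has_derivative (\<lambda>H. snd (snd (g' (\<iota> X0) (H, 0, 0))))) (at X0)"
      by (intro has_derivative_snd d)
    show "\<forall>\<^sub>F X in nhds X0. gram X (fst (snd (g (\<iota> X)))) = snd (snd (g (\<iota> X))) *\<^sub>R fst (snd (g (\<iota> X)))
      \<and> fst (snd (g (\<iota> X))) \<bullet> fst (snd (g (\<iota> X))) = 1"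
      using ev
    proof eventually_elim
      case (elim X)
      have "\<Phi> (g (\<iota> X)) = \<iota> X" using homeomorphism_apply2[OF hom elim] .
      then show ?case by (auto simp: \<Phi>_def \<iota>_def case_prod_unfold)
    qed
  qed (simp_all add: gz)
qed

lemma gram_eigenvectors_orthogonal:
  assumes "gram X x = a *\<^sub>R x" "gram X y = b *\<^sub>R y" "a \<noteq> b"
  shows "x \<bullet> y = 0"
proof -
  have "a * (x \<bullet> y) = b * (x \<bullet> y)"
    using gram_selfadjoint[of X x y] assms by simp
  then show ?thesis using assms(3) by simp
qed

lemma distinct_svd_eigen_less:
  fixes X :: "real ^ 'q ^ 'p"
  assumes "distinct_svd X d u v" "k \<in> {1..CARD('q)}" "l \<in> {1..CARD('q)}" "k < l"
  shows "(d l)\<^sup>2 < (d k)\<^sup>2"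
  using distinct_svdD(3,4)[OF assms(1)] assms(2-) by (intro power_strict_mono) auto

lemma distinct_svd_eigen_neq:
  fixes X :: "real ^ 'q ^ 'p"
  assumes "distinct_svd X d u v" "k \<in> {1..CARD('q)}" "l \<in> {1..CARD('q)}" "k \<noteq> l"
  shows "(d k)\<^sup>2 \<noteq> (d l)\<^sup>2"
  using distinct_svd_eigen_less[OF assms(1-3)] distinct_svd_eigen_less[OF assms(1,3,2)] assms(4)
  by (cases k l rule: linorder_cases) auto

text \<open>First-order perturbation theory: the eigenvalue equation and the normalisation of
  \<open>V k X\<close> are differentiated at \<open>X0\<close> and projected onto the
  \<open>v l\<close>. Derivatives are given for \<open>e = d\<^sup>2\<close> and \<open>v\<close>
  only, as at a vanishing singular value \<open>d\<close> need not be differentiable and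
  \<open>u\<close> is not determined.\<close>

lemma distinct_svd_perturbation:
  fixes X0 :: "real ^ 'q ^ 'p"
  assumes pq: "CARD('q) \<le> CARD('p)" and svd: "distinct_svd X0 d u v"
  shows "\<exists>V V' e e'. (\<forall>\<^sub>F X in nhds X0. \<exists>u. distinct_svd X (\<lambda>k. sqrt (e k X)) u (\<lambda>k. V k X)) \<and>
    (\<forall>k\<in>{1..CARD('q)}. V k X0 = v k \<and> e k X0 = (d k)\<^sup>2 \<and>
      (V k has_derivative V' k) (at X0) \<and> (e k has_derivative e' k) (at X0) \<and>
      (\<forall>H. e' k H = gram_deriv X0 H (v k) \<bullet> v k \<and> V' k H \<bullet> v k = 0 \<and>
        (\<forall>l\<in>{1..CARD('q)} - {k}. V' k H \<bullet> v l = gram_deriv X0 H (v k) \<bullet> v l / ((d k)\<^sup>2 - (d l)\<^sup>2))))"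
proof -
  let ?q = "CARD('q)"
  note D = distinct_svdD[OF svd]
  have eig: "gram X0 (v k) = (d k)\<^sup>2 *\<^sub>R v k" if "k \<in> {1..?q}" for k
    by (rule distinct_svd_mult[OF svd that])
  have unit: "v k \<bullet> v k = 1" if "k \<in> {1..?q}" for k
    using orthonormal_onD[OF D(2) that that] by simp
  have simple: "h = 0" if k: "k \<in> {1..?q}" and h: "gram X0 h = (d k)\<^sup>2 *\<^sub>R h" "h \<bullet> v k = 0" for k h
  proof (rule orthonormal_on_complete[of v])
    show "orthonormal_on DIM(real ^ 'q) v" using D(2) by simp
    fix l assume "l \<in> {1..DIM(real ^ 'q)}"
    then have l: "l \<in> {1..?q}" by simp
    show "h \<bullet> v l = 0"
    proof (cases "l = k")
      case True
      then show ?thesis using h by simp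
    next
      case False
      then show ?thesis
        by (intro gram_eigenvectors_orthogonal[OF h(1) eig[OF l]] distinct_svd_eigen_neq[OF svd k l]) simp
    qed
  qed
  have "\<forall>k\<in>{1..?q}. \<exists>V V' e e'. V X0 = v k \<and> e X0 = (d k)\<^sup>2 \<and> (V has_derivative V') (at X0) \<and>
    (e has_derivative e') (at X0) \<and> (\<forall>\<^sub>F X in nhds X0. gram X (V X) = e X *\<^sub>R V X \<and> V X \<bullet> V X = 1)"
  proof
    fix k assume k: "k \<in> {1..?q}"
    show "\<exists>V V' e e'. V X0 = v k \<and> e X0 = (d k)\<^sup>2 \<and> (V has_derivative V') (at X0) \<and>
      (e has_derivative e') (at X0) \<and> (\<forall>\<^sub>F X in nhds X0. gram X (V X) = e X *\<^sub>R V X \<and> V X \<bullet> V X = 1)"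
      by (rule simple_eigenpair_differentiable[OF eig[OF k] unit[OF k] simple[OF k]])
  qed
  then obtain V V' e e' where
    *: "\<forall>k\<in>{1..?q}. V k X0 = v k \<and> e k X0 = (d k)\<^sup>2 \<and> (V k has_derivative V' k) (at X0) \<and>
    (e k has_derivative e' k) (at X0) \<and>
    (\<forall>\<^sub>F X in nhds X0. gram X (V k X) = e k X *\<^sub>R V k X \<and> V k X \<bullet> V k X = 1)"
    unfolding bchoice_iff by blast
  have V0: "V k X0 = v k" and e0: "e k X0 = (d k)\<^sup>2" and V': "(V k has_derivative V' k) (at X0)"
    and e': "(e k has_derivative e' k) (at X0)"
    and nbh: "\<forall>\<^sub>F X in nhds X0. gram X (V k X) = e k X *\<^sub>R V k X \<and> V k X \<bullet> V k X = 1"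
    if "k \<in> {1..?q}" for k
    using * that by auto
  \<comment> \<open>By continuity the order persists nearby. Distinct eigenvalues then make the
    separately constructed branches orthogonal to each other.\<close>
  have less: "\<forall>\<^sub>F X in nhds X0. e l X < e k X" if "k \<in> {1..?q}" "l \<in> {1..?q}" "k < l" for k l
  proof -
    have "isCont (\<lambda>X. e k X - e l X) X0"
      using has_derivative_continuous[OF e'[OF that(1)]] has_derivative_continuous[OF e'[OF that(2)]]
      by (intro continuous_intros) auto
    then have "((\<lambda>X. e k X - e l X) \<longlongrightarrow> e k X0 - e l X0) (nhds X0)"
      unfolding isCont_def by (rule tendsto_at_iff_tendsto_nhds[THEN iffD1])
    moreover have "0 < e k X0 - e l X0"
      using distinct_svd_eigen_less[OF svd that] that by (simp add: e0)
    ultimately have "\<forall>\<^sub>F X in nhds X0. 0 < e k X - e l X" by (rule order_tendstoD(1))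
    then show ?thesis by eventually_elim simp
  qed
  have all: "\<forall>\<^sub>F X in nhds X0. \<forall>k\<in>{1..?q}. gram X (V k X) = e k X *\<^sub>R V k X \<and> V k X \<bullet> V k X = 1"
    using nbh by (intro eventually_ball_finite) auto
  have allless: "\<forall>\<^sub>F X in nhds X0. \<forall>k\<in>{1..?q}. \<forall>l\<in>{1..?q}. k < l \<longrightarrow> e l X < e k X"
  proof (intro eventually_ball_finite ballI)
    fix k l assume "k \<in> {1..?q}" "l \<in> {1..?q}"
    then show "\<forall>\<^sub>F X in nhds X0. k < l \<longrightarrow> e l X < e k X"
      using less[of k l] by (cases "k < l") auto
  qed auto
  have svdX: "\<forall>\<^sub>F X in nhds X0. \<exists>u. distinct_svd X (\<lambda>k. sqrt (e k X)) u (\<lambda>k. V k X)"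
    using all allless
  proof eventually_elim
    case (elim X)
    have neq: "e k X \<noteq> e l X" if "k \<in> {1..?q}" "l \<in> {1..?q}" "k \<noteq> l" for k l
      using elim(2) that by (cases k l rule: linorder_cases) force+
    show ?case
    proof (rule distinct_svd_exists[OF pq])
      show "orthonormal_on ?q (\<lambda>k. V k X)"
        unfolding orthonormal_on_def
      proof (intro ballI)
        fix k l assume kl: "k \<in> {1..?q}" "l \<in> {1..?q}"
        show "V k X \<bullet> V l X = (if k = l then 1 else 0)"
        proof (cases "k = l")
          case True
          then show ?thesis using elim(1) kl by simp
        next
          case False
          have "V k X \<bullet> V l X = 0"
            by (rule gram_eigenvectors_orthogonal[OF _ _ neq[OF kl False]]) (use elim(1) kl in auto)
          then show ?thesis using False by simp
        qed
      qed
    qed (use elim in auto)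
  qed
  have eqs: "gram_deriv X0 H (v k) + gram X0 (V' k H) = (d k)\<^sup>2 *\<^sub>R V' k H + e' k H *\<^sub>R v k"
    "V' k H \<bullet> v k = 0" if k: "k \<in> {1..?q}" for k H
  proof -
    have near: "\<forall>\<^sub>F X in at X0. gram X (V k X) = e k X *\<^sub>R V k X \<and> V k X \<bullet> V k X = 1"
      using nbh[OF k] by (auto simp: eventually_nhds_conv_at)
    have x0: "gram X0 (V k X0) = e k X0 *\<^sub>R V k X0 \<and> V k X0 \<bullet> V k X0 = 1"
      using nbh[OF k] by (rule eventually_nhds_x_imp_x)
    have 1: "((\<lambda>X. gram X (V k X)) has_derivative (\<lambda>H. gram_deriv X0 H (V k X0) + gram X0 (V' k H))) (at X0)"
      by (rule gram_has_derivative[OF V'[OF k]])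
    have "((\<lambda>X. e k X *\<^sub>R V k X) has_derivative (\<lambda>H. e k X0 *\<^sub>R V' k H + e' k H *\<^sub>R V k X0)) (at X0)"
      by (rule has_derivative_scaleR[OF e'[OF k] V'[OF k]])
    then have 2: "((\<lambda>X. gram X (V k X)) has_derivative (\<lambda>H. e k X0 *\<^sub>R V' k H + e' k H *\<^sub>R V k X0)) (at X0)"
      by (rule has_derivative_transform_eventually) (use near x0 in \<open>auto elim: eventually_mono\<close>)
    from has_derivative_unique[OF 1 2] show "gram_deriv X0 H (v k) + gram X0 (V' k H) = (d k)\<^sup>2 *\<^sub>R V' k H + e' k H *\<^sub>R v k"
      using V0[OF k] e0[OF k] by (simp add: fun_eq_iff)
    have "((\<lambda>X. V k X \<bullet> V k X) has_derivative (\<lambda>H. V k X0 \<bullet> V' k H + V' k H \<bullet> V k X0)) (at X0)"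
      by (rule has_derivative_inner[OF V'[OF k] V'[OF k]])
    then have 3: "((\<lambda>X. 1) has_derivative (\<lambda>H. V k X0 \<bullet> V' k H + V' k H \<bullet> V k X0)) (at X0)"
      by (rule has_derivative_transform_eventually) (use near x0 in \<open>auto elim: eventually_mono\<close>)
    have 4: "((\<lambda>X. 1) has_derivative (\<lambda>H. 0)) (at X0)" by (rule has_derivative_const)
    from fun_cong[OF has_derivative_unique[OF 3 4], of H] show "V' k H \<bullet> v k = 0"
      using V0[OF k] by (simp add: inner_commute)
  qed
  have proj: "gram_deriv X0 H (v k) \<bullet> v l + (d l)\<^sup>2 * (V' k H \<bullet> v l) = (d k)\<^sup>2 * (V' k H \<bullet> v l) + e' k H * (v k \<bullet> v l)"
    if "k \<in> {1..?q}" "l \<in> {1..?q}" for k l H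
    using arg_cong[OF eqs(1)[OF that(1), of H], of "\<lambda>x. x \<bullet> v l"] eig[OF that(2)]
    by (simp add: inner_add_left gram_selfadjoint)
  have "e' k H = gram_deriv X0 H (v k) \<bullet> v k" if k: "k \<in> {1..?q}" for k H
    using proj[OF k k, of H] unit[OF k] by simp
  moreover have "V' k H \<bullet> v l = gram_deriv X0 H (v k) \<bullet> v l / ((d k)\<^sup>2 - (d l)\<^sup>2)"
    if kl: "k \<in> {1..?q}" "l \<in> {1..?q}" "l \<noteq> k" for k l H
    using proj[OF kl(1,2), of H] orthonormal_onD[OF D(2) kl(1,2)] distinct_svd_eigen_neq[OF svd kl(1,2)] kl(3)
    by (simp add: field_simps)
  ultimately show ?thesis
    using V0 e0 V' e' svdX eqs(2) by (intro exI[of _ V] exI[of _ V'] exI[of _ e] exI[of _ e']) auto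
qed

section \<open>Positivity of the partial derivatives\<close>

lemma sum_offdiagonal_swap:
  fixes g :: "nat \<Rightarrow> nat \<Rightarrow> real"
  assumes "finite A"
  shows "(\<Sum>k\<in>A. \<Sum>l\<in>A - {k}. g k l) = (\<Sum>k\<in>A. \<Sum>l\<in>A - {k}. g l k)"
proof -
  have "(\<Sum>k\<in>A. \<Sum>l\<in>A - {k}. g k l) = (\<Sum>k\<in>A. (\<Sum>l\<in>A. g k l) - g k k)" for g :: "nat \<Rightarrow> nat \<Rightarrow> real"
    by (intro sum.cong refl) (simp add: sum_diff1 assms)
  then show ?thesis by (simp add: sum_subtractf sum.swap[of g])
qed

text \<open>The quadratic form in \<open>s\<close>, \<open>t\<close> is diagonal in
  \<open>s + t\<close> and \<open>s - t\<close>. With \<open>fk = gk * dk\<close> and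
  \<open>fl = gl * dl\<close> its coefficients are half of \<open>(fk - fl) / (dk - dl)\<close> and
  \<open>(fk + fl) / (dk + dl)\<close>, the familiar second-order quotients of spectral
  functions.\<close>

lemma partial_derivative_pair_nonneg:
  fixes dk dl gk gl s t :: real
  assumes dl: "0 \<le> dl" and dkl: "dl < dk" and gl: "0 \<le> gl" and le: "gl * dl \<le> gk * dk"
  shows "0 \<le> gk * s\<^sup>2 + gl * t\<^sup>2 + (gk - gl) * (dk * t + dl * s)\<^sup>2 / (dk\<^sup>2 - dl\<^sup>2)"
proof -
  let ?fk = "gk * dk" and ?fl = "gl * dl"
  have pos: "dk\<^sup>2 - dl\<^sup>2 > 0"
    using power_strict_mono[OF dkl dl, of 2] by simp
  have "(gk * s\<^sup>2 + gl * t\<^sup>2) * (dk\<^sup>2 - dl\<^sup>2) + (gk - gl) * (dk * t + dl * s)\<^sup>2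
     = ((?fk - ?fl) * (dk + dl) * (s + t)\<^sup>2 + (?fk + ?fl) * (dk - dl) * (s - t)\<^sup>2) / 2"
    by (simp add: power2_eq_square field_simps)
  also have "\<dots> \<ge> 0"
  proof -
    have "0 \<le> ?fl" using gl dl by simp
    then have "0 \<le> ?fk + ?fl" "0 \<le> ?fk - ?fl" "0 \<le> dk + dl" "0 \<le> dk - dl"
      using le dl dkl by linarith+
    then have "0 \<le> (?fk - ?fl) * (dk + dl) * (s + t)\<^sup>2" "0 \<le> (?fk + ?fl) * (dk - dl) * (s - t)\<^sup>2"
      by (metis mult_nonneg_nonneg zero_le_power2)+
    then show ?thesis by (intro divide_nonneg_nonneg add_nonneg_nonneg) simp_all
  qed
  finally have "0 \<le> ((gk * s\<^sup>2 + gl * t\<^sup>2) * (dk\<^sup>2 - dl\<^sup>2) + (gk - gl) * (dk * t + dl * s)\<^sup>2) / (dk\<^sup>2 - dl\<^sup>2)"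
    using pos by simp
  also have "\<dots> = gk * s\<^sup>2 + gl * t\<^sup>2 + (gk - gl) * (dk * t + dl * s)\<^sup>2 / (dk\<^sup>2 - dl\<^sup>2)"
    using pos by (simp add: add_divide_distrib)
  finally show ?thesis .
qed

text \<open>Bessel's inequality distributes the terms \<open>g k * (a k)\<^sup>2\<close> among the pairs \<open>(k, l)\<close>.\<close>

lemma partial_derivative_nonneg:
  fixes d g h \<xi> a :: "nat \<Rightarrow> real"
  assumes dpos: "\<And>k. k \<in> {1..n} \<Longrightarrow> 0 \<le> d k"
    and dless: "\<And>k l. k \<in> {1..n} \<Longrightarrow> l \<in> {1..n} \<Longrightarrow> k < l \<Longrightarrow> d l < d k"
    and g: "\<And>k. k \<in> {1..n} \<Longrightarrow> 0 \<le> g k" and h: "\<And>k. k \<in> {1..n} \<Longrightarrow> 0 \<le> h k"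
    and gd: "\<And>k l. k \<in> {1..n} \<Longrightarrow> l \<in> {1..n} \<Longrightarrow> k < l \<Longrightarrow> g l * d l \<le> g k * d k"
    and Bessel: "(\<Sum>k=1..n. (\<xi> k)\<^sup>2) \<le> 1"
  shows "0 \<le> (\<Sum>k=1..n. (h k - g k) * (\<xi> k)\<^sup>2 * (a k)\<^sup>2 + g k * (a k)\<^sup>2 +
    (\<Sum>l\<in>{1..n} - {k}. g k * (d k * \<xi> k * a l + a k * (d l * \<xi> l))\<^sup>2 / ((d k)\<^sup>2 - (d l)\<^sup>2)))"
proof -
  let ?A = "{1..n}"
  \<comment> \<open>A single \<open>G k l\<close> is nonpositive for \<open>k > l\<close>.
    \<open>P\<close> adds to it the share of the diagonal term that makes the sum over both orders
    of a pair nonnegative.\<close>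
  define G where "G k l = g k * (d k * \<xi> k * a l + a k * (d l * \<xi> l))\<^sup>2 / ((d k)\<^sup>2 - (d l)\<^sup>2)" for k l
  define P where "P k l = g k * (a k * \<xi> l)\<^sup>2 + G k l" for k l
  have pair': "0 \<le> P k l + P l k" if kl: "k \<in> ?A" "l \<in> ?A" "k < l" for k l
  proof -
    have "P k l + P l k = g k * (a k * \<xi> l)\<^sup>2 + g l * (a l * \<xi> k)\<^sup>2
        + (g k - g l) * (d k * (a l * \<xi> k) + d l * (a k * \<xi> l))\<^sup>2 / ((d k)\<^sup>2 - (d l)\<^sup>2)"
    proof -
      let ?S = "(d k * (a l * \<xi> k) + d l * (a k * \<xi> l))\<^sup>2" and ?D = "(d k)\<^sup>2 - (d l)\<^sup>2"
      have "G k l = g k * ?S / ?D" by (simp add: G_def mult_ac)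
      moreover have "G l k = - (g l * ?S / ?D)"
      proof -
        have "(d l * \<xi> l * a k + a l * (d k * \<xi> k))\<^sup>2 = ?S" by (simp add: mult_ac add.commute)
        then show ?thesis
          unfolding G_def minus_divide_right by (simp add: minus_diff_eq)
      qed
      ultimately show ?thesis
        unfolding P_def by (simp add: left_diff_distrib diff_divide_distrib)
    qed
    also have "\<dots> \<ge> 0"
      by (rule partial_derivative_pair_nonneg[OF dpos[OF kl(2)] dless[OF kl] g[OF kl(2)] gd[OF kl]])
    finally show ?thesis .
  qed
  have pair: "0 \<le> P k l + P l k" if "k \<in> ?A" "l \<in> ?A" "k \<noteq> l" for k l
    using pair'[of k l] pair'[of l k] that by (cases k l rule: linorder_cases) (auto simp: add.commute)
  have "2 * (\<Sum>k\<in>?A. \<Sum>l\<in>?A - {k}. P k l) = (\<Sum>k\<in>?A. \<Sum>l\<in>?A - {k}. P k l + P l k)"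
    using sum_offdiagonal_swap[of ?A P] by (simp add: sum.distrib)
  also have "\<dots> \<ge> 0" by (intro sum_nonneg pair) auto
  finally have 1: "0 \<le> (\<Sum>k\<in>?A. \<Sum>l\<in>?A - {k}. P k l)" by simp
  have 2: "(\<Sum>l\<in>?A - {k}. g k * (a k * \<xi> l)\<^sup>2) \<le> g k * (a k)\<^sup>2 * (1 - (\<xi> k)\<^sup>2)" if k: "k \<in> ?A" for k
  proof -
    have "(\<Sum>l\<in>?A - {k}. (\<xi> l)\<^sup>2) \<le> 1 - (\<xi> k)\<^sup>2"
      using Bessel k by (simp add: sum_diff1)
    then have "g k * (a k)\<^sup>2 * (\<Sum>l\<in>?A - {k}. (\<xi> l)\<^sup>2) \<le> g k * (a k)\<^sup>2 * (1 - (\<xi> k)\<^sup>2)"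
      using g[OF k] by (intro mult_left_mono) auto
    then show ?thesis by (simp add: sum_distrib_left power_mult_distrib mult.assoc)
  qed
  have "(\<Sum>k\<in>?A. \<Sum>l\<in>?A - {k}. P k l) \<le> (\<Sum>k\<in>?A. h k * (\<xi> k)\<^sup>2 * (a k)\<^sup>2 +
      (g k * (a k)\<^sup>2 * (1 - (\<xi> k)\<^sup>2) + (\<Sum>l\<in>?A - {k}. G k l)))"
  proof (rule sum_mono)
    fix k assume k: "k \<in> ?A"
    have "0 \<le> h k * (\<xi> k)\<^sup>2 * (a k)\<^sup>2" using h[OF k] by simp
    then show "(\<Sum>l\<in>?A - {k}. P k l) \<le> h k * (\<xi> k)\<^sup>2 * (a k)\<^sup>2 +
      (g k * (a k)\<^sup>2 * (1 - (\<xi> k)\<^sup>2) + (\<Sum>l\<in>?A - {k}. G k l))"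
      using 2[OF k] by (simp add: P_def sum.distrib)
  qed
  also have "\<dots> = (\<Sum>k\<in>?A. (h k - g k) * (\<xi> k)\<^sup>2 * (a k)\<^sup>2 + g k * (a k)\<^sup>2 + (\<Sum>l\<in>?A - {k}. G k l))"
    by (intro sum.cong refl) (simp add: algebra_simps)
  finally show ?thesis using 1 by (simp add: G_def)
qed

section \<open>Spectral functions and the quotients \<open>f x / x\<close>\<close>

definition spectral_functions :: "nat \<Rightarrow> (nat \<Rightarrow> real \<Rightarrow> real) \<Rightarrow> (nat \<Rightarrow> real \<Rightarrow> real) \<Rightarrow> bool"
  where "spectral_functions n f f' \<longleftrightarrow>
    (\<forall>k\<in>{1..n}. \<forall>x\<ge>0. 0 \<le> f k x) \<and>
    (\<forall>k\<in>{1..n}. \<forall>x>0. (f k has_real_derivative f' k x) (at x)) \<and>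
    (f n has_real_derivative f' n 0) (at 0 within {0..}) \<and>
    (\<forall>k\<in>{1..n}. \<forall>l\<in>{1..n}. k < l \<longrightarrow> (\<forall>x\<ge>0. f l x \<le> f k x)) \<and>
    (\<forall>k\<in>{1..n}. \<forall>x>0. 0 \<le> f' k x)"

text \<open>The value at \<open>0\<close> is the limit of \<open>f x / x\<close> if \<open>f 0 = 0\<close>.\<close>

definition quotient_fun :: "(real \<Rightarrow> real) \<Rightarrow> (real \<Rightarrow> real) \<Rightarrow> real \<Rightarrow> real"
  where "quotient_fun f f' x = (if x = 0 then f' 0 else f x / x)"

context
  fixes n f f'
  assumes sf: "spectral_functions n f f'"
begin

lemma spectral_functions_nonneg: "k \<in> {1..n} \<Longrightarrow> 0 \<le> x \<Longrightarrow> 0 \<le> f k x"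
  and spectral_functions_deriv: "k \<in> {1..n} \<Longrightarrow> 0 < x \<Longrightarrow> (f k has_real_derivative f' k x) (at x)"
  and spectral_functions_deriv_0: "(f n has_real_derivative f' n 0) (at 0 within {0..})"
  and spectral_functions_le: "k \<in> {1..n} \<Longrightarrow> l \<in> {1..n} \<Longrightarrow> k < l \<Longrightarrow> 0 \<le> x \<Longrightarrow> f l x \<le> f k x"
  and spectral_functions_deriv_nonneg: "k \<in> {1..n} \<Longrightarrow> 0 < x \<Longrightarrow> 0 \<le> f' k x"
  using sf unfolding spectral_functions_def by blast+

lemma spectral_functions_mono:
  assumes k: "k \<in> {1..n}" and xy: "0 < x" "x \<le> y"
  shows "f k x \<le> f k y"
proof (rule DERIV_nonneg_imp_nondecreasing[OF xy(2)])
  fix z assume "x \<le> z" "z \<le> y"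
  then show "\<exists>y. (f k has_real_derivative y) (at z) \<and> 0 \<le> y"
    using spectral_functions_deriv[OF k, of z] spectral_functions_deriv_nonneg[OF k, of z] xy by auto
qed

lemma tendsto_quotient_fun:
  assumes "f n 0 = 0"
  shows "((\<lambda>x. quotient_fun (f n) (f' n) x) \<longlongrightarrow> f' n 0) (at 0 within {0..})"
proof -
  have "((\<lambda>x. (f n x - f n 0) / (x - 0)) \<longlongrightarrow> f' n 0) (at 0 within {0..})"
    using spectral_functions_deriv_0 by (simp add: has_field_derivative_iff)
  then show ?thesis
    by (rule Lim_transform_eventually) (auto simp: eventually_at_filter quotient_fun_def assms)
qed

text \<open>The sign of \<open>f'\<close> is prescribed on the open half line; at \<open>0\<close>
  it is inherited from the nonnegative quotients \<open>f n x / x\<close>.\<close>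

lemma deriv_nonneg_0:
  assumes "f n 0 = 0" "n \<ge> 1"
  shows "0 \<le> f' n 0"
proof (rule tendsto_lowerbound[OF tendsto_quotient_fun[OF assms(1)]])
  show "\<forall>\<^sub>F x in at 0 within {0..}. 0 \<le> quotient_fun (f n) (f' n) x"
    using spectral_functions_nonneg[of n] assms by (auto simp: eventually_at_filter quotient_fun_def)
  show "at (0::real) within {0..} \<noteq> bot"
    by (simp add: at_within_Ici_at_right trivial_limit_at_right_real)
qed

end

text \<open>At a zero of \<open>h\<close> the product rule asks only continuity of the factor
  \<open>c\<close>. This is for \<open>d q = 0\<close>, where the weight is a function of
  \<open>sqrt (e q)\<close>, which need not be differentiable in \<open>X\<close>, while
  \<open>X v q\<close> vanishes.\<close>

lemma has_derivative_scaleR_vanishing: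
  fixes h :: "'a::real_normed_vector \<Rightarrow> 'b::real_normed_vector"
  assumes h: "(h has_derivative h') (at x)" and h0: "h x = 0" and c: "(c \<longlongrightarrow> c x) (at x)"
  shows "((\<lambda>y. c y *\<^sub>R h y) has_derivative (\<lambda>y. c x *\<^sub>R h' y)) (at x)"
proof -
  interpret h': bounded_linear h' using h by (rule has_derivative_bounded_linear)
  let ?r = "\<lambda>y. (h y - h x - h' (y - x)) /\<^sub>R norm (y - x)"
  have r: "(?r \<longlongrightarrow> 0) (at x)"
    using h unfolding has_derivative_at_within by simp
  obtain K where K: "\<And>z. norm (h' z) \<le> norm z * K" using h'.bounded by blast
  have "((\<lambda>y. (c y - c x) *\<^sub>R (h' (y - x) /\<^sub>R norm (y - x))) \<longlongrightarrow> 0) (at x)"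
  proof (rule Lim_null_comparison)
    show "\<forall>\<^sub>F y in at x. norm ((c y - c x) *\<^sub>R (h' (y - x) /\<^sub>R norm (y - x))) \<le> \<bar>c y - c x\<bar> * K"
    proof (intro always_eventually allI)
      fix y
      have "norm (h' (y - x) /\<^sub>R norm (y - x)) \<le> K" if "y \<noteq> x"
        using K[of "y - x"] that by (simp add: field_simps)
      then show "norm ((c y - c x) *\<^sub>R (h' (y - x) /\<^sub>R norm (y - x))) \<le> \<bar>c y - c x\<bar> * K"
      proof (cases "y = x")
        case False
        assume le: "y \<noteq> x \<Longrightarrow> norm (h' (y - x) /\<^sub>R norm (y - x)) \<le> K"
        show ?thesis
          by (subst norm_scaleR, rule mult_left_mono[OF le[OF False]]) simp
      qed simp
    qed
    show "((\<lambda>y. \<bar>c y - c x\<bar> * K) \<longlongrightarrow> 0) (at x)"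
      using tendsto_mult_right[OF tendsto_rabs[OF tendsto_diff[OF c tendsto_const[of "c x"]]], of K] by simp
  qed
  moreover have "((\<lambda>y. c y *\<^sub>R ?r y) \<longlongrightarrow> 0) (at x)"
    using tendsto_scaleR[OF c r] by simp
  ultimately have "((\<lambda>y. c y *\<^sub>R ?r y + (c y - c x) *\<^sub>R (h' (y - x) /\<^sub>R norm (y - x))) \<longlongrightarrow> 0) (at x)"
    using tendsto_add by fastforce
  \<comment> \<open>The remainder of the product is \<open>c y\<close> times the remainder of
    \<open>h\<close> plus \<open>c y - c x\<close> times a bounded quotient.\<close>
  moreover have "c y *\<^sub>R ?r y + (c y - c x) *\<^sub>R (h' (y - x) /\<^sub>R norm (y - x))
      = (c y *\<^sub>R h y - c x *\<^sub>R h x - c x *\<^sub>R h' (y - x)) /\<^sub>R norm (y - x)" for y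
    by (simp add: h0 algebra_simps)
  ultimately show ?thesis
    unfolding has_derivative_at_within by (simp add: bounded_linear_scaleR_right h'.bounded_linear_axioms bounded_linear_const_scaleR h0)
qed

section \<open>Differentiability of the estimator\<close>

definition svd_domain :: "(nat \<Rightarrow> real \<Rightarrow> real) \<Rightarrow> (real ^ 'q ^ 'p) set"
  where "svd_domain f = {X. \<exists>d u v. distinct_svd X d u v \<and> (0 < d CARD('q) \<or> f CARD('q) 0 = 0)}"

text \<open>Entry \<open>(i, j)\<close> of the derivative, in direction \<open>(i, j)\<close>, of
  the sum of \<open>g k (d k)\<close> times \<open>X v k (v k)^T\<close> with
  \<open>g k x = f k x / x\<close>. The three summands stem from the weight, from the factor
  \<open>X\<close> and from the motion of \<open>v k\<close>. By the choice of
  \<open>quotient_fun\<close> at \<open>0\<close> the first one vanishes for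
  \<open>d k = 0\<close>.\<close>

definition partial_deriv ::
    "(nat \<Rightarrow> real \<Rightarrow> real) \<Rightarrow> (nat \<Rightarrow> real \<Rightarrow> real) \<Rightarrow> (nat \<Rightarrow> real) \<Rightarrow> (nat \<Rightarrow> real ^ 'p) \<Rightarrow> (nat \<Rightarrow> real ^ 'q)
      \<Rightarrow> 'p \<Rightarrow> 'q \<Rightarrow> real"
  where "partial_deriv f f' d u v i j = (\<Sum>k=1..CARD('q).
    (f' k (d k) - quotient_fun (f k) (f' k) (d k)) * (u k $ i)\<^sup>2 * (v k $ j)\<^sup>2
    + quotient_fun (f k) (f' k) (d k) * (v k $ j)\<^sup>2
    + (\<Sum>l\<in>{1..CARD('q)} - {k}. quotient_fun (f k) (f' k) (d k) *
        (d k * u k $ i * v l $ j + v k $ j * (d l * u l $ i))\<^sup>2 / ((d k)\<^sup>2 - (d l)\<^sup>2)))"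

text \<open>Writing \<open>X v k\<close> for \<open>d k u k\<close> eliminates the left singular
  vectors. At \<open>d k = 0\<close> both sides have a zero term, because then \<open>k = q\<close>
  and \<open>f q 0 = 0\<close>.\<close>

lemma spectral_estimator_formula:
  fixes F :: "real ^ 'q ^ 'p \<Rightarrow> real ^ 'q ^ 'p"
  assumes F: "spectral_estimator f F" and svd: "distinct_svd X d u v"
    and ok: "0 < d CARD('q) \<or> f CARD('q) 0 = 0"
  shows "F X = (\<Sum>k=1..CARD('q). quotient_fun (f k) (f' k) (d k) *\<^sub>R outer_prod (X *v v k) (v k))"
proof -
  have "F X = (\<Sum>k=1..CARD('q). f k (d k) *\<^sub>R outer_prod (u k) (v k))"
    using F svd ok unfolding spectral_estimator_def by blast
  also have "\<dots> = (\<Sum>k=1..CARD('q). quotient_fun (f k) (f' k) (d k) *\<^sub>R outer_prod (X *v v k) (v k))"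
  proof (intro sum.cong refl)
    fix k assume k: "k \<in> {1..CARD('q)}"
    have "outer_prod (X *v v k) (v k) = d k *\<^sub>R outer_prod (u k) (v k)"
      by (simp add: distinct_svd_mult[OF svd k] bounded_bilinear.scaleR_left[OF bounded_bilinear_outer_prod])
    moreover have "f k 0 = 0" if "d k = 0"
    proof -
      have "k = CARD('q)" using distinct_svd_zero[OF svd k that] .
      then show ?thesis using ok that by auto
    qed
    ultimately show "f k (d k) *\<^sub>R outer_prod (u k) (v k)
        = quotient_fun (f k) (f' k) (d k) *\<^sub>R outer_prod (X *v v k) (v k)"
      by (auto simp: quotient_fun_def)
  qed
  finally show ?thesis .
qed

lemma spectral_estimator_has_derivative:
  fixes F :: "real ^ 'q ^ 'p \<Rightarrow> real ^ 'q ^ 'p"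
  assumes pq: "CARD('q) \<le> CARD('p)" and sf: "spectral_functions CARD('q) f f'"
    and F: "spectral_estimator f F" and svd: "distinct_svd X0 d u v"
    and ok: "0 < d CARD('q) \<or> f CARD('q) 0 = 0"
  shows "\<exists>F'. (F has_derivative F') (at X0) \<and>
           (\<forall>i j. F' (axis i (axis j 1)) $ i $ j = partial_deriv f f' d u v i j)"
    and "\<forall>\<^sub>F X in nhds X0. X \<in> svd_domain f"
proof -
  let ?q = "CARD('q)"
  let ?g = "\<lambda>k. quotient_fun (f k) (f' k)"
  note D = distinct_svdD[OF svd]
  have q1: "?q \<in> {1..?q}" by (simp add: Suc_leI One_nat_def)
  obtain V V' e e' where
    near: "\<forall>\<^sub>F X in nhds X0. \<exists>u. distinct_svd X (\<lambda>k. sqrt (e k X)) u (\<lambda>k. V k X)" and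
    *: "\<forall>k\<in>{1..?q}. V k X0 = v k \<and> e k X0 = (d k)\<^sup>2 \<and>
      (V k has_derivative V' k) (at X0) \<and> (e k has_derivative e' k) (at X0) \<and>
      (\<forall>H. e' k H = gram_deriv X0 H (v k) \<bullet> v k \<and> V' k H \<bullet> v k = 0 \<and>
        (\<forall>l\<in>{1..?q} - {k}. V' k H \<bullet> v l = gram_deriv X0 H (v k) \<bullet> v l / ((d k)\<^sup>2 - (d l)\<^sup>2)))"
    using distinct_svd_perturbation[OF pq svd] by (elim exE conjE) (rule that)
  have V0: "V k X0 = v k" and e0: "e k X0 = (d k)\<^sup>2"
    and V': "(V k has_derivative V' k) (at X0)" and e': "(e k has_derivative e' k) (at X0)"
    and e'_eq: "e' k H = gram_deriv X0 H (v k) \<bullet> v k" and V'_k: "V' k H \<bullet> v k = 0"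
    if "k \<in> {1..?q}" for k H
    using * that by blast+
  have V'_l: "V' k H \<bullet> v l = gram_deriv X0 H (v k) \<bullet> v l / ((d k)\<^sup>2 - (d l)\<^sup>2)"
    if "k \<in> {1..?q}" "l \<in> {1..?q}" "l \<noteq> k" for k l H
    using * that by blast
  have pos_near: "\<forall>\<^sub>F X in nhds X0. 0 < sqrt (e ?q X) \<or> f ?q 0 = 0"
  proof (cases "f ?q 0 = 0")
    case False
    have "isCont (e ?q) X0" using has_derivative_continuous[OF e'[OF q1]] .
    then have "(e ?q \<longlongrightarrow> e ?q X0) (nhds X0)"
      unfolding isCont_def by (rule tendsto_at_iff_tendsto_nhds[THEN iffD1])
    moreover have "0 < e ?q X0" using ok False by (simp add: e0[OF q1])
    ultimately have "\<forall>\<^sub>F X in nhds X0. 0 < e ?q X" by (rule order_tendstoD(1))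
    then show ?thesis by eventually_elim simp
  qed simp
  show "\<forall>\<^sub>F X in nhds X0. X \<in> svd_domain f"
    using near pos_near unfolding svd_domain_def by eventually_elim blast
  define W where "W k X = outer_prod (X *v V k X) (V k X)" for k X
  define W' where "W' k H = outer_prod (X0 *v v k) (V' k H) + outer_prod (X0 *v V' k H + H *v v k) (v k)" for k H
  have FX: "\<forall>\<^sub>F X in nhds X0. (\<Sum>k=1..?q. ?g k (sqrt (e k X)) *\<^sub>R W k X) = F X"
    using near pos_near
  proof eventually_elim
    case (elim X)
    then obtain w where "distinct_svd X (\<lambda>k. sqrt (e k X)) w (\<lambda>k. V k X)" by blast
    from spectral_estimator_formula[OF F this elim(2), of f'] show ?case
      unfolding W_def by (rule sym)
  qed
  have W': "(W k has_derivative W' k) (at X0)" if k: "k \<in> {1..?q}" for k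
    unfolding W_def[abs_def] W'_def[abs_def]
    by (rule has_derivative_eq_rhs, (rule derivative_intros V'[OF k])+) (simp add: fun_eq_iff V0[OF k])
  \<comment> \<open>The derivative of \<open>?g k (sqrt e)\<close> at
    \<open>e = (d k)\<^sup>2\<close>: the quotient contributes \<open>(f' - g) / d\<close> and the
    root \<open>1 / (2 d)\<close>. For \<open>d k = 0\<close> it has the value
    \<open>0\<close>.\<close>
  define \<gamma> where "\<gamma> k = (f' k (d k) - ?g k (d k)) / (2 * (d k)\<^sup>2)" for k
  define T' where "T' k H = ?g k (d k) *\<^sub>R W' k H + (\<gamma> k * e' k H) *\<^sub>R outer_prod (X0 *v v k) (v k)" for k H
  have T': "((\<lambda>X. ?g k (sqrt (e k X)) *\<^sub>R W k X) has_derivative T' k) (at X0)" if k: "k \<in> {1..?q}" for k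
  proof (cases "d k = 0")
    case True
    have kq: "k = ?q" by (rule distinct_svd_zero[OF svd k True])
    with True ok have fq0: "f ?q 0 = 0" by auto
    have Xv: "X0 *v v k = 0" using distinct_svd_mult(1)[OF svd k] True by simp
    have W0: "W k X0 = 0"
      by (simp add: W_def V0[OF k] Xv bounded_bilinear.zero_left[OF bounded_bilinear_outer_prod])
    have "((\<lambda>X. sqrt (e k X)) \<longlongrightarrow> sqrt (e k X0)) (at X0)"
      using has_derivative_continuous[OF e'[OF k]] by (intro tendsto_intros) (simp add: isCont_def)
    then have "((\<lambda>X. sqrt (e k X)) \<longlongrightarrow> 0) (at X0)" using True by (simp add: e0[OF k])
    moreover have "\<forall>\<^sub>F X in at X0. sqrt (e k X) \<in> {0..}"
    proof -
      from near have "\<forall>\<^sub>F X in nhds X0. sqrt (e k X) \<in> {0..}"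
        by eventually_elim (use distinct_svdD(3) k in fastforce)
      then show ?thesis by (simp add: eventually_nhds_conv_at)
    qed
    \<comment> \<open>Since \<open>f q\<close> has a one-sided derivative at \<open>0\<close>, its
      quotient is controlled on \<open>{0..}\<close>, and the limit is taken inside this half line,
      in which the roots stay.\<close>
    ultimately have lim: "filterlim (\<lambda>X. sqrt (e k X)) (inf (nhds 0) (principal {0..})) (at X0)"
      by (simp add: filterlim_inf filterlim_principal)
    have "((\<lambda>x. ?g k x) \<longlongrightarrow> ?g k 0) (at 0 within {0..})"
      using tendsto_quotient_fun[OF sf fq0] kq by (simp add: quotient_fun_def)
    then have "((\<lambda>x. ?g k x) \<longlongrightarrow> ?g k 0) (inf (nhds 0) (principal {0..}))"
      by (simp add: tendsto_at_iff_tendsto_nhds_within)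
    from filterlim_compose[OF this lim] have "((\<lambda>X. ?g k (sqrt (e k X))) \<longlongrightarrow> ?g k 0) (at X0)" .
    then have "((\<lambda>X. ?g k (sqrt (e k X))) \<longlongrightarrow> ?g k (sqrt (e k X0))) (at X0)"
      using True by (simp add: e0[OF k])
    from has_derivative_scaleR_vanishing[OF W'[OF k] W0 this] show ?thesis
      unfolding T'_def by (rule has_derivative_eq_rhs)
        (simp add: fun_eq_iff True e0[OF k] Xv bounded_bilinear.zero_left[OF bounded_bilinear_outer_prod])
  next
    case False
    then have dk: "d k > 0" using D(3)[OF k] by simp
    have fd: "(f k has_real_derivative f' k (d k)) (at (d k))"
      by (rule spectral_functions_deriv[OF sf k dk])
    have D1: "((\<lambda>x. f k x / x) has_real_derivative (f' k (d k) - ?g k (d k)) / d k) (at (d k))"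
      by (rule DERIV_cong[OF DERIV_divide[OF fd DERIV_ident]])
        (use dk in \<open>simp_all add: quotient_fun_def field_simps\<close>)
    have ev: "\<forall>\<^sub>F x in nhds (d k). f k x / x = ?g k x"
    proof -
      have "\<forall>\<^sub>F x in nhds (d k). x \<in> {0<..}"
        using dk by (intro eventually_nhds_in_open) auto
      then show ?thesis by eventually_elim (simp add: quotient_fun_def)
    qed
    have "(?g k has_real_derivative (f' k (d k) - ?g k (d k)) / d k) (at (d k))"
      by (rule DERIV_cong_ev[OF refl ev refl, THEN iffD1, OF D1])
    moreover have sq: "sqrt (e k X0) = d k" using dk by (simp add: e0[OF k])
    ultimately have gd: "(?g k has_derivative (*) ((f' k (d k) - ?g k (d k)) / d k)) (at (sqrt (e k X0)))"
      by (simp add: has_field_derivative_def)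
    have "(sqrt has_derivative (*) (inverse (sqrt (e k X0)) / 2)) (at (e k X0))"
      using DERIV_real_sqrt[of "e k X0"] dk by (simp add: has_field_derivative_def e0[OF k])
    from has_derivative_compose[OF has_derivative_compose[OF e'[OF k] this] gd]
    have "((\<lambda>X. ?g k (sqrt (e k X))) has_derivative (\<lambda>H. \<gamma> k * e' k H)) (at X0)"
      by (rule has_derivative_eq_rhs)
        (use dk in \<open>simp add: fun_eq_iff \<gamma>_def sq power2_eq_square field_simps\<close>)
    from has_derivative_scaleR[OF this W'[OF k]] show ?thesis
      by (rule has_derivative_eq_rhs) (simp add: fun_eq_iff T'_def sq W_def V0[OF k])
  qed
  have "((\<lambda>X. \<Sum>k=1..?q. ?g k (sqrt (e k X)) *\<^sub>R W k X) has_derivative (\<lambda>H. \<Sum>k=1..?q. T' k H)) (at X0)"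
    by (rule has_derivative_sum[OF T'])
  then have F': "(F has_derivative (\<lambda>H. \<Sum>k=1..?q. T' k H)) (at X0)"
    by (rule has_derivative_transform_eventually)
      (use FX eventually_nhds_x_imp_x[OF FX] in \<open>auto simp: eventually_nhds_conv_at\<close>)
  moreover have "(\<Sum>k=1..?q. T' k (axis i (axis j 1))) $ i $ j = partial_deriv f f' d u v i j" for i j
  proof -
    let ?E = "axis i (axis j 1) :: real ^ 'q ^ 'p"
    define x where "x k = d k * u k $ i" for k
    define a where "a k = v k $ j" for k
    \<comment> \<open>The coefficient of \<open>v l\<close> in the derivative of \<open>v k\<close>
      in direction \<open>(i, j)\<close>, for \<open>l \<noteq> k\<close>.\<close>
    define c where "c k l = (x k * a l + a k * x l) / ((d k)\<^sup>2 - (d l)\<^sup>2)" for k l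
    have Ev: "?E *v y = axis i (y $ j)" for y
    proof -
      have "(?E *v y) $ m = axis i (y $ j) $ m" for m
        by (cases "m = i") (auto simp: matrix_vector_mult_row inner_axis' axis_def[of i])
      then show ?thesis by (simp add: vec_eq_iff)
    qed
    have Xv: "(X0 *v v k) $ i = x k" if "k \<in> {1..?q}" for k
      using distinct_svd_mult(1)[OF svd that] by (simp add: x_def)
    have gram': "gram_deriv X0 ?E (v k) \<bullet> v l = x k * a l + a k * x l" if "k \<in> {1..?q}" "l \<in> {1..?q}" for k l
      unfolding gram_deriv_inner Ev by (simp add: inner_axis inner_axis' Xv[OF that(1)] Xv[OF that(2)] a_def mult.commute)
    have expand: "V' k ?E = (\<Sum>l\<in>{1..?q} - {k}. c k l *\<^sub>R v l)" if k: "k \<in> {1..?q}" for k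
    proof -
      have "V' k ?E = (\<Sum>l=1..?q. (V' k ?E \<bullet> v l) *\<^sub>R v l)"
        using orthonormal_on_expansion[of v "V' k ?E"] D(2) by simp
      also have "\<dots> = (\<Sum>l\<in>{1..?q} - {k}. (V' k ?E \<bullet> v l) *\<^sub>R v l)"
        using k by (subst sum.remove[of _ k]) (auto simp: V'_k)
      also have "\<dots> = (\<Sum>l\<in>{1..?q} - {k}. c k l *\<^sub>R v l)"
        using k by (intro sum.cong refl) (auto simp: V'_l gram' c_def)
      finally show ?thesis .
    qed
    have V'j: "V' k ?E $ j = (\<Sum>l\<in>{1..?q} - {k}. c k l * a l)" if "k \<in> {1..?q}" for k
      by (simp add: expand[OF that] a_def)
    have XV'i: "(X0 *v V' k ?E) $ i = (\<Sum>l\<in>{1..?q} - {k}. c k l * x l)" if "k \<in> {1..?q}" for k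
      unfolding matrix_vector_mult_row expand[OF that] inner_sum_right inner_scaleR_right
      by (intro sum.cong refl) (simp add: matrix_vector_mult_row[symmetric] Xv)
    have "T' k ?E $ i $ j = (f' k (d k) - ?g k (d k)) * (u k $ i)\<^sup>2 * (v k $ j)\<^sup>2
      + ?g k (d k) * (v k $ j)\<^sup>2
      + (\<Sum>l\<in>{1..?q} - {k}. ?g k (d k) * (d k * u k $ i * v l $ j + v k $ j * (d l * u l $ i))\<^sup>2 / ((d k)\<^sup>2 - (d l)\<^sup>2))"
      if k: "k \<in> {1..?q}" for k
    proof -
      \<comment> \<open>Moving \<open>v k\<close> in both of its places multiplies
        \<open>c k l\<close> by its own numerator; hence the squares.\<close>
      have "W' k ?E $ i $ j = (a k)\<^sup>2 + (\<Sum>l\<in>{1..?q} - {k}. c k l * (x k * a l + a k * x l))"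
        by (simp add: W'_def outer_prod_nth Xv[OF k] V'j[OF k] XV'i[OF k] Ev a_def[symmetric]
            power2_eq_square sum_distrib_left sum_distrib_right sum.distrib algebra_simps)
      also have "(\<Sum>l\<in>{1..?q} - {k}. c k l * (x k * a l + a k * x l))
          = (\<Sum>l\<in>{1..?q} - {k}. (x k * a l + a k * x l)\<^sup>2 / ((d k)\<^sup>2 - (d l)\<^sup>2))"
        by (simp add: c_def power2_eq_square)
      finally have W'_ij: "?g k (d k) * W' k ?E $ i $ j = ?g k (d k) * (a k)\<^sup>2
          + (\<Sum>l\<in>{1..?q} - {k}. ?g k (d k) * (x k * a l + a k * x l)\<^sup>2 / ((d k)\<^sup>2 - (d l)\<^sup>2))"
        by (simp add: distrib_left sum_distrib_left)
      have "\<gamma> k * e' k ?E * (x k * a k) = (f' k (d k) - ?g k (d k)) * (u k $ i)\<^sup>2 * (a k)\<^sup>2"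
      proof (cases "d k = 0")
        case True
        then show ?thesis by (simp add: \<gamma>_def quotient_fun_def)
      next
        case False
        then show ?thesis
          by (simp add: \<gamma>_def e'_eq[OF k] gram'[OF k k] x_def power2_eq_square field_simps)
      qed
      then have "(\<gamma> k * e' k ?E) * (outer_prod (X0 *v v k) (v k) $ i $ j)
          = (f' k (d k) - ?g k (d k)) * (u k $ i)\<^sup>2 * (a k)\<^sup>2"
        by (simp add: outer_prod_nth Xv[OF k] a_def)
      then show ?thesis
        using W'_ij by (simp add: T'_def x_def a_def)
    qed
    then show ?thesis by (simp add: partial_deriv_def)
  qed
  ultimately show "\<exists>F'. (F has_derivative F') (at X0) \<and>
      (\<forall>i j. F' (axis i (axis j 1)) $ i $ j = partial_deriv f f' d u v i j)"
    by blast
qed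

section \<open>Sign and sum of the partial derivatives\<close>

lemma quotient_fun_mult: "quotient_fun f f' x * x = (if x = 0 then 0 else f x)"
  by (simp add: quotient_fun_def)

lemma partial_deriv_nonneg:
  fixes X :: "real ^ 'q ^ 'p"
  assumes sf: "spectral_functions CARD('q) f f'" and svd: "distinct_svd X d u v"
    and ok: "0 < d CARD('q) \<or> f CARD('q) 0 = 0"
  shows "0 \<le> partial_deriv f f' d u v i j"
proof -
  let ?q = "CARD('q)"
  note D = distinct_svdD[OF svd]
  have q1: "1 \<le> ?q" by (simp add: Suc_leI One_nat_def)
  have zero: "k = ?q \<and> f ?q 0 = 0 \<and> 0 \<le> f' ?q 0" if "k \<in> {1..?q}" "d k = 0" for k
    using distinct_svd_zero[OF svd that] ok that deriv_nonneg_0[OF sf _ q1] by auto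
  show ?thesis
    unfolding partial_deriv_def
  proof (rule partial_derivative_nonneg[where \<xi> = "\<lambda>k. u k $ i" and a = "\<lambda>k. v k $ j"])
    fix k assume k: "k \<in> {1..?q}"
    show dk: "0 \<le> d k" by (rule D(3)[OF k])
    show "0 \<le> f' k (d k)"
      using zero[OF k] dk spectral_functions_deriv_nonneg[OF sf k, of "d k"] by (cases "d k = 0") auto
    show "0 \<le> quotient_fun (f k) (f' k) (d k)"
      using zero[OF k] dk spectral_functions_nonneg[OF sf k, of "d k"]
      by (cases "d k = 0") (auto simp: quotient_fun_def)
  next
    fix k l assume kl: "k \<in> {1..?q}" "l \<in> {1..?q}" "k < l"
    show less: "d l < d k" by (rule D(4)[OF kl])
    \<comment> \<open>\<open>f l (d l) \<le> f k (d l) \<le> f k (d k)\<close>: the order of the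
      spectral functions followed by monotonicity. For \<open>d l = 0\<close> it is the
      nonnegativity of \<open>f k\<close>.\<close>
    have "(if d l = 0 then 0 else f l (d l)) \<le> f k (d k)"
    proof (cases "d l = 0")
      case True
      then show ?thesis using spectral_functions_nonneg[OF sf kl(1)] less by simp
    next
      case False
      then have "0 < d l" using D(3)[OF kl(2)] by simp
      then show ?thesis
        using spectral_functions_le[OF sf kl, of "d l"] spectral_functions_mono[OF sf kl(1), of "d l" "d k"] less
        by simp
    qed
    then show "quotient_fun (f l) (f' l) (d l) * d l \<le> quotient_fun (f k) (f' k) (d k) * d k"
      unfolding quotient_fun_mult using less D(3)[OF kl(2)] by simp
  next
    show "(\<Sum>k=1..?q. (u k $ i)\<^sup>2) \<le> 1"
      using orthonormal_on_Bessel[OF D(1), of "axis i 1"] by (simp add: inner_axis' inner_axis_axis)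
  qed
qed

text \<open>The squared Frobenius norm of \<open>\<alpha> x y^T + \<beta> z w^T\<close>. For
  singular vectors with distinct indices the middle term drops out by orthogonality.\<close>

lemma sum_square_outer:
  fixes x z :: "real ^ 'p" and y w :: "real ^ 'q"
  shows "(\<Sum>i\<in>UNIV. \<Sum>j\<in>UNIV. (\<alpha> * x $ i * y $ j + w $ j * (\<beta> * z $ i))\<^sup>2)
    = \<alpha>\<^sup>2 * (x \<bullet> x) * (y \<bullet> y) + 2 * \<alpha> * \<beta> * (x \<bullet> z) * (y \<bullet> w) + \<beta>\<^sup>2 * (z \<bullet> z) * (w \<bullet> w)"
proof -
  have "(\<Sum>i\<in>UNIV. \<Sum>j\<in>UNIV. (\<alpha> * x $ i * y $ j + w $ j * (\<beta> * z $ i))\<^sup>2)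
    = (\<Sum>i\<in>UNIV. \<Sum>j\<in>UNIV. \<alpha>\<^sup>2 * ((x $ i * x $ i) * (y $ j * y $ j))
       + 2 * \<alpha> * \<beta> * ((x $ i * z $ i) * (y $ j * w $ j)) + \<beta>\<^sup>2 * ((z $ i * z $ i) * (w $ j * w $ j)))"
    by (intro sum.cong refl) (simp add: power2_eq_square algebra_simps)
  also have "\<dots> = \<alpha>\<^sup>2 * ((x \<bullet> x) * (y \<bullet> y)) + 2 * \<alpha> * \<beta> * ((x \<bullet> z) * (y \<bullet> w)) + \<beta>\<^sup>2 * ((z \<bullet> z) * (w \<bullet> w))"
    unfolding inner_vec_def inner_real_def sum_product
    by (simp add: sum.distrib sum_distrib_left)
  finally show ?thesis by (simp add: mult.assoc)
qed

text \<open>Summed over all entries, a pair term becomes \<open>g k\<close> times \<open>((d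
  k)\<^sup>2 + (d l)\<^sup>2) / ((d k)\<^sup>2 - (d l)\<^sup>2)\<close>. This fraction equals
  \<open>2 (d k)\<^sup>2 / ((d k)\<^sup>2 - (d l)\<^sup>2) - 1\<close>, and the \<open>q - 1\<close>
  subtracted copies of \<open>g k\<close> turn the factor \<open>p - 1\<close> into
  \<open>p - q\<close>.\<close>

lemma sum_partial_deriv:
  fixes X :: "real ^ 'q ^ 'p"
  assumes svd: "distinct_svd X d u v"
  shows "(\<Sum>i\<in>UNIV. \<Sum>j\<in>UNIV. partial_deriv f f' d u v i j) =
    (real CARD('p) - real CARD('q)) * (\<Sum>k=1..CARD('q). quotient_fun (f k) (f' k) (d k))
    + (\<Sum>k=1..CARD('q). f' k (d k))
    + 2 * (\<Sum>k=1..CARD('q). \<Sum>l\<in>{1..CARD('q)} - {k}. d k * f k (d k) / ((d k)\<^sup>2 - (d l)\<^sup>2))"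
proof -
  let ?q = "CARD('q)" and ?p = "real CARD('p)"
  note D = distinct_svdD[OF svd]
  define g where "g k = quotient_fun (f k) (f' k) (d k)" for k
  define c where "c k l = g k / ((d k)\<^sup>2 - (d l)\<^sup>2)" for k l
  have on: "u k \<bullet> u l = (if k = l then 1 else 0)" "v k \<bullet> v l = (if k = l then 1 else 0)"
    if "k \<in> {1..?q}" "l \<in> {1..?q}" for k l
    using orthonormal_onD[OF D(1) that] orthonormal_onD[OF D(2) that] by auto
  have nrm: "(\<Sum>i\<in>UNIV. (x $ i)\<^sup>2) = x \<bullet> x" for x :: "real ^ 'n::finite"
    by (simp add: inner_vec_def power2_eq_square)
  have "(\<Sum>i\<in>UNIV. \<Sum>j\<in>UNIV. partial_deriv f f' d u v i j)
     = (\<Sum>k=1..?q. \<Sum>i\<in>UNIV. \<Sum>j\<in>UNIV. (f' k (d k) - g k) * (u k $ i)\<^sup>2 * (v k $ j)\<^sup>2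
        + g k * (v k $ j)\<^sup>2
        + (\<Sum>l\<in>{1..?q} - {k}. c k l * (d k * u k $ i * v l $ j + v k $ j * (d l * u l $ i))\<^sup>2))"
    (is "_ = (\<Sum>k=1..?q. ?S k)")
    unfolding partial_deriv_def sum.swap[of _ "{1..?q}"] by (simp add: g_def c_def)
  also have "\<dots> = (\<Sum>k=1..?q. f' k (d k) + (?p - real ?q) * g k
      + 2 * (\<Sum>l\<in>{1..?q} - {k}. d k * f k (d k) / ((d k)\<^sup>2 - (d l)\<^sup>2)))"
  proof (intro sum.cong refl)
    fix k assume k: "k \<in> {1..?q}"
    have 1: "(\<Sum>i\<in>UNIV. \<Sum>j\<in>UNIV. (f' k (d k) - g k) * (u k $ i)\<^sup>2 * (v k $ j)\<^sup>2) = f' k (d k) - g k"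
      unfolding sum_distrib_left[symmetric] nrm sum_distrib_right[symmetric] by (simp add: on[OF k k])
    have 2: "(\<Sum>i\<in>(UNIV :: 'p set). \<Sum>j\<in>UNIV. g k * (v k $ j)\<^sup>2) = ?p * g k"
      unfolding sum_distrib_left[symmetric] nrm by (simp add: on[OF k k])
    have 3: "(\<Sum>i\<in>UNIV. \<Sum>j\<in>UNIV. \<Sum>l\<in>{1..?q} - {k}. c k l * (d k * u k $ i * v l $ j + v k $ j * (d l * u l $ i))\<^sup>2)
        = (\<Sum>l\<in>{1..?q} - {k}. c k l * ((d k)\<^sup>2 + (d l)\<^sup>2))"
      unfolding sum.swap[of _ "{1..?q} - {k}"] sum_distrib_left[symmetric] sum_square_outer
      using k by (intro sum.cong refl) (simp add: on)
    have 4: "c k l * ((d k)\<^sup>2 + (d l)\<^sup>2) = 2 * (d k * f k (d k) / ((d k)\<^sup>2 - (d l)\<^sup>2)) - g k"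
      if l: "l \<in> {1..?q} - {k}" for l
    proof -
      have ne: "(d k)\<^sup>2 - (d l)\<^sup>2 \<noteq> 0"
        using distinct_svd_eigen_neq[OF svd k] l by auto
      \<comment> \<open>This covers \<open>d k = 0\<close>, where both sides vanish.\<close>
      have "d k * f k (d k) = g k * (d k)\<^sup>2"
        by (simp add: g_def quotient_fun_def power2_eq_square)
      then show ?thesis using ne by (simp add: c_def field_simps)
    qed
    have "real (card ({1..?q} - {k})) = real ?q - 1" using k by (simp add: of_nat_diff)
    then have 5: "(\<Sum>l\<in>{1..?q} - {k}. c k l * ((d k)\<^sup>2 + (d l)\<^sup>2))
        = 2 * (\<Sum>l\<in>{1..?q} - {k}. d k * f k (d k) / ((d k)\<^sup>2 - (d l)\<^sup>2)) - (real ?q - 1) * g k"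
      using 4 by (simp only: sum_distrib_left sum_subtractf sum_constant cong: sum.cong)
    show "?S k = f' k (d k) + (?p - real ?q) * g k
      + 2 * (\<Sum>l\<in>{1..?q} - {k}. d k * f k (d k) / ((d k)\<^sup>2 - (d l)\<^sup>2))"
      unfolding sum.distrib 1 2 3 5 by (simp add: algebra_simps)
  qed
  finally show ?thesis
    by (simp add: sum.distrib sum_distrib_left g_def)
qed

lemma entry_fun_DERIV:
  fixes F :: "real ^ 'q ^ 'p \<Rightarrow> real ^ 'q ^ 'p"
  assumes pq: "CARD('q) \<le> CARD('p)" and sf: "spectral_functions CARD('q) f f'"
    and F: "spectral_estimator f F" and svd: "distinct_svd X d u v"
    and ok: "0 < d CARD('q) \<or> f CARD('q) 0 = 0"
  shows "(entry_fun F X i j has_real_derivative partial_deriv f f' d u v i j) (at 0)"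
proof -
  obtain F' where F': "(F has_derivative F') (at X)"
    and eq: "F' (axis i (axis j 1)) $ i $ j = partial_deriv f f' d u v i j"
    using spectral_estimator_has_derivative(1)[OF pq sf F svd ok] by blast
  let ?E = "axis i (axis j 1) :: real ^ 'q ^ 'p"
  interpret F': bounded_linear F' using F' by (rule has_derivative_bounded_linear)
  have "((\<lambda>t. X + t *\<^sub>R ?E) has_derivative (\<lambda>t. t *\<^sub>R ?E)) (at 0)"
    by (auto intro!: derivative_eq_intros)
  moreover have "(F has_derivative F') (at (X + 0 *\<^sub>R ?E))" using F' by simp
  ultimately have "((\<lambda>t. F (X + t *\<^sub>R ?E)) has_derivative (\<lambda>t. F' (t *\<^sub>R ?E))) (at 0)"
    by (rule has_derivative_compose)
  then have "((\<lambda>t. F (X + t *\<^sub>R ?E) $ i $ j) has_derivative (\<lambda>t. F' (t *\<^sub>R ?E) $ i $ j)) (at 0)"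
    by (intro bounded_linear.has_derivative[OF bounded_linear_vec_nth])
  then show ?thesis
    unfolding has_field_derivative_def entry_fun_def[abs_def]
    by (rule has_derivative_eq_rhs) (simp add: fun_eq_iff F'.scaleR eq mult.commute)
qed

lemma divergence_spectral_estimator:
  fixes F :: "real ^ 'q ^ 'p \<Rightarrow> real ^ 'q ^ 'p"
  assumes pq: "CARD('q) \<le> CARD('p)" and sf: "spectral_functions CARD('q) f f'"
    and F: "spectral_estimator f F" and svd: "distinct_svd X d u v"
    and ok: "0 < d CARD('q) \<or> f CARD('q) 0 = 0"
  shows "has_divergence_terms F X"
    and "divergence F X = (\<Sum>i\<in>UNIV. \<Sum>j\<in>UNIV. partial_deriv f f' d u v i j)"
  using DERIV_imp_deriv[OF entry_fun_DERIV[OF assms]]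
    real_differentiable_def[THEN iffD2, OF exI, OF entry_fun_DERIV[OF assms]]
  by (simp_all add: has_divergence_terms_def divergence_def)

section \<open>Stein's identity for products of normal distributions\<close>

definition normal_measure :: "real \<Rightarrow> real \<Rightarrow> real measure"
  where "normal_measure m \<sigma> = density lborel (\<lambda>x. ennreal (normal_density m \<sigma> x))"

lemma sets_normal_measure [simp, measurable_cong]: "sets (normal_measure m \<sigma>) = sets borel"
  by (simp add: normal_measure_def)

lemma space_normal_measure [simp]: "space (normal_measure m \<sigma>) = UNIV"
  by (simp add: normal_measure_def)

lemma prob_space_normal_measure: "\<sigma> > 0 \<Longrightarrow> prob_space (normal_measure m \<sigma>)"
  unfolding normal_measure_def by (rule prob_space_normal_density)

lemma emeasure_normal_measure_singleton: "emeasure (normal_measure m \<sigma>) {c} = 0"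
  unfolding normal_measure_def
  by (subst emeasure_density) (auto simp: nn_integral_0_iff_AE intro!: AE_I[of _ _ "{c}"])

lemma normal_measure_moment:
  assumes "\<sigma> > 0"
  shows "has_bochner_integral (normal_measure m \<sigma>) (\<lambda>x. x - m) 0"
    and "has_bochner_integral (normal_measure m \<sigma>) (\<lambda>x. (x - m)\<^sup>2) (\<sigma>\<^sup>2)"
proof -
  show "has_bochner_integral (normal_measure m \<sigma>) (\<lambda>x. x - m) 0"
    unfolding normal_measure_def
    by (rule has_bochner_integral_density) (use normal_moment_odd[OF assms, of m 0] in auto)
  show "has_bochner_integral (normal_measure m \<sigma>) (\<lambda>x. (x - m)\<^sup>2) (\<sigma>\<^sup>2)"
    unfolding normal_measure_def
    by (rule has_bochner_integral_density)
      (use normal_moment_even[OF assms, of m 1] in \<open>auto simp: fact_numeral\<close>)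
qed

lemma integrable_mult_square:
  fixes f g :: "'a \<Rightarrow> real"
  assumes [measurable]: "f \<in> borel_measurable M" "g \<in> borel_measurable M"
    and "integrable M (\<lambda>x. (f x)\<^sup>2)" "integrable M (\<lambda>x. (g x)\<^sup>2)"
  shows "integrable M (\<lambda>x. f x * g x)"
proof (rule Bochner_Integration.integrable_bound)
  show "integrable M (\<lambda>x. (f x)\<^sup>2 + (g x)\<^sup>2)" using assms by simp
  show "AE x in M. norm (f x * g x) \<le> norm ((f x)\<^sup>2 + (g x)\<^sup>2)"
  proof (rule AE_I2)
    fix x
    have "0 \<le> (\<bar>f x\<bar> - \<bar>g x\<bar>)\<^sup>2" by simp
    then have "2 * \<bar>f x * g x\<bar> \<le> (f x)\<^sup>2 + (g x)\<^sup>2"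
      by (simp add: power2_diff abs_mult)
    then show "norm (f x * g x) \<le> norm ((f x)\<^sup>2 + (g x)\<^sup>2)" by simp
  qed
qed measurable

text \<open>As \<open>t - m\<close> has mean zero, subtracting \<open>G m\<close> from
  \<open>G\<close> leaves the integral unchanged. It makes the integrand nonnegative, because
  \<open>G\<close> is nondecreasing, so the nonnegative integral of \<open>stein_nn_integral\<close>
  has a finite value.\<close>

lemma stein_normal:
  assumes \<sigma>: "\<sigma> > 0" and G: "\<And>t. (G has_real_derivative D t) (at t)" and D: "\<And>t. 0 \<le> D t"
    and int: "integrable (normal_measure m \<sigma>) (\<lambda>t. G t * (t - m))"
  shows "(\<integral>\<^sup>+t. ennreal (\<sigma>\<^sup>2 * D t) \<partial>normal_measure m \<sigma>)
           = ennreal (\<integral>t. G t * (t - m) \<partial>normal_measure m \<sigma>)"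
    and "0 \<le> (\<integral>t. G t * (t - m) \<partial>normal_measure m \<sigma>)"
proof -
  let ?N = "normal_measure m \<sigma>"
  have [measurable]: "D \<in> borel_measurable borel" by (rule borel_measurable_DERIV[OF G])
  have [measurable]: "G \<in> borel_measurable borel"
    using G by (intro borel_measurable_continuous_onI) (meson DERIV_isCont continuous_at_imp_continuous_on)
  have mono: "G s \<le> G t" if "s \<le> t" for s t
    using DERIV_nonneg_imp_nondecreasing[OF that] G D by blast
  have nonneg: "0 \<le> (G t - G m) * (t - m)" for t
    using mono[of m t] mono[of t m] by (cases "m \<le> t") (auto intro: mult_nonneg_nonneg mult_nonpos_nonpos)
  note mom = normal_measure_moment(1)[OF \<sigma>, of m]
  have eq: "(G t - G m) * (t - m) = G t * (t - m) - G m * (t - m)" for t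
    by (simp add: left_diff_distrib)
  have int': "integrable ?N (\<lambda>t. (G t - G m) * (t - m))"
    unfolding eq using int mom by (intro Bochner_Integration.integrable_diff) (auto simp: has_bochner_integral_iff)
  have val: "(\<integral>t. (G t - G m) * (t - m) \<partial>?N) = (\<integral>t. G t * (t - m) \<partial>?N)"
    unfolding eq using int mom by (subst Bochner_Integration.integral_diff) (auto simp: has_bochner_integral_iff)
  show "0 \<le> (\<integral>t. G t * (t - m) \<partial>?N)"
    unfolding val[symmetric] by (intro Bochner_Integration.integral_nonneg nonneg)
  have "(\<integral>\<^sup>+t. ennreal (\<sigma>\<^sup>2 * D t) \<partial>?N) = (\<integral>\<^sup>+t. ennreal (\<sigma>\<^sup>2 * D t * normal_density m \<sigma> t) \<partial>lborel)"
    unfolding normal_measure_def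
    by (subst nn_integral_density) (auto simp: ennreal_mult'[symmetric] mult.commute intro!: nn_integral_cong)
  also have "\<dots> = (\<integral>\<^sup>+t. ennreal ((G t - G m) * (t - m) * normal_density m \<sigma> t) \<partial>lborel)"
    by (rule stein_nn_integral[OF \<sigma> G D])
  also have "\<dots> = (\<integral>\<^sup>+t. ennreal ((G t - G m) * (t - m)) \<partial>?N)"
    unfolding normal_measure_def
    by (subst nn_integral_density) (auto simp: ennreal_mult'[symmetric] mult.commute intro!: nn_integral_cong)
  also have "\<dots> = ennreal (\<integral>t. (G t - G m) * (t - m) \<partial>?N)"
    by (rule nn_integral_eq_integral[OF int']) (simp add: nonneg)
  finally show "(\<integral>\<^sup>+t. ennreal (\<sigma>\<^sup>2 * D t) \<partial>?N) = ennreal (\<integral>t. G t * (t - m) \<partial>?N)"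
    by (simp add: val)
qed

text \<open>The one-dimensional identity is applied on almost every line and the remaining
  coordinates are integrated by Tonelli. Since \<open>D\<close> is nonnegative almost everywhere,
  its integrability comes out of the finite right-hand side.\<close>

lemma stein_product:
  fixes H D :: "('n::finite \<Rightarrow> real) \<Rightarrow> real" and m :: "'n \<Rightarrow> real" and s :: 'n
  assumes \<sigma>: "\<sigma> > 0"
    and H: "H \<in> borel_measurable (Pi\<^sub>M UNIV (\<lambda>i. normal_measure (m i) \<sigma>))"
    and D: "D \<in> borel_measurable (Pi\<^sub>M UNIV (\<lambda>i. normal_measure (m i) \<sigma>))"
    and line: "AE x in Pi\<^sub>M UNIV (\<lambda>i. normal_measure (m i) \<sigma>). \<forall>t.
      ((\<lambda>t. H (x(s := t))) has_real_derivative D (x(s := t))) (at t) \<and> 0 \<le> D (x(s := t))"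
    and int: "integrable (Pi\<^sub>M UNIV (\<lambda>i. normal_measure (m i) \<sigma>)) (\<lambda>x. H x * (x s - m s))"
  shows "integrable (Pi\<^sub>M UNIV (\<lambda>i. normal_measure (m i) \<sigma>)) D"
    and "\<sigma>\<^sup>2 * (\<integral>x. D x \<partial>Pi\<^sub>M UNIV (\<lambda>i. normal_measure (m i) \<sigma>))
      = (\<integral>x. H x * (x s - m s) \<partial>Pi\<^sub>M UNIV (\<lambda>i. normal_measure (m i) \<sigma>))"
proof -
  define N where "N = (\<lambda>i. normal_measure (m i) \<sigma>)"
  define J where "J = UNIV - {s}"
  let ?Q = "Pi\<^sub>M UNIV N" and ?R = "Pi\<^sub>M J N"
  have U: "insert s J = UNIV" and sJ: "s \<notin> J" and finJ: "finite J" by (auto simp: J_def)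
  have prob: "prob_space (N i)" for i
    unfolding N_def by (rule prob_space_normal_measure[OF \<sigma>])
  interpret N: product_prob_space N UNIV
    unfolding product_prob_space_def product_sigma_finite_def product_prob_space_axioms_def
    using prob by (auto intro: prob_space_imp_sigma_finite)
  interpret Ns: prob_space "N s" by (rule prob)
  interpret R: prob_space ?R by (intro prob_space_PiM prob)
  interpret pair: pair_prob_space "N s" ?R by standard
  note [measurable] = H[folded N_def] D[folded N_def]
  have [measurable]: "(\<lambda>x. H x * (x s - m s)) \<in> borel_measurable ?Q"
    using borel_measurable_integrable[OF int] by (simp add: N_def)
  have upd: "(\<lambda>(x, t). x(s := t)) \<in> measurable (?R \<Otimes>\<^sub>M N s) ?Q"
    using measurable_add_dim[of s J N] by (simp add: U)
  have Hupd[measurable]: "(\<lambda>(x, t). H (x(s := t))) \<in> borel_measurable (?R \<Otimes>\<^sub>M N s)"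
    using measurable_compose[OF upd H[folded N_def]] by (simp add: case_prod_beta')
  let ?\<Pi> = "\<lambda>x. \<forall>t. ((\<lambda>t. H (x(s := t))) has_real_derivative D (x(s := t))) (at t) \<and> 0 \<le> D (x(s := t))"
  \<comment> \<open>The statement about the line through \<open>x\<close> does not depend on
    \<open>x s\<close>. Splitting off this coordinate gives it for almost all \<open>t\<close> and
    then almost all \<open>x\<close>, and \<open>t\<close> no longer occurs.\<close>
  have lineR: "AE x in ?R. ?\<Pi> x"
  proof -
    have law: "distr (N s \<Otimes>\<^sub>M ?R) ?Q (\<lambda>(t, x). x(s := t)) = ?Q"
      using distr_pair_PiM_eq_PiM[of J N s] prob by (simp add: U)
    have "AE x in distr (N s \<Otimes>\<^sub>M ?R) ?Q (\<lambda>(t, x). x(s := t)). ?\<Pi> x"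
      unfolding law using line unfolding N_def .
    moreover have "(\<lambda>(t, x). x(s := t)) \<in> measurable (N s \<Otimes>\<^sub>M ?R) ?Q"
      using measurable_compose[OF measurable_pair_swap' upd] by (simp add: case_prod_beta')
    ultimately have "AE z in N s \<Otimes>\<^sub>M ?R. ?\<Pi> (case z of (t, x) \<Rightarrow> x(s := t))"
      by (rule AE_distrD[rotated])
    from pair.AE_pair[OF this] have "AE t in N s. AE x in ?R. ?\<Pi> x"
      by simp
    then show ?thesis by simp
  qed
  let ?h = "\<lambda>x t. H (x(s := t)) * (t - m s)"
  have int_abs: "(\<integral>\<^sup>+x. (\<integral>\<^sup>+t. ennreal (norm (?h x t)) \<partial>N s) \<partial>?R) < \<infinity>"
  proof -
    have "(\<integral>\<^sup>+x. ennreal (norm (H x * (x s - m s))) \<partial>?Q) < \<infinity>"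
      using int by (simp add: integrable_iff_bounded N_def)
    then show ?thesis
      using N.product_nn_integral_insert[OF finJ sJ, of "\<lambda>x. ennreal (norm (H x * (x s - m s)))"]
      unfolding U by simp
  qed
  have hm[measurable]: "(\<lambda>(x, t). ?h x t) \<in> borel_measurable (?R \<Otimes>\<^sub>M N s)"
    unfolding case_prod_beta' using Hupd by (simp add: case_prod_beta' N_def)
  have "AE x in ?R. (\<integral>\<^sup>+t. ennreal (norm (?h x t)) \<partial>N s) \<noteq> \<infinity>"
    using int_abs by (intro nn_integral_PInf_AE) auto
  then have inner_int: "AE x in ?R. integrable (N s) (?h x)"
  proof (rule AE_mp, intro AE_I2 impI)
    fix x assume x: "x \<in> space ?R" and fin: "(\<integral>\<^sup>+t. ennreal (norm (?h x t)) \<partial>N s) \<noteq> \<infinity>"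
    have "?h x \<in> borel_measurable (N s)"
      using measurable_compose[OF measurable_Pair1'[OF x] hm] by simp
    then show "integrable (N s) (?h x)"
      using fin by (simp add: integrable_iff_bounded less_top)
  qed
  define I where "I x = (\<integral>t. ?h x t \<partial>N s)" for x
  have I_meas[measurable]: "I \<in> borel_measurable ?R"
    unfolding I_def by (rule sigma_finite_measure.borel_measurable_lebesgue_integral[OF prob_space_imp_sigma_finite[OF prob]]) (rule hm)
  have stein: "AE x in ?R. (\<integral>\<^sup>+t. ennreal (\<sigma>\<^sup>2 * D (x(s := t))) \<partial>N s) = ennreal (I x) \<and> 0 \<le> I x"
    using lineR inner_int
  proof eventually_elim
    case (elim x)
    show ?case
      using stein_normal[OF \<sigma>, of "\<lambda>t. H (x(s := t))" "\<lambda>t. D (x(s := t))" "m s"] elim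
      by (simp add: N_def I_def)
  qed
  have "(\<integral>\<^sup>+x. ennreal (\<sigma>\<^sup>2 * D x) \<partial>?Q) = (\<integral>\<^sup>+x. (\<integral>\<^sup>+t. ennreal (\<sigma>\<^sup>2 * D (x(s := t))) \<partial>N s) \<partial>?R)"
    using N.product_nn_integral_insert[OF finJ sJ, of "\<lambda>x. ennreal (\<sigma>\<^sup>2 * D x)"] by (simp add: U)
  also have "\<dots> = (\<integral>\<^sup>+x. ennreal (I x) \<partial>?R)"
    by (rule nn_integral_cong_AE) (use stein in \<open>auto elim: eventually_mono\<close>)
  also have "\<dots> = ennreal (\<integral>x. I x \<partial>?R)"
  proof (rule nn_integral_eq_integral)
    have "(\<integral>\<^sup>+x. ennreal (norm (I x)) \<partial>?R) \<le> (\<integral>\<^sup>+x. (\<integral>\<^sup>+t. ennreal (norm (?h x t)) \<partial>N s) \<partial>?R)"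
    proof (rule nn_integral_mono_AE)
      show "AE x in ?R. ennreal (norm (I x)) \<le> (\<integral>\<^sup>+t. ennreal (norm (?h x t)) \<partial>N s)"
        using inner_int unfolding I_def by eventually_elim (rule integral_norm_bound_ennreal)
    qed
    then show "integrable ?R I"
      using int_abs by (auto simp: integrable_iff_bounded intro: le_less_trans)
    show "AE x in ?R. 0 \<le> I x" using stein by (auto elim: eventually_mono)
  qed
  also have "(\<integral>x. I x \<partial>?R) = (\<integral>x. H x * (x s - m s) \<partial>?Q)"
    unfolding I_def using N.product_integral_insert[OF finJ sJ, of "\<lambda>x. H x * (x s - m s)"] int
    by (simp add: U N_def)
  finally have main: "(\<integral>\<^sup>+x. ennreal (\<sigma>\<^sup>2 * D x) \<partial>?Q) = ennreal (\<integral>x. H x * (x s - m s) \<partial>?Q)" .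
  \<comment> \<open>Each point lies on its own line, at \<open>t = x s\<close>.\<close>
  have D0: "AE x in ?Q. 0 \<le> D x"
    using line unfolding N_def[symmetric] by eventually_elim (metis fun_upd_triv)
  have intD: "integrable ?Q (\<lambda>x. \<sigma>\<^sup>2 * D x)"
    using main D0 \<sigma> by (intro integrableI_nonneg) (auto elim: eventually_mono)
  then have "integrable ?Q D" using \<sigma> by simp
  then show "integrable (Pi\<^sub>M UNIV (\<lambda>i. normal_measure (m i) \<sigma>)) D" by (simp add: N_def)
  \<comment> \<open>\<open>ennreal\<close> sends negative numbers to \<open>0\<close>, so the sign
    is required for reading off an equality of real integrals.\<close>
  have I0: "0 \<le> (\<integral>x. H x * (x s - m s) \<partial>?Q)"
  proof -
    have "(\<integral>x. H x * (x s - m s) \<partial>?Q) = (\<integral>x. I x \<partial>?R)"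
      unfolding I_def using N.product_integral_insert[OF finJ sJ, of "\<lambda>x. H x * (x s - m s)"] int
      by (simp add: U N_def)
    also have "\<dots> \<ge> 0" using stein by (intro integral_nonneg_AE) (auto elim: eventually_mono)
    finally show ?thesis .
  qed
  have "(\<integral>\<^sup>+x. ennreal (\<sigma>\<^sup>2 * D x) \<partial>?Q) = ennreal (\<integral>x. \<sigma>\<^sup>2 * D x \<partial>?Q)"
    by (rule nn_integral_eq_integral[OF intD]) (use D0 in \<open>auto elim: eventually_mono\<close>)
  then have "(\<integral>x. \<sigma>\<^sup>2 * D x \<partial>?Q) = (\<integral>x. H x * (x s - m s) \<partial>?Q)"
    unfolding main using I0 integral_nonneg_AE[OF D0] by (subst (asm) ennreal_inj) auto
  then show "\<sigma>\<^sup>2 * (\<integral>x. D x \<partial>Pi\<^sub>M UNIV (\<lambda>i. normal_measure (m i) \<sigma>))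
      = (\<integral>x. H x * (x s - m s) \<partial>Pi\<^sub>M UNIV (\<lambda>i. normal_measure (m i) \<sigma>))"
    by (simp add: N_def)
qed

text \<open>The preimages under \<open>f\<close> and \<open>g\<close> differ by a null set, which
  the completion absorbs. This gives measurability to expressions in the estimator itself, whose
  values outside \<open>svd_domain\<close> are arbitrary.\<close>

lemma measurable_completion_AE:
  fixes g :: "'a \<Rightarrow> 'b::topological_space"
  assumes f: "f \<in> borel_measurable M" and ae: "AE x in M. f x = g x"
  shows "g \<in> borel_measurable (completion M)"
proof (rule measurableI)
  fix A :: "'b set" assume A: "A \<in> sets borel"
  show "g -` A \<inter> space (completion M) \<in> sets (completion M)"
  proof (rule completion.in_sets_AE)
    show "f -` A \<inter> space M \<in> sets (completion M)"
      using measurable_sets[OF f A] by auto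
    show "AE x in completion M. (x \<in> f -` A \<inter> space M) = (x \<in> g -` A \<inter> space (completion M))"
      unfolding AE_completion_iff using ae by eventually_elim auto
  qed auto
qed auto

section \<open>Unbiasedness\<close>

lemma axis_axis_nth: "(axis i (axis j c) :: 'a::zero ^ 'q ^ 'p) $ a $ b = (if a = i \<and> b = j then c else 0)"
  by (simp add: axis_def)

lemma matrix_of_nth [simp]: "matrix_of x $ i $ j = x (i, j)"
  by (simp add: matrix_of_def)

lemma matrix_of_upd:
  "matrix_of (x((i, j) := t)) = matrix_of (x((i, j) := t')) + (t - t') *\<^sub>R axis i (axis j 1)"
  by (simp add: vec_eq_iff axis_axis_nth)

lemma measurable_matrix_of:
  "matrix_of \<in> borel_measurable (Pi\<^sub>M (UNIV :: ('p::finite \<times> 'q::finite) set) (\<lambda>_. borel))"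
proof -
  have eq: "matrix_of = (\<lambda>x :: 'p \<times> 'q \<Rightarrow> real. \<Sum>s\<in>UNIV. x s *\<^sub>R axis (fst s) (axis (snd s) 1))"
  proof (rule ext)
    fix x :: "'p \<times> 'q \<Rightarrow> real"
    have "x (a, b) = (\<Sum>s\<in>UNIV. x s * (if a = fst s \<and> b = snd s then 1 else 0))" for a b
    proof -
      have "(\<Sum>s\<in>UNIV. x s * (if a = fst s \<and> b = snd s then 1 else 0)) = (\<Sum>s\<in>UNIV. if s = (a, b) then x s else 0)"
        by (intro sum.cong) auto
      then show ?thesis by simp
    qed
    then show "matrix_of x = (\<Sum>s\<in>UNIV. x s *\<^sub>R axis (fst s) (axis (snd s) 1))"
      by (simp add: vec_eq_iff axis_axis_nth)
  qed
  show ?thesis unfolding eq by measurable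
qed

lemma inner_matrix: "(A :: real ^ 'q ^ 'p) \<bullet> B = (\<Sum>i\<in>UNIV. \<Sum>j\<in>UNIV. A $ i $ j * B $ i $ j)"
  by (simp add: inner_vec_def)

section \<open>Borel versions of the estimator and of its partial derivatives\<close>

context
  fixes f f' :: "nat \<Rightarrow> real \<Rightarrow> real" and F :: "real ^ 'q ^ 'p \<Rightarrow> real ^ 'q ^ 'p"
  assumes pq: "CARD('q) \<le> CARD('p)" and sf: "spectral_functions CARD('q) f f'"
    and F: "spectral_estimator f F"
begin

lemma open_svd_domain: "open (svd_domain f :: (real ^ 'q ^ 'p) set)"
proof (subst open_subopen, intro ballI)
  fix X0 :: "real ^ 'q ^ 'p" assume "X0 \<in> svd_domain f"
  then obtain d u v where "distinct_svd X0 d u v" "0 < d CARD('q) \<or> f CARD('q) 0 = 0"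
    unfolding svd_domain_def by blast
  from spectral_estimator_has_derivative(2)[OF pq sf F this]
  show "\<exists>T. open T \<and> X0 \<in> T \<and> T \<subseteq> svd_domain f"
    unfolding eventually_nhds by blast
qed

lemma continuous_on_svd_domain: "continuous_on (svd_domain f) F"
proof (intro continuous_at_imp_continuous_on ballI)
  fix X0 :: "real ^ 'q ^ 'p" assume "X0 \<in> svd_domain f"
  then obtain d u v where "distinct_svd X0 d u v" "0 < d CARD('q) \<or> f CARD('q) 0 = 0"
    unfolding svd_domain_def by blast
  from spectral_estimator_has_derivative(1)[OF pq sf F this]
  show "isCont F X0" using has_derivative_continuous by blast
qed

lemma svd_domain_entry_DERIV:
  assumes "X \<in> svd_domain f"
  shows "(entry_fun F X i j has_real_derivative deriv (entry_fun F X i j) 0) (at 0)"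
    and "0 \<le> deriv (entry_fun F X i j) 0"
proof -
  obtain d u v where svd: "distinct_svd X d u v" "0 < d CARD('q) \<or> f CARD('q) 0 = 0"
    using assms unfolding svd_domain_def by blast
  note D = entry_fun_DERIV[OF pq sf F svd, of i j]
  show "(entry_fun F X i j has_real_derivative deriv (entry_fun F X i j) 0) (at 0)"
    using D DERIV_imp_deriv[OF D] by simp
  show "0 \<le> deriv (entry_fun F X i j) 0"
    using DERIV_imp_deriv[OF D] partial_deriv_nonneg[OF sf svd] by simp
qed

lemma line_DERIV:
  assumes dom: "\<And>t. matrix_of (x((i, j) := t)) \<in> svd_domain f"
  shows "((\<lambda>t. F (matrix_of (x((i, j) := t))) $ i $ j) has_real_derivative
    deriv (entry_fun F (matrix_of (x((i, j) := t))) i j) 0) (at t)"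
proof -
  let ?X = "matrix_of (x((i, j) := t))"
  have "F (matrix_of (x((i, j) := s))) $ i $ j = entry_fun F ?X i j (s + - t)" for s
    unfolding entry_fun_def by (subst matrix_of_upd[of x i j s t]) simp
  then show ?thesis
    using svd_domain_entry_DERIV(1)[OF dom[of t], of i j] DERIV_shift[of "entry_fun F ?X i j" _ t "- t"] by simp
qed

text \<open>Outside \<open>svd_domain\<close> the function \<open>F\<close> is arbitrary and may
  fail to be Borel. Cutting it off by \<open>0\<close> repairs this, as the domain is open and
  \<open>F\<close> is continuous on it.\<close>

definition restricted_estimator :: "real ^ 'q ^ 'p \<Rightarrow> real ^ 'q ^ 'p"
  where "restricted_estimator X = (if X \<in> svd_domain f then F X else 0)"

lemma restricted_estimator_measurable [measurable]: "restricted_estimator \<in> borel_measurable borel"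
proof -
  have "(\<lambda>X. indicator (svd_domain f) X *\<^sub>R F X) \<in> borel_measurable borel"
    by (rule borel_measurable_continuous_on_indicator)
      (use open_svd_domain continuous_on_svd_domain in auto)
  moreover have "restricted_estimator = (\<lambda>X. indicator (svd_domain f) X *\<^sub>R F X)"
    by (auto simp: restricted_estimator_def fun_eq_iff)
  ultimately show ?thesis by simp
qed

text \<open>A Borel substitute for the partial derivative: a limit along one fixed sequence of
  increments, with the default value of \<open>lim\<close> where the sequence diverges.\<close>

definition partial_limit :: "'p \<Rightarrow> 'q \<Rightarrow> real ^ 'q ^ 'p \<Rightarrow> real"
  where "partial_limit i j X = lim (\<lambda>n. (restricted_estimator (X + inverse (real (Suc n)) *\<^sub>R axis i (axis j 1)) $ i $ j
    - restricted_estimator X $ i $ j) / inverse (real (Suc n)))"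

lemma partial_limit_measurable [measurable]: "partial_limit i j \<in> borel_measurable borel"
proof -
  have [measurable]: "(\<lambda>X. restricted_estimator (X + c *\<^sub>R axis i (axis j 1)) $ i $ j) \<in> borel_measurable borel" for c
  proof -
    have "(\<lambda>X. restricted_estimator (X + c *\<^sub>R axis i (axis j 1))) \<in> borel_measurable borel"
      by measurable
    moreover have "(\<lambda>X :: real ^ 'q ^ 'p. X $ i $ j) \<in> borel_measurable borel"
      by (intro borel_measurable_continuous_onI continuous_intros)
    ultimately show ?thesis by (rule measurable_compose)
  qed
  from this[of 0] have [measurable]: "(\<lambda>X. restricted_estimator X $ i $ j) \<in> borel_measurable borel"
    by simp
  show ?thesis unfolding partial_limit_def[abs_def] by measurable
qed

lemma partial_limit_eq:
  assumes X: "X \<in> svd_domain f"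
  shows "partial_limit i j X = deriv (entry_fun F X i j) 0"
proof -
  let ?E = "axis i (axis j 1) :: real ^ 'q ^ 'p"
  have L: "(\<lambda>n. inverse (real (Suc n))) \<longlonglongrightarrow> 0"
    by (rule LIMSEQ_inverse_real_of_nat)
  have "((\<lambda>h. (entry_fun F X i j h - entry_fun F X i j 0) / h) \<longlongrightarrow> deriv (entry_fun F X i j) 0) (at 0)"
    using svd_domain_entry_DERIV(1)[OF X] by (simp add: DERIV_def)
  moreover have "filterlim (\<lambda>n. inverse (real (Suc n))) (at 0) sequentially"
    using L by (auto simp: filterlim_at)
  ultimately have lim: "(\<lambda>n. (entry_fun F X i j (inverse (real (Suc n))) - entry_fun F X i j 0) / inverse (real (Suc n)))
      \<longlonglongrightarrow> deriv (entry_fun F X i j) 0"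
    by (rule filterlim_compose)
  \<comment> \<open>The domain is open, so from some \<open>n\<close> on the cut-off does not affect
    the difference quotient.\<close>
  have "(\<lambda>n. X + inverse (real (Suc n)) *\<^sub>R ?E) \<longlonglongrightarrow> X + 0 *\<^sub>R ?E"
    by (intro tendsto_intros L)
  then have "\<forall>\<^sub>F n in sequentially. X + inverse (real (Suc n)) *\<^sub>R ?E \<in> svd_domain f"
    using topological_tendstoD[OF _ open_svd_domain] X by simp
  then have "\<forall>\<^sub>F n in sequentially. (entry_fun F X i j (inverse (real (Suc n))) - entry_fun F X i j 0) / inverse (real (Suc n))
    = (restricted_estimator (X + inverse (real (Suc n)) *\<^sub>R ?E) $ i $ j - restricted_estimator X $ i $ j) / inverse (real (Suc n))"
    by eventually_elim (simp add: restricted_estimator_def entry_fun_def X)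
  from Lim_transform_eventually[OF lim this] show ?thesis
    unfolding partial_limit_def by (rule limI)
qed

text \<open>Simple eigenvalues give a decomposition at every point of the line. If
  \<open>f q 0 \<noteq> 0\<close>, then \<open>q < p\<close> and the line also avoids
  \<open>d q = 0\<close>; if \<open>f q 0 = 0\<close>, a vanishing \<open>d q\<close> is allowed in
  the domain.\<close>

lemma AE_line_svd_domain:
  fixes N :: "'p \<times> 'q \<Rightarrow> real measure"
  assumes bdry: "CARD('q) < CARD('p) \<or> f CARD('q) 0 = 0"
    and prob: "\<And>s. prob_space (N s)" and sets: "\<And>s. sets (N s) = sets borel"
    and atomless: "\<And>s c. emeasure (N s) {c} = 0"
  shows "AE x in Pi\<^sub>M UNIV N. \<forall>t. matrix_of (x((i, j) := t)) \<in> svd_domain f"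
  using AE_line_generic[OF pq prob sets atomless, of i j]
proof eventually_elim
  case (elim x)
  show ?case
  proof
    fix t
    let ?X = "matrix_of (x((i, j) := t))"
    obtain d u v where svd: "distinct_svd ?X d u v"
      using simple_gram_imp_distinct_svd[OF pq] elim by blast
    have "0 < d CARD('q) \<or> f CARD('q) 0 = 0"
    proof (rule disjCI)
      assume "f CARD('q) 0 \<noteq> 0"
      then have ker: "\<And>y. gram ?X y = 0 \<Longrightarrow> y = 0" using bdry elim by blast
      have q: "CARD('q) \<in> {1..CARD('q)}" by (simp add: Suc_leI One_nat_def)
      have "v CARD('q) \<noteq> 0"
        using orthonormal_onD[OF distinct_svdD(2)[OF svd] q q] by auto
      then have "d CARD('q) \<noteq> 0"
        using ker[of "v CARD('q)"] distinct_svd_mult(2)[OF svd q] by auto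
      then show "0 < d CARD('q)" using distinct_svdD(3)[OF svd q] by simp
    qed
    then show "?X \<in> svd_domain f" using svd unfolding svd_domain_def by blast
  qed
qed

end

theorem theorem2:
  fixes M :: "'a measure"
    and Y :: "'a \<Rightarrow> real ^ 'q ^ 'p"
    and \<mu> :: "real ^ 'q ^ 'p"
    and \<sigma> :: real
    and f f' :: "nat \<Rightarrow> real \<Rightarrow> real"
    and muhat :: "real ^ 'q ^ 'p \<Rightarrow> real ^ 'q ^ 'p"
  assumes "CARD('q) \<le> CARD('p)"
    and "prob_space M"
    and "\<sigma> > 0"
    and "prob_space.indep_vars M (\<lambda>_. borel) (\<lambda>(i, j) \<omega>. Y \<omega> $ i $ j) (UNIV :: ('p \<times> 'q) set)"
    and "\<And>i j. distributed M lborel (\<lambda>\<omega>. Y \<omega> $ i $ j) (normal_density (\<mu> $ i $ j) \<sigma>)"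
    and "\<And>k x. k \<in> {1..CARD('q)} \<Longrightarrow> x \<ge> 0 \<Longrightarrow> f k x \<ge> 0"
    and "\<And>k x. k \<in> {1..<CARD('q)} \<Longrightarrow> x > 0 \<Longrightarrow> (f k has_real_derivative f' k x) (at x)"
    and "\<And>k. k \<in> {1..<CARD('q)} \<Longrightarrow> continuous_on {0<..} (f' k)"
    and "\<And>x. x \<ge> 0 \<Longrightarrow>
           (f CARD('q) has_real_derivative f' CARD('q) x) (at x within {0..})"
    and "continuous_on {0..} (f' CARD('q))"
    and "\<And>k l x. k \<in> {1..CARD('q)} \<Longrightarrow> l \<in> {1..CARD('q)} \<Longrightarrow> k < l \<Longrightarrow> x \<ge> 0 \<Longrightarrow> f k x \<ge> f l x"
    and "\<And>k x. k \<in> {1..CARD('q)} \<Longrightarrow> x > 0 \<Longrightarrow> f' k x \<ge> 0"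
    \<comment> \<open>For \<open>p = q\<close> and \<open>f q 0 > 0\<close> the estimator jumps across the hypersurface of singular matrices
        and SURE is biased, e.g. \<open>p = q = 1\<close>, \<open>f 1 = 1\<close>, where it is the sign function.\<close>
    and "CARD('q) < CARD('p) \<or> f CARD('q) 0 = 0"
    and "spectral_estimator f muhat"
    \<comment> \<open>Expectations are taken in the completion, as values on null sets are irrelevant.\<close>
    and "integrable (completion M) (\<lambda>\<omega>. (norm (muhat (Y \<omega>)))\<^sup>2)"
  shows "integrable (completion M) (\<lambda>\<omega>. sure \<sigma> muhat (Y \<omega>))
       \<and> integrable (completion M) (\<lambda>\<omega>. (norm (muhat (Y \<omega>) - \<mu>))\<^sup>2)
       \<and> (\<integral>\<omega>. sure \<sigma> muhat (Y \<omega>) \<partial>completion M)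
           = (\<integral>\<omega>. (norm (muhat (Y \<omega>) - \<mu>))\<^sup>2 \<partial>completion M)
       \<and> (\<forall>X d u v. distinct_svd X d u v \<and> (d CARD('q) > 0 \<or> f CARD('q) 0 = 0) \<longrightarrow>
            has_divergence_terms muhat X \<and>
            divergence muhat X =
              (real CARD('p) - real CARD('q)) *
                \<comment> \<open>\<open>d k = 0\<close> only for \<open>k = q\<close> and \<open>f q 0 = 0\<close>; the quotient is then its limit.\<close>
                (\<Sum>k=1..CARD('q). if d k = 0 then f' k 0 else f k (d k) / d k)
              + (\<Sum>k=1..CARD('q). f' k (d k))
              + 2 * (\<Sum>k=1..CARD('q). \<Sum>l\<in>{1..CARD('q)} - {k}.
                       d k * f k (d k) / ((d k)\<^sup>2 - (d l)\<^sup>2)))"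
proof -
  let ?p = "CARD('p)" and ?q = "CARD('q)"
  note pq = assms(1) and \<sigma> = assms(3) and est = assms(14)
  interpret prob_space M by (rule assms(2))
  have q1: "?q \<in> {1..?q}" by (simp add: Suc_leI One_nat_def)
  have sf: "spectral_functions ?q f f'"
    unfolding spectral_functions_def
  proof (intro conjI ballI allI impI)
    fix k x assume k: "k \<in> {1..?q}" and x: "(0::real) < x"
    show "(f k has_real_derivative f' k x) (at x)"
    proof (cases "k = ?q")
      case True
      have "(f k has_real_derivative f' k x) (at x within {0..})"
        using assms(9)[of x] x True by simp
      moreover have "at x within {0..} = at x"
        using x by (intro at_within_open_subset[of _ "{0<..}"]) auto
      ultimately show ?thesis by simp
    next
      case False
      then show ?thesis using assms(7)[of k x] k x by simp
    qed
  qed (use assms(6,9,11,12) in auto)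
  define B where "B = restricted_estimator f muhat"
  define D where "D = partial_limit f muhat"
  note B_meas [measurable] = restricted_estimator_measurable[OF pq sf est, folded B_def]
  note D_meas [measurable] = partial_limit_measurable[OF pq sf est, folded D_def]
  define N where "N = (\<lambda>s :: 'p \<times> 'q. normal_measure (\<mu> $ fst s $ snd s) \<sigma>)"
  let ?Q = "Pi\<^sub>M UNIV N"
  have prob_N: "prob_space (N s)" and sets_N[measurable_cong]: "sets (N s) = sets borel"
    and atom_N: "emeasure (N s) {c} = 0" for s c
    unfolding N_def using prob_space_normal_measure[OF \<sigma>] emeasure_normal_measure_singleton by auto
  have sets_Q: "sets ?Q = sets (Pi\<^sub>M UNIV (\<lambda>_. borel))"
    by (rule sets_PiM_cong) (simp_all add: sets_N)
  define T where "T \<omega> = (\<lambda>s. Y \<omega> $ fst s $ snd s)" for \<omega>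
  have Y: "matrix_of (T \<omega>) = Y \<omega>" for \<omega>
    by (simp add: vec_eq_iff T_def)
  have T_nth: "T \<omega> (i, j) = Y \<omega> $ i $ j" for \<omega> i j
    by (simp add: T_def)
  have entry[measurable]: "(\<lambda>\<omega>. Y \<omega> $ i $ j) \<in> borel_measurable M" for i j
    using distributed_measurable[OF assms(5)] by simp
  have T_meas': "T \<in> measurable M (Pi\<^sub>M UNIV (\<lambda>_. borel))"
    by (rule measurable_PiM_single') (auto simp: T_def)
  then have T_meas[measurable]: "T \<in> measurable M ?Q"
    using measurable_cong_sets[OF refl sets_Q] by blast
  have law: "distr M ?Q T = ?Q"
  proof -
    let ?X = "\<lambda>(i, j) \<omega>. Y \<omega> $ i $ j"
    have "distr M (Pi\<^sub>M UNIV (\<lambda>_. borel)) (\<lambda>\<omega>. \<lambda>s\<in>UNIV. ?X s \<omega>) = Pi\<^sub>M UNIV (\<lambda>s. distr M borel (?X s))"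
      using assms(4) by (subst (asm) indep_vars_iff_distr_eq_PiM) auto
    moreover have "(\<lambda>\<omega>. \<lambda>s\<in>UNIV. ?X s \<omega>) = T"
      by (auto simp: T_def fun_eq_iff)
    moreover have "distr M borel (?X s) = N s" for s
    proof -
      obtain i j where s: "s = (i, j)" by (cases s)
      have "distr M borel (\<lambda>\<omega>. Y \<omega> $ i $ j) = distr M lborel (\<lambda>\<omega>. Y \<omega> $ i $ j)"
        by (rule distr_cong) auto
      then show ?thesis
        using distributed_distr_eq_density[OF assms(5)[of i j]] by (simp add: s N_def normal_measure_def)
    qed
    moreover have "distr M (Pi\<^sub>M UNIV (\<lambda>_. borel)) T = distr M ?Q T"
      by (rule distr_cong) (simp_all add: sets_Q)
    ultimately show ?thesis by simp
  qed
  have mat_meas[measurable]: "matrix_of \<in> borel_measurable ?Q"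
    using measurable_matrix_of measurable_cong_sets[OF sets_Q refl] by blast
  have Y_meas[measurable]: "Y \<in> borel_measurable M"
    using measurable_compose[OF T_meas mat_meas] by (simp add: Y)
  have nth_meas[measurable]: "(\<lambda>X :: real ^ 'q ^ 'p. X $ i $ j) \<in> borel_measurable borel" for i j
    by (intro borel_measurable_continuous_onI continuous_intros)
  have Bij_meas[measurable]: "(\<lambda>X. B X $ i $ j) \<in> borel_measurable borel" for i j
    by (rule measurable_compose[OF B_meas nth_meas])
  have transfer: "integrable M (\<lambda>\<omega>. h (T \<omega>)) \<longleftrightarrow> integrable ?Q h" "(\<integral>\<omega>. h (T \<omega>) \<partial>M) = (\<integral>x. h x \<partial>?Q)"
    if "h \<in> borel_measurable ?Q" for h :: "('p \<times> 'q \<Rightarrow> real) \<Rightarrow> real"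
    using integrable_distr_eq[OF T_meas, of h] integral_distr[OF T_meas, of h] that by (simp_all add: law)

  note line = AE_line_svd_domain[OF pq sf est assms(13) prob_N sets_N atom_N]
  have dom: "AE \<omega> in M. Y \<omega> \<in> svd_domain f"
  proof -
    \<comment> \<open>Any coordinate direction serves, since every matrix lies on its own
      line.\<close>
    obtain i :: 'p and j :: 'q where True by simp
    have "AE x in ?Q. matrix_of x \<in> svd_domain f"
      using line[of i j] by eventually_elim (metis fun_upd_triv)
    then have "AE \<omega> in M. matrix_of (T \<omega>) \<in> svd_domain f"
      by (rule AE_distrD[OF T_meas, unfolded law])
    then show ?thesis by (simp add: Y)
  qed
  have B_eq: "B X = muhat X" if "X \<in> svd_domain f" for X
    using that by (simp add: B_def restricted_estimator_def[OF pq sf est])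
  have D_eq: "D i j X = deriv (entry_fun muhat X i j) 0" if "X \<in> svd_domain f" for i j X
    unfolding D_def by (rule partial_limit_eq[OF pq sf est that])

  \<comment> \<open>The second moment is finite in the completion; for the Borel version this
    descends to \<open>M\<close>.\<close>
  have B2: "integrable M (\<lambda>\<omega>. (norm (B (Y \<omega>)))\<^sup>2)"
  proof -
    have "integrable (completion M) (\<lambda>\<omega>. (norm (B (Y \<omega>)))\<^sup>2)"
    proof (rule Bochner_Integration.integrable_cong_AE_imp[OF assms(15)])
      show "(\<lambda>\<omega>. (norm (B (Y \<omega>)))\<^sup>2) \<in> borel_measurable (completion M)"
        by (rule measurable_completion) measurable
      show "AE \<omega> in completion M. (norm (muhat (Y \<omega>)))\<^sup>2 = (norm (B (Y \<omega>)))\<^sup>2"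
        unfolding AE_completion_iff using dom by eventually_elim (simp add: B_eq)
    qed
    then show ?thesis by (subst (asm) integrable_completion) measurable
  qed
  have Bij2: "integrable M (\<lambda>\<omega>. (B (Y \<omega>) $ i $ j)\<^sup>2)" for i j
  proof (rule Bochner_Integration.integrable_bound[OF B2])
    show "AE \<omega> in M. norm ((B (Y \<omega>) $ i $ j)\<^sup>2) \<le> norm ((norm (B (Y \<omega>)))\<^sup>2)"
    proof (rule AE_I2)
      fix \<omega>
      have "\<bar>B (Y \<omega>) $ i $ j\<bar> \<le> norm (B (Y \<omega>))"
        using component_le_norm_cart[of "B (Y \<omega>) $ i" j] Finite_Cartesian_Product.norm_nth_le[of "B (Y \<omega>)" i] by linarith
      then show "norm ((B (Y \<omega>) $ i $ j)\<^sup>2) \<le> norm ((norm (B (Y \<omega>)))\<^sup>2)"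
        by (simp add: abs_le_square_iff[symmetric])
    qed
  qed measurable

  define Z where "Z i j \<omega> = Y \<omega> $ i $ j - \<mu> $ i $ j" for i j \<omega>
  have [measurable]: "Z i j \<in> borel_measurable M" for i j
    unfolding Z_def by measurable
  have Z1: "has_bochner_integral M (Z i j) 0" and Z2: "has_bochner_integral M (\<lambda>\<omega>. (Z i j \<omega>)\<^sup>2) (\<sigma>\<^sup>2)" for i j
  proof -
    have law_ij: "distr M (N (i, j)) (\<lambda>\<omega>. Y \<omega> $ i $ j) = N (i, j)"
    proof -
      have "distr M (N (i, j)) (\<lambda>\<omega>. Y \<omega> $ i $ j) = distr M lborel (\<lambda>\<omega>. Y \<omega> $ i $ j)"
        by (rule distr_cong) (auto simp: sets_N)
      then show ?thesis
        using distributed_distr_eq_density[OF assms(5)[of i j]] by (simp add: N_def normal_measure_def)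
    qed
    have ent: "(\<lambda>\<omega>. Y \<omega> $ i $ j) \<in> measurable M (N (i, j))" by measurable
    have "has_bochner_integral M (\<lambda>\<omega>. g (Y \<omega> $ i $ j)) c"
      if "has_bochner_integral (N (i, j)) g c" for g :: "real \<Rightarrow> real" and c
      using that integrable_distr_eq[OF ent, of g] integral_distr[OF ent, of g]
      by (auto simp: has_bochner_integral_iff law_ij)
    then show "has_bochner_integral M (Z i j) 0" "has_bochner_integral M (\<lambda>\<omega>. (Z i j \<omega>)\<^sup>2) (\<sigma>\<^sup>2)"
      using normal_measure_moment[OF \<sigma>, of "\<mu> $ i $ j"] by (auto simp: Z_def[abs_def] N_def)
  qed
  \<comment> \<open>Here the second moment of the estimator becomes the integrability that Stein's
    identity asks for.\<close>
  have BZ: "integrable M (\<lambda>\<omega>. B (Y \<omega>) $ i $ j * Z i j \<omega>)" for i j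
    by (rule integrable_mult_square) (use Bij2 Z2 in \<open>auto simp: has_bochner_integral_iff\<close>)

  have stein: "integrable M (\<lambda>\<omega>. D i j (Y \<omega>))"
    "(\<integral>\<omega>. B (Y \<omega>) $ i $ j * Z i j \<omega> \<partial>M) = \<sigma>\<^sup>2 * (\<integral>\<omega>. D i j (Y \<omega>) \<partial>M)" for i j
  proof -
    let ?H = "\<lambda>x. B (matrix_of x) $ i $ j" and ?D = "\<lambda>x. D i j (matrix_of x)"
    have H: "?H \<in> borel_measurable ?Q" and Dm: "?D \<in> borel_measurable ?Q"
      by measurable
    have HZ: "(\<lambda>x. ?H x * (x (i, j) - \<mu> $ i $ j)) \<in> borel_measurable ?Q"
      using H by measurable
    have lineD: "AE x in ?Q. \<forall>t. ((\<lambda>t. ?H (x((i, j) := t))) has_real_derivative ?D (x((i, j) := t))) (at t)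
        \<and> 0 \<le> ?D (x((i, j) := t))"
      using line[of i j]
    proof eventually_elim
      case (elim x)
      show ?case
        using line_DERIV[OF pq sf est, of x i j] svd_domain_entry_DERIV(2)[OF pq sf est] elim
        by (simp add: B_eq D_eq)
    qed
    have int: "integrable ?Q (\<lambda>x. ?H x * (x (i, j) - \<mu> $ i $ j))"
      using BZ[of i j] transfer(1)[OF HZ] by (simp add: Y Z_def T_nth)
    note S = stein_product[where m = "\<lambda>s. \<mu> $ fst s $ snd s" and s = "(i, j)" and \<sigma> = \<sigma>, folded N_def, OF \<sigma> H Dm lineD]
    show "integrable M (\<lambda>\<omega>. D i j (Y \<omega>))"
      using S(1) int transfer(1)[OF Dm] by (simp add: Y)
    show "(\<integral>\<omega>. B (Y \<omega>) $ i $ j * Z i j \<omega> \<partial>M) = \<sigma>\<^sup>2 * (\<integral>\<omega>. D i j (Y \<omega>) \<partial>M)"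
      using S(2) int transfer(2)[OF Dm] transfer(2)[OF HZ] by (simp add: Y Z_def T_nth)
  qed

  define R where "R \<omega> = (norm (B (Y \<omega>) - \<mu>))\<^sup>2" for \<omega>
  \<comment> \<open>The share of the entry \<open>(i, j)\<close> in \<open>S - R\<close>, apart from
    the constant. In expectation Stein's identity cancels the first summand against the last and
    \<open>Z\<close> has mean zero, so \<open>\<sigma>\<^sup>2\<close> remains; its
    \<open>p q\<close> copies match the constant subtracted in SURE.\<close>
  define W where "W i j \<omega> = - 2 * (B (Y \<omega>) $ i $ j * Z i j \<omega>) + 2 * \<mu> $ i $ j * Z i j \<omega> + (Z i j \<omega>)\<^sup>2
      + 2 * \<sigma>\<^sup>2 * D i j (Y \<omega>)" for i j \<omega>
  define S where "S \<omega> = (norm (Y \<omega> - B (Y \<omega>)))\<^sup>2 - \<sigma>\<^sup>2 * real ?p * real ?q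
      + 2 * \<sigma>\<^sup>2 * (\<Sum>i\<in>UNIV. \<Sum>j\<in>UNIV. D i j (Y \<omega>))" for \<omega>
  have R_meas: "R \<in> borel_measurable M" and S_meas: "S \<in> borel_measurable M"
    unfolding R_def[abs_def] S_def[abs_def] by measurable
  have R_int: "integrable M R"
  proof (rule Bochner_Integration.integrable_bound)
    show "integrable M (\<lambda>\<omega>. 2 * (norm (B (Y \<omega>)))\<^sup>2 + 2 * (norm \<mu>)\<^sup>2)"
      using B2 by simp
    show "AE \<omega> in M. norm (R \<omega>) \<le> norm (2 * (norm (B (Y \<omega>)))\<^sup>2 + 2 * (norm \<mu>)\<^sup>2)"
    proof (rule AE_I2)
      fix \<omega>
      \<comment> \<open>By the parallelogram law the gap in the next bound is the squared norm of
        \<open>B (Y \<omega>) + \<mu>\<close>.\<close>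
      have "0 \<le> (B (Y \<omega>) + \<mu>) \<bullet> (B (Y \<omega>) + \<mu>)" by (rule inner_ge_zero)
      then have "R \<omega> \<le> 2 * (norm (B (Y \<omega>)))\<^sup>2 + 2 * (norm \<mu>)\<^sup>2"
        by (simp add: R_def power2_norm_eq_inner inner_add_left inner_add_right inner_diff_left inner_diff_right inner_commute)
      moreover have "0 \<le> R \<omega>" by (simp add: R_def)
      ultimately show "norm (R \<omega>) \<le> norm (2 * (norm (B (Y \<omega>)))\<^sup>2 + 2 * (norm \<mu>)\<^sup>2)"
        by simp
    qed
  qed (rule R_meas)
  have W: "has_bochner_integral M (W i j) (\<sigma>\<^sup>2)" for i j
  proof -
    define c where "c = (\<integral>\<omega>. D i j (Y \<omega>) \<partial>M)"
    have 1: "has_bochner_integral M (\<lambda>\<omega>. B (Y \<omega>) $ i $ j * Z i j \<omega>) (\<sigma>\<^sup>2 * c)"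
      using BZ stein(2) by (simp add: has_bochner_integral_iff c_def)
    have 2: "has_bochner_integral M (\<lambda>\<omega>. D i j (Y \<omega>)) c"
      using stein(1) by (simp add: has_bochner_integral_iff c_def)
    have "has_bochner_integral M (W i j) (- 2 * (\<sigma>\<^sup>2 * c) + 2 * \<mu> $ i $ j * 0 + \<sigma>\<^sup>2 + 2 * \<sigma>\<^sup>2 * c)"
      unfolding W_def[abs_def]
      by (intro has_bochner_integral_add has_bochner_integral_mult_right 1 2 Z1 Z2)
    then show ?thesis by simp
  qed
  have S_eq: "S \<omega> = R \<omega> + (\<Sum>i\<in>UNIV. \<Sum>j\<in>UNIV. W i j \<omega>) - \<sigma>\<^sup>2 * real ?p * real ?q" for \<omega>
  proof -
    let ?B = "B (Y \<omega>)" and ?Z = "Y \<omega> - \<mu>"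
    \<comment> \<open>Noise minus estimation error: the cross term of the square splits into the
      product treated by Stein's identity and a term linear in the noise.\<close>
    have "Y \<omega> - ?B = ?Z - (?B - \<mu>)" by simp
    then have "(norm (Y \<omega> - ?B))\<^sup>2 = R \<omega> - 2 * (?B \<bullet> ?Z) + 2 * (\<mu> \<bullet> ?Z) + ?Z \<bullet> ?Z"
      by (simp only: R_def power2_norm_eq_inner inner_diff_left inner_diff_right inner_commute)
        (simp add: inner_commute algebra_simps)
    also have "\<dots> = R \<omega> + (\<Sum>i\<in>UNIV. \<Sum>j\<in>UNIV. - 2 * (?B $ i $ j * Z i j \<omega>) + 2 * \<mu> $ i $ j * Z i j \<omega> + (Z i j \<omega>)\<^sup>2)"
      unfolding inner_matrix by (simp add: Z_def sum.distrib sum_distrib_left sum_subtractf mult.assoc power2_eq_square)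
    finally show ?thesis
      by (simp add: S_def W_def sum.distrib sum_distrib_left)
  qed
  have "has_bochner_integral M (\<lambda>\<omega>. R \<omega> + (\<Sum>i\<in>UNIV. \<Sum>j\<in>UNIV. W i j \<omega>) - \<sigma>\<^sup>2 * real ?p * real ?q)
      ((\<integral>\<omega>. R \<omega> \<partial>M) + (\<Sum>i\<in>(UNIV :: 'p set). \<Sum>j\<in>(UNIV :: 'q set). \<sigma>\<^sup>2) - \<sigma>\<^sup>2 * real ?p * real ?q)"
    by (intro has_bochner_integral_add has_bochner_integral_diff has_bochner_integral_sum W)
      (use R_int in \<open>auto simp: has_bochner_integral_iff prob_space\<close>)
  then have S_int: "has_bochner_integral M S (\<integral>\<omega>. R \<omega> \<partial>M)"
    unfolding S_eq[abs_def, symmetric] by (simp add: mult_ac)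

  have AE_S: "AE \<omega> in M. S \<omega> = sure \<sigma> muhat (Y \<omega>)"
    using dom by eventually_elim (simp add: S_def sure_def divergence_def B_eq D_eq)
  have AE_R: "AE \<omega> in M. R \<omega> = (norm (muhat (Y \<omega>) - \<mu>))\<^sup>2"
    using dom by eventually_elim (simp add: R_def B_eq)
  \<comment> \<open>The return from the Borel versions to the estimator itself, for which the
    completion is required.\<close>
  have comp: "integrable (completion M) h' \<and> (\<integral>\<omega>. h' \<omega> \<partial>completion M) = (\<integral>\<omega>. h \<omega> \<partial>M)"
    if "integrable M h" "AE \<omega> in M. h \<omega> = h' \<omega>" for h h' :: "'a \<Rightarrow> real"
  proof -
    have hm: "h \<in> borel_measurable M" using that(1) by (rule borel_measurable_integrable)
    have h'm: "h' \<in> borel_measurable (completion M)" by (rule measurable_completion_AE[OF hm that(2)])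
    have ae: "AE \<omega> in completion M. h \<omega> = h' \<omega>" using that(2) by (simp add: AE_completion_iff)
    have "integrable (completion M) h" using that(1) hm by (simp add: integrable_completion)
    from Bochner_Integration.integrable_cong_AE_imp[OF this h'm] ae
    have "integrable (completion M) h'" by (auto elim: eventually_mono)
    moreover have "(\<integral>\<omega>. h' \<omega> \<partial>completion M) = (\<integral>\<omega>. h \<omega> \<partial>completion M)"
      by (rule integral_cong_AE[OF h'm measurable_completion[OF hm]]) (use ae in \<open>auto elim: eventually_mono\<close>)
    ultimately show ?thesis using hm by (simp add: integral_completion)
  qed
  have "has_divergence_terms muhat X \<and>
      divergence muhat X =
        (real ?p - real ?q) * (\<Sum>k=1..?q. if d k = 0 then f' k 0 else f k (d k) / d k)
        + (\<Sum>k=1..?q. f' k (d k))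
        + 2 * (\<Sum>k=1..?q. \<Sum>l\<in>{1..?q} - {k}. d k * f k (d k) / ((d k)\<^sup>2 - (d l)\<^sup>2))"
    if "distinct_svd X d u v" "d ?q > 0 \<or> f ?q 0 = 0" for X d u v
    using divergence_spectral_estimator[OF pq sf est that] sum_partial_deriv[OF that(1), of f f']
    by (simp add: quotient_fun_def)
  then show ?thesis
    using comp[OF _ AE_S] comp[OF R_int AE_R] S_int by (auto simp: has_bochner_integral_iff)
qed

end
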